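(* Let $4 \leq d < n$. Among all trees on $n$ vertices with diameter $d$, the meeting time $T_{\mathsf{meet}}(G)$ is minimized uniquely (up to isomorphism) by (a) the balanced double broom $D_{n,d}$ when $n$ and $d$ have opposite parities, with $$T_{\mathsf{meet}}(D_{n,d}) = H(\pi, v_d) = \frac{1}{2}(d+2) n + \frac{d^3-6 d^2+8 d }{6(n-1)} -\frac{1}{2}(d+5);$$ (b) the balanced near double broom $D'_{n,d}$ when $n$ and $d$ have the same parity, with $$T_{\mathsf{meet}}(D'_{n,d}) = \begin{cases} \frac{1}{2}(d+2)n + \frac{d^3-3d^2-d+6}{6(n-1)} - \frac{1}{2}(d+5) & \text{if } d \text{ is even},\\[2pt] \frac{1}{2}(d+2)n + \frac{d^3-3d^2-d+3}{6(n-1)} - \frac{1}{2}(d+3) & \text{if } d \text{ is odd}.\end{cases}$$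
   Context: For a connected graph $G=(V,E)$ and simple random walk on $G$ (each step moves to a uniformly random neighbor), $H(u,v)$ is the expected number of steps for the walk from $u$ to reach $v$ ($H(u,u)=0$), $\pi_v=\deg(v)/2|E|$, $H(\pi,w)=\sum_v \pi_v H(v,w)$ and $T_{\mathsf{meet}}(G)=\max_{w}H(\pi,w)$. A double broom of diameter $d$ consists of a path $v_1,\ldots,v_{d-1}$, leaves $u_1,\ldots,u_\ell$ ($\ell\ge1$) adjacent to $v_1$ and leaves $w_1,\ldots,w_r$ ($r\ge1$) adjacent to $v_{d-1}$, with $v_0=u_1$, $v_d=w_1$ and $n=\ell+r+d-1$. The balanced double broom $D_{n,d}$ has $\ell=\lfloor (n-d+1)/2\rfloor$, $r=\lceil (n-d+1)/2\rceil$. A near double broom is a tree that is not a double broom but has a leaf $z$ (the singleton leaf) whose removal yields a double broom. The balanced near double broom $D'_{n,d}$ consists of a path $v_1,\ldots,v_{d-1}$, $\ell=\lfloor (n-d)/2\rfloor$ leaves adjacent to $v_1$, $r=\lceil (n-d)/2\rceil$ leaves adjacent to $v_{d-1}$, and one further leaf $z$ adjacent to $v_{\lfloor d/2\rfloor}$. *)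

theory Defs
  imports "HOL-Probability.Probability"
begin

section \<open>Finite simple graphs and trees\<close>

record 'a ugraph =
  verts :: "'a set"
  edges :: "'a set set"

definition simple_graph :: "'a ugraph \<Rightarrow> bool" where
  "simple_graph G \<longleftrightarrow> finite (verts G) \<and> (\<forall>e\<in>edges G. e \<subseteq> verts G \<and> card e = 2)"

definition nbrs :: "'a ugraph \<Rightarrow> 'a \<Rightarrow> 'a set" where
  "nbrs G v = {w \<in> verts G. {v, w} \<in> edges G}"

definition deg :: "'a ugraph \<Rightarrow> 'a \<Rightarrow> nat" where
  "deg G v = card (nbrs G v)"

definition is_walk :: "'a ugraph \<Rightarrow> 'a list \<Rightarrow> bool" where
  "is_walk G xs \<longleftrightarrow>
     xs \<noteq> [] \<and> set xs \<subseteq> verts G \<and> successively (\<lambda>x y. {x, y} \<in> edges G) xs"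

definition walk_between :: "'a ugraph \<Rightarrow> 'a \<Rightarrow> 'a list \<Rightarrow> 'a \<Rightarrow> bool" where
  "walk_between G u xs v \<longleftrightarrow> is_walk G xs \<and> hd xs = u \<and> last xs = v"

definition connected_graph :: "'a ugraph \<Rightarrow> bool" where
  "connected_graph G \<longleftrightarrow>
     verts G \<noteq> {} \<and> (\<forall>u\<in>verts G. \<forall>v\<in>verts G. \<exists>xs. walk_between G u xs v)"

text \<open>A cycle is given by its list of pairwise distinct vertices; the closing edge joins the
  last vertex to the first.\<close>

definition is_cycle :: "'a ugraph \<Rightarrow> 'a list \<Rightarrow> bool" where
  "is_cycle G xs \<longleftrightarrow>
     is_walk G xs \<and> distinct xs \<and> length xs \<ge> 3 \<and> {last xs, hd xs} \<in> edges G"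

definition is_tree :: "'a ugraph \<Rightarrow> bool" where
  "is_tree G \<longleftrightarrow> simple_graph G \<and> connected_graph G \<and> (\<nexists>xs. is_cycle G xs)"

definition graph_dist :: "'a ugraph \<Rightarrow> 'a \<Rightarrow> 'a \<Rightarrow> nat" where
  "graph_dist G u v = (LEAST k. \<exists>xs. walk_between G u xs v \<and> length xs = Suc k)"

definition diam :: "'a ugraph \<Rightarrow> nat" where
  "diam G = Max {graph_dist G u v |u v. u \<in> verts G \<and> v \<in> verts G}"

definition graph_iso :: "'a ugraph \<Rightarrow> 'b ugraph \<Rightarrow> bool" where
  "graph_iso G H \<longleftrightarrow> (\<exists>f. bij_betw f (verts G) (verts H) \<and>
     (\<forall>u\<in>verts G. \<forall>v\<in>verts G. {u, v} \<in> edges G \<longleftrightarrow> {f u, f v} \<in> edges H))"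

definition trees_with_diam :: "nat \<Rightarrow> nat \<Rightarrow> 'a ugraph set" where
  "trees_with_diam n d = {G. is_tree G \<and> card (verts G) = n \<and> diam G = d}"

section \<open>Simple random walk, hitting times and meeting time\<close>

text \<open>
  The kernel maps the time \<open>i\<close> and the past \<open>\<omega> 0, \<dots>, \<omega> (i - 1)\<close> of a trajectory to the
  distribution of \<open>\<omega> i\<close>: the walk starts in \<open>u\<close> and then always moves to a uniformly random
  neighbour of its current position.
\<close>

definition srw_kernel :: "'a ugraph \<Rightarrow> 'a \<Rightarrow> nat \<Rightarrow> (nat \<Rightarrow> 'a) \<Rightarrow> 'a measure" where
  "srw_kernel G u i \<omega> =
     uniform_measure (count_space (verts G)) (if i = 0 then {u} else nbrs G (\<omega> (i - 1)))"

text \<open>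
  The law of the whole trajectory is the measure on \<open>nat \<Rightarrow> 'a\<close> that the theorem of Ionescu
  Tulcea associates with this kernel.
\<close>

definition srw :: "'a ugraph \<Rightarrow> 'a \<Rightarrow> (nat \<Rightarrow> 'a) measure" where
  "srw G u =
     projective_family.lim UNIV
       (Ionescu_Tulcea.CI (srw_kernel G u) (\<lambda>_. count_space (verts G)))
       (\<lambda>_. count_space (verts G))"

lemma Ionescu_Tulcea_srw_kernel:
  assumes G: "simple_graph G" "connected_graph G" "card (verts G) \<ge> 2" and u: "u \<in> verts G"
  shows "Ionescu_Tulcea (srw_kernel G u) (\<lambda>_. count_space (verts G))"
proof (rule Ionescu_Tulcea.intro)
  have fin: "finite (verts G)" using G by (simp add: simple_graph_def)
  have ne: "nbrs G v \<noteq> {}" if v: "v \<in> verts G" for v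
  proof -
    obtain w where w: "w \<in> verts G" "w \<noteq> v"
      using G(3) fin v by (metis One_nat_def Suc_1 card_le_Suc0_iff_eq not_less_eq_eq)
    then obtain xs where xs: "walk_between G v xs w"
      using G(2) v by (auto simp: connected_graph_def)
    then obtain y ys where "xs = v # y # ys"
      using w(2) unfolding walk_between_def is_walk_def
      by (metis last_ConsL list.collapse)
    with xs show ?thesis
      by (auto simp: walk_between_def is_walk_def nbrs_def)
  qed
  have sub: "nbrs G v \<subseteq> verts G" for v by (auto simp: nbrs_def)
  have prob: "prob_space (uniform_measure (count_space (verts G)) N)"
    if "N \<noteq> {}" "N \<subseteq> verts G" for N
    using that fin by (intro prob_space_uniform_measure)
      (auto simp: emeasure_count_space finite_subset)
  show "srw_kernel G u i \<in>
      PiM {0..<i} (\<lambda>_. count_space (verts G)) \<rightarrow>\<^sub>M subprob_algebra (count_space (verts G))" for i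
  proof (cases i)
    case 0
    have "uniform_measure (count_space (verts G)) {u} \<in> space (subprob_algebra (count_space (verts G)))"
      using prob[of "{u}"] u by (auto simp: space_subprob_algebra prob_space_imp_subprob_space)
    then show ?thesis by (simp add: 0 srw_kernel_def[abs_def])
  next
    case (Suc k)
    have step: "(\<lambda>v. uniform_measure (count_space (verts G)) (nbrs G v))
        \<in> count_space (verts G) \<rightarrow>\<^sub>M subprob_algebra (count_space (verts G))"
      using prob[OF ne sub]
      by (auto simp: space_subprob_algebra prob_space_imp_subprob_space)
    have "(\<lambda>\<omega>. \<omega> k) \<in> PiM {0..<i} (\<lambda>_. count_space (verts G)) \<rightarrow>\<^sub>M count_space (verts G)"
      by (rule measurable_component_singleton) (simp add: Suc)
    from measurable_compose[OF this step] show ?thesis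
      by (simp add: Suc srw_kernel_def[abs_def])
  qed
  show "prob_space (srw_kernel G u i x)"
    if "x \<in> space (PiM {0..<i} (\<lambda>_. count_space (verts G)))" for i x
    unfolding srw_kernel_def using that u ne sub
    by (intro prob) (auto simp: space_PiM PiE_iff)
qed

text \<open>The first \<open>t\<close> with \<open>\<omega> t = v\<close>; it is \<open>\<infinity>\<close> if there is none.\<close>

definition hitting_time :: "'a \<Rightarrow> (nat \<Rightarrow> 'a) \<Rightarrow> ennreal" where
  "hitting_time v \<omega> = (INF t\<in>{t. \<omega> t = v}. of_nat t)"

definition expected_hitting_time :: "'a ugraph \<Rightarrow> 'a \<Rightarrow> 'a \<Rightarrow> ennreal" where
  "expected_hitting_time G u v = (\<integral>\<^sup>+ \<omega>. hitting_time v \<omega> \<partial>srw G u)"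

definition stat :: "'a ugraph \<Rightarrow> 'a \<Rightarrow> real" where
  "stat G v = real (deg G v) / (2 * real (card (edges G)))"

definition H_stat :: "'a ugraph \<Rightarrow> 'a \<Rightarrow> ennreal" where
  "H_stat G w = (\<Sum>v\<in>verts G. ennreal (stat G v) * expected_hitting_time G v w)"

definition T_meet :: "'a ugraph \<Rightarrow> ennreal" where
  "T_meet G = Max (H_stat G ` verts G)"

section \<open>Balanced (near) double brooms\<close>

text \<open>\<open>Path i\<close>, \<open>LeftLeaf j\<close>, \<open>RightLeaf j\<close> and \<open>Singleton\<close> stand for \<open>v\<^sub>i\<close>, \<open>u\<^sub>j\<close>, \<open>w\<^sub>j\<close> and \<open>z\<close>;
  in particular \<open>v\<^sub>0 = u\<^sub>1\<close> is \<open>LeftLeaf 1\<close> and \<open>v\<^sub>d = w\<^sub>1\<close> is \<open>RightLeaf 1\<close>.\<close>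

datatype broom_vertex = Path nat | LeftLeaf nat | RightLeaf nat | Singleton

definition double_broom :: "nat \<Rightarrow> nat \<Rightarrow> nat \<Rightarrow> broom_vertex ugraph" where
  "double_broom d l r =
     \<lparr>verts = Path ` {1..d - 1} \<union> LeftLeaf ` {1..l} \<union> RightLeaf ` {1..r},
      edges = (\<lambda>i. {Path i, Path (i + 1)}) ` {1..<d - 1}
        \<union> (\<lambda>j. {LeftLeaf j, Path 1}) ` {1..l}
        \<union> (\<lambda>j. {RightLeaf j, Path (d - 1)}) ` {1..r}\<rparr>"

text \<open>On the natural numbers, \<open>k div 2\<close> and \<open>(k + 1) div 2\<close> are the floor and the ceiling
  of \<open>k / 2\<close>.\<close>

definition balanced_double_broom :: "nat \<Rightarrow> nat \<Rightarrow> broom_vertex ugraph" where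
  "balanced_double_broom n d =
     double_broom d ((n - d + 1) div 2) ((n - d + 1 + 1) div 2)"

definition balanced_near_double_broom :: "nat \<Rightarrow> nat \<Rightarrow> broom_vertex ugraph" where
  "balanced_near_double_broom n d =
     (let B = double_broom d ((n - d) div 2) ((n - d + 1) div 2)
      in \<lparr>verts = insert Singleton (verts B),
          edges = insert {Singleton, Path (d div 2)} (edges B)\<rparr>)"

end

(*
In a tree with n = m + 1 vertices, moving one step along an edge towards the target w takes
2 s - 1 expected steps, s being the number of vertices on the side of the edge away from w, so
H(pi, w) = (1 / 2m) * sum over the edges of (2 s - 1)^2. Let v_0, ..., v_d be a diametral path
and put y_i = 2 s_i - n for its i-th edge, where s_i counts the vertices on the side of v_d.
Averaging the values at v_0 and v_d gives, up to constants,
2m T_meet >= sum y_i^2 + 2m |sum y_i| + (contribution of the edges off the path),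
with equality for caterpillars. Off-path edges contribute least when they are pendant. The inner
y_i form a decreasing sequence with gaps at least 2 and the parity of n: if n + d is odd the optimum
is the symmetric sequence of consecutive values; if n + d is even no such symmetric sequence
exists, and it is best to skip the value 0 (d even) or one of 1, -1 (d odd), which places a single
leaf at the middle of the spine.
*)
theory Submission
  imports Defs
begin

section \<open>Hitting times from a potential\<close>


text \<open>The expected hitting time is an integral over infinite trajectories. It is identified
  with an explicit function, a signed sum over the edges of a tree path, by solving the discrete
  Dirichlet problem. Write m = n - 1. On a spine edge the slope is y_i + m or y_i - m, so only the
  sign of the cross term 2 m y_i sees the target. At the two ends of the spine the totals of the
  cross terms are opposite, and the larger of the two values carries the absolute value. The extreme
  values n - 2 and 2 - n are forced and cancel in the sum, which leaves N = d - 2 free integers. The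
  centred run N - 1, N - 3, ..., 1 - N has the parity of d - 1; this is where the parity of n + d
  enters. If it is wrong, shifting the run by 1 would change its sum by N, and the weight 2 m of the
  sum is too large for that: here n >= d + 2, so m >= N + 3. For odd d there are two optimal
  sequences, but they belong to one tree whose spine is read from either end, so uniqueness up to
  isomorphism survives.\<close>

lemma (in Ionescu_Tulcea) up_to_Ico: "up_to {0..<n} = n"
proof (rule antisym)
  show "up_to {0..<n} \<le> n" by (simp add: up_to_iff_Ico)
  show "n \<le> up_to {0..<n}"
  proof (cases n)
    case (Suc m)
    then show ?thesis using up_to_less[of "{0..<n}" m] by auto
  qed simp
qed

text \<open>An integrand that looks at the first n coordinates only sees the n-step marginal, which
  \<open>C 0 n\<close> builds kernel by kernel. All later integrals over trajectories are reduced to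
  finite horizons in this way.\<close>

lemma (in Ionescu_Tulcea) nn_integral_lim:
  assumes f: "f \<in> borel_measurable (PiM {0..<n} M)"
  shows "(\<integral>\<^sup>+\<omega>. f (restrict \<omega> {0..<n}) \<partial>PF.lim) = (\<integral>\<^sup>+\<omega>. f \<omega> \<partial>C 0 n (\<lambda>_. undefined))"
proof -
  let ?u = "\<lambda>_::nat. undefined::'a"
  have u: "?u \<in> space (PiM {0..<0} M)" by (simp add: space_PiM)
  have sp: "space (C 0 n ?u) = space (PiM {0..<n} M)"
    using space_C[OF u, of n] by simp
  have st: "sets (C 0 n ?u) = sets (PiM {0..<n} M)"
    using sets_C[OF u, of n] by simp
  have "(\<integral>\<^sup>+\<omega>. f (restrict \<omega> {0..<n}) \<partial>PF.lim) =
      (\<integral>\<^sup>+\<omega>. f \<omega> \<partial>distr PF.lim (PiM {0..<n} M) (\<lambda>\<omega>. restrict \<omega> {0..<n}))"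
    using f by (subst nn_integral_distr)
      (auto simp: measurable_cong_sets[OF PF.sets_lim refl] intro!: measurable_restrict_subset)
  also have "\<dots> = (\<integral>\<^sup>+\<omega>. f \<omega> \<partial>CI {0..<n})"
    by (simp add: distr_lim)
  also have "\<dots> = (\<integral>\<^sup>+\<omega>. f (restrict \<omega> {0..<n}) \<partial>C 0 n ?u)"
    unfolding CI_def up_to_Ico using f by (subst nn_integral_distr)
      (auto simp: measurable_cong_sets[OF st refl] intro!: measurable_restrict_subset)
  also have "\<dots> = (\<integral>\<^sup>+\<omega>. f \<omega> \<partial>C 0 n ?u)"
    by (rule nn_integral_cong) (simp add: sp space_PiM PiE_restrict)
  finally show ?thesis .
qed

text \<open>The tower property for the last step; it exposes the kernel at time n, hence the average
  over the neighbours.\<close>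

lemma (in Ionescu_Tulcea) nn_integral_C_Suc:
  assumes f: "f \<in> borel_measurable (PiM {0..<Suc n} M)"
  shows "(\<integral>\<^sup>+\<omega>. f \<omega> \<partial>C 0 (Suc n) (\<lambda>_. undefined)) =
    (\<integral>\<^sup>+\<omega>. (\<integral>\<^sup>+x. f (fun_upd \<omega> n x) \<partial>P n \<omega>) \<partial>C 0 n (\<lambda>_. undefined))"
proof -
  let ?u = "\<lambda>_::nat. undefined::'a"
  have u: "?u \<in> space (PiM {0..<0} M)" by (simp add: space_PiM)
  have sp: "space (C 0 n ?u) = space (PiM {0..<n} M)"
    using space_C[OF u, of n] by simp
  have st: "sets (C 0 n ?u) = sets (PiM {0..<n} M)"
    using sets_C[OF u, of n] by simp
  have "(\<integral>\<^sup>+\<omega>. f \<omega> \<partial>C 0 (Suc n) ?u) = (\<integral>\<^sup>+\<omega>. (\<integral>\<^sup>+x. f x \<partial>eP n \<omega>) \<partial>C 0 n ?u)"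
    using f by (simp, subst nn_integral_bind[where B="PiM {0..<Suc n} M"])
      (auto simp: measurable_cong_sets[OF st refl])
  also have "\<dots> = (\<integral>\<^sup>+\<omega>. (\<integral>\<^sup>+x. f (fun_upd \<omega> n x) \<partial>P n \<omega>) \<partial>C 0 n ?u)"
    using f by (intro nn_integral_cong nn_integral_eP) (simp_all add: sp)
  finally show ?thesis .
qed

text \<open>The tail-sum formula: the k-th term is the indicator that the hitting time exceeds k.
  Each term depends on finitely many coordinates, and the formula also covers trajectories that
  never reach v.\<close>

lemma hitting_time_eq_suminf:
  "hitting_time v \<omega> = (\<Sum>k. if \<forall>i\<le>k. \<omega> i \<noteq> v then 1 else 0)"
proof (cases "\<exists>t. \<omega> t = v")
  case False
  then have "hitting_time v \<omega> = \<top>" by (simp add: hitting_time_def)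
  moreover have "(\<Sum>k. if \<forall>i\<le>k. \<omega> i \<noteq> v then 1 else 0) = (\<Sum>k::nat. 1::ennreal)"
    using False by simp
  moreover have "\<dots> = \<top>"
  proof -
    have "of_nat n \<le> (\<Sum>k::nat. 1::ennreal)" for n
      using sum_le_suminf[of "\<lambda>_. 1::ennreal" "{..<n}"] by simp
    then show ?thesis
      by (metis ennreal_SUP_of_nat_eq_top SUP_le_iff top.extremum_uniqueI)
  qed
  ultimately show ?thesis by simp
next
  case True
  define t where "t = (LEAST t. \<omega> t = v)"
  have t: "\<omega> t = v" "\<And>s. s < t \<Longrightarrow> \<omega> s \<noteq> v"
    using True unfolding t_def by (auto intro: LeastI_ex dest: not_less_Least)
  have "hitting_time v \<omega> = of_nat t"
    unfolding hitting_time_def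
  proof (rule antisym)
    show "(INF t\<in>{t. \<omega> t = v}. of_nat t) \<le> (of_nat t :: ennreal)"
      by (rule INF_lower) (simp add: t)
    show "(of_nat t :: ennreal) \<le> (INF t\<in>{t. \<omega> t = v}. of_nat t)"
      by (rule INF_greatest) (use t in \<open>auto simp: not_less[symmetric]\<close>)
  qed
  moreover have "(\<Sum>k. if \<forall>i\<le>k. \<omega> i \<noteq> v then 1 else 0 :: ennreal)
      = (\<Sum>k<t. if \<forall>i\<le>k. \<omega> i \<noteq> v then 1 else 0)"
    by (rule suminf_finite) (use t(1) in \<open>auto simp: not_less\<close>)
  moreover have "\<dots> = (\<Sum>k<t. 1)"
    by (rule sum.cong) (use t in auto)
  ultimately show ?thesis by simp
qed

text \<open>By \<open>step\<close>, one move from a vertex other than w lowers the mean of g by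
  exactly one. Hence the mean of g on the event that w is still unvisited telescopes against the
  tail probabilities, whose sum is the expected hitting time. The partial sums of the tails stay
  below g u, so the tails tend to 0, and with them the remainder, which is at most a constant times
  a tail.\<close>

theorem expected_hitting_time_eqI:
  fixes g :: "'a \<Rightarrow> real"
  assumes G: "simple_graph G" "connected_graph G" "card (verts G) \<ge> 2"
    and u: "u \<in> verts G" and w: "w \<in> verts G"
    and nonneg: "\<And>v. v \<in> verts G \<Longrightarrow> 0 \<le> g v" and gw: "g w = 0"
    and step: "\<And>v. v \<in> verts G \<Longrightarrow> v \<noteq> w \<Longrightarrow>
      (\<Sum>x\<in>nbrs G v. g x) + deg G v = deg G v * g v"
    and pos: "\<And>v. v \<in> verts G \<Longrightarrow> 0 < deg G v"
  shows "expected_hitting_time G u w = ennreal (g u)"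
proof -
  let ?V = "verts G"
  interpret Ionescu_Tulcea "srw_kernel G u" "\<lambda>_. count_space ?V"
    by (rule Ionescu_Tulcea_srw_kernel[OF G u])
  let ?PM = "\<lambda>n::nat. PiM {0..<n} (\<lambda>_. count_space ?V)"
  let ?C = "\<lambda>n. C 0 n (\<lambda>_. undefined)"
  have fin: "finite ?V" using G by (simp add: simple_graph_def)
  have finN: "finite (nbrs G v)" for v using fin by (simp add: nbrs_def)
  have u0: "(\<lambda>_. undefined) \<in> space (?PM 0)" by (simp add: space_PiM)
  have spC: "space (?C n) = space (?PM n)" and stC: "sets (?C n) = sets (?PM n)" for n
    using space_C[OF u0, of n] sets_C[OF u0, of n] by auto
  have uni: "(\<integral>\<^sup>+x. f x \<partial>uniform_measure (count_space ?V) N) = (\<Sum>x\<in>N. f x) / of_nat (card N)"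
    if "N \<subseteq> ?V" for f N
  proof -
    have "(\<integral>\<^sup>+x. f x \<partial>uniform_measure (count_space ?V) N) =
      (\<integral>\<^sup>+x. f x * indicator N x \<partial>count_space ?V) / emeasure (count_space ?V) N"
      using that by (intro nn_integral_uniform_measure) auto
    also have "emeasure (count_space ?V) N = of_nat (card N)"
      using that fin by (subst emeasure_count_space) (auto simp: finite_subset)
    also have "(\<integral>\<^sup>+x. f x * indicator N x \<partial>count_space ?V) = (\<Sum>x\<in>N. f x)"
    proof (subst nn_integral_count_space_finite[OF fin])
      show "(\<Sum>x\<in>?V. f x * indicator N x) = (\<Sum>x\<in>N. f x)"
        using that fin by (intro sum.mono_neutral_cong_right) auto
    qed
    finally show ?thesis .
  qed
  \<comment> \<open>This is E[f(X_k); w not visited up to time k]; with f = 1 it is the tail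
    probability at k.\<close>
  define A where "A k f = (\<integral>\<^sup>+\<omega>. (if \<forall>i\<le>k. \<omega> i \<noteq> w then f (\<omega> k) else 0) \<partial>?C (Suc k))"
    for k and f :: "'a \<Rightarrow> ennreal"
  have meas: "(\<lambda>\<omega>. if \<forall>i\<le>k. \<omega> i \<noteq> w then f (\<omega> k) else 0) \<in> borel_measurable (?PM (Suc k))"
    for k and f :: "'a \<Rightarrow> ennreal"
  proof -
    have c: "(\<lambda>\<omega>. \<omega> i) \<in> ?PM (Suc k) \<rightarrow>\<^sub>M count_space ?V" if "i \<le> k" for i
      using that by (intro measurable_component_singleton) auto
    have "Measurable.pred (?PM (Suc k)) (\<lambda>\<omega>. \<omega> i \<noteq> w)" if "i \<le> k" for i
      using measurable_compose[OF c[OF that], of "\<lambda>x. x \<noteq> w" "count_space UNIV"] by simp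
    then have "Measurable.pred (?PM (Suc k)) (\<lambda>\<omega>. \<forall>i\<in>{..k}. \<omega> i \<noteq> w)"
      by (intro pred_intros_finite) auto
    moreover have "(\<lambda>\<omega>. f (\<omega> k)) \<in> borel_measurable (?PM (Suc k))"
      using measurable_compose[OF c[of k], of f borel] by simp
    ultimately show ?thesis by (intro measurable_If) (auto simp: atMost_def)
  qed
  have measC: "(\<lambda>\<omega>. if \<forall>i\<le>k. \<omega> i \<noteq> w then f (\<omega> k) else 0) \<in> borel_measurable (?C (Suc k))"
    for k and f :: "'a \<Rightarrow> ennreal"
    unfolding measurable_cong_sets[OF stC refl] by (rule meas)
  have A0: "A 0 (\<lambda>x. ennreal (g x)) = ennreal (g u)"
  proof -
    have "A 0 (\<lambda>x. ennreal (g x)) = (\<integral>\<^sup>+\<omega>. (\<integral>\<^sup>+x. (if x \<noteq> w then ennreal (g x) else 0)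
        \<partial>srw_kernel G u 0 \<omega>) \<partial>?C 0)"
      unfolding A_def by (subst nn_integral_C_Suc[OF meas]) (simp cong: if_cong)
    also have "\<dots> = (\<integral>\<^sup>+\<omega>. ennreal (g u) \<partial>?C 0)"
    proof (rule nn_integral_cong)
      fix \<omega> :: "nat \<Rightarrow> 'a"
      show "(\<integral>\<^sup>+x. (if x \<noteq> w then ennreal (g x) else 0) \<partial>srw_kernel G u 0 \<omega>) = ennreal (g u)"
        using u gw unfolding srw_kernel_def by (simp add: uni divide_ennreal_def)
    qed
    also have "\<dots> = ennreal (g u)"
      using prob_space_C[OF u0, of 0] by (simp add: prob_space.emeasure_space_1)
    finally show ?thesis .
  qed
  \<comment> \<open>The indicator at time k + 1 discards a move onto w, but g w = 0 gives such a
    move the value 0 anyway, so the inner integral is the full neighbour average g - 1.\<close>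
  have AS: "A k (\<lambda>x. ennreal (g x)) = A (Suc k) (\<lambda>x. ennreal (g x)) + A k (\<lambda>_. 1)" for k
  proof -
    have "A (Suc k) (\<lambda>x. ennreal (g x)) =
      (\<integral>\<^sup>+\<omega>. (\<integral>\<^sup>+x. (if (\<forall>i\<le>Suc k. fun_upd \<omega> (Suc k) x i \<noteq> w) then ennreal (g x) else 0)
        \<partial>srw_kernel G u (Suc k) \<omega>) \<partial>?C (Suc k))"
      unfolding A_def by (subst nn_integral_C_Suc[OF meas]) (simp cong: if_cong)
    also have "\<dots> = A k (\<lambda>v. ennreal (g v - 1))"
      unfolding A_def
    proof (rule nn_integral_cong)
      fix \<omega> assume "\<omega> \<in> space (?C (Suc k))"
      then have v: "\<omega> k \<in> ?V" unfolding spC by (auto simp: space_PiM PiE_iff)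
      have eq: "(\<forall>i\<le>Suc k. fun_upd \<omega> (Suc k) x i \<noteq> w) \<longleftrightarrow> (\<forall>i\<le>k. \<omega> i \<noteq> w) \<and> x \<noteq> w" for x
        by (auto simp: le_Suc_eq)
      show "(\<integral>\<^sup>+x. (if (\<forall>i\<le>Suc k. fun_upd \<omega> (Suc k) x i \<noteq> w) then ennreal (g x) else 0)
            \<partial>srw_kernel G u (Suc k) \<omega>)
          = (if \<forall>i\<le>k. \<omega> i \<noteq> w then ennreal (g (\<omega> k) - 1) else 0)"
      proof (cases "\<forall>i\<le>k. \<omega> i \<noteq> w")
        case True
        let ?d = "deg G (\<omega> k)"
        have d: "0 < ?d" using pos v by simp
        have sub: "nbrs G (\<omega> k) \<subseteq> ?V" by (auto simp: nbrs_def)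
        have f: "(if (\<forall>i\<le>Suc k. fun_upd \<omega> (Suc k) x i \<noteq> w) then ennreal (g x) else 0) = ennreal (g x)" for x
          unfolding eq using True gw by simp
        have "(\<integral>\<^sup>+x. (if (\<forall>i\<le>Suc k. fun_upd \<omega> (Suc k) x i \<noteq> w) then ennreal (g x) else 0)
            \<partial>srw_kernel G u (Suc k) \<omega>) = (\<Sum>x\<in>nbrs G (\<omega> k). ennreal (g x)) / of_nat ?d"
          unfolding f srw_kernel_def by (simp add: uni[OF sub] deg_def)
        also have "\<dots> = ennreal ((\<Sum>x\<in>nbrs G (\<omega> k). g x) / ?d)"
        proof -
          have "(\<Sum>x\<in>nbrs G (\<omega> k). ennreal (g x)) = ennreal (\<Sum>x\<in>nbrs G (\<omega> k). g x)"
            using nonneg sub by (intro sum_ennreal) auto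
          then show ?thesis
            using d nonneg sub by (simp add: ennreal_of_nat_eq_real_of_nat divide_ennreal sum_nonneg subset_eq)
        qed
        also have "(\<Sum>x\<in>nbrs G (\<omega> k). g x) / ?d = g (\<omega> k) - 1"
          using step[OF v] True d by (simp add: field_simps)
        finally show ?thesis using True by simp
      next
        case False
        then have "\<not> (\<forall>i\<le>Suc k. fun_upd \<omega> (Suc k) x i \<noteq> w)" for x unfolding eq by simp
        then show ?thesis using False by (simp only: if_False) simp
      qed
    qed
    finally have "A (Suc k) (\<lambda>x. ennreal (g x)) + A k (\<lambda>_. 1) =
       A k (\<lambda>v. ennreal (g v - 1)) + A k (\<lambda>_. 1)" by simp
    also have "\<dots> = (\<integral>\<^sup>+\<omega>. (if \<forall>i\<le>k. \<omega> i \<noteq> w then ennreal (g (\<omega> k) - 1) else 0) +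
        (if \<forall>i\<le>k. \<omega> i \<noteq> w then 1 else 0) \<partial>?C (Suc k))"
      unfolding A_def by (rule nn_integral_add[symmetric]; rule measC)
    also have "\<dots> = A k (\<lambda>x. ennreal (g x))"
      unfolding A_def
    proof (rule nn_integral_cong)
      fix \<omega> assume "\<omega> \<in> space (?C (Suc k))"
      then have v: "\<omega> k \<in> ?V" unfolding spC by (auto simp: space_PiM PiE_iff)
      \<comment> \<open>\<open>ennreal\<close> truncates negative numbers to 0; the truncation is
        harmless because the equation at a vertex other than w forces g to be at least 1
        there.\<close>
      have "ennreal (g (\<omega> k) - 1) + 1 = ennreal (g (\<omega> k))" if "\<omega> k \<noteq> w"
      proof -
        have "0 \<le> (\<Sum>x\<in>nbrs G (\<omega> k). g x)"
          using nonneg by (intro sum_nonneg) (auto simp: nbrs_def)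
        then have "real (deg G (\<omega> k)) * 1 \<le> deg G (\<omega> k) * g (\<omega> k)"
          using step[OF v that] by simp
        then have "1 \<le> g (\<omega> k)"
          using pos[OF v] by (simp only: mult_le_cancel_left_pos of_nat_0_less_iff)
        then show ?thesis by (simp flip: ennreal_1 ennreal_plus)
      qed
      then show "(if \<forall>i\<le>k. \<omega> i \<noteq> w then ennreal (g (\<omega> k) - 1) else 0) +
         (if \<forall>i\<le>k. \<omega> i \<noteq> w then 1 else 0) = (if \<forall>i\<le>k. \<omega> i \<noteq> w then ennreal (g (\<omega> k)) else 0)"
        by auto
    qed
    finally show ?thesis by simp
  qed
  have sumA: "(\<Sum>k<K. A k (\<lambda>_. 1)) + A K (\<lambda>x. ennreal (g x)) = ennreal (g u)" for K
  proof (induction K)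
    case (Suc K)
    then show ?case using AS[of K] by (simp add: add_ac)
  qed (simp add: A0)
  define a where "a k = A k (\<lambda>_. 1)" for k
  define B where "B = (\<Sum>v\<in>?V. g v)"
  have B: "g v \<le> B" if "v \<in> ?V" for v
    unfolding B_def using that fin nonneg by (intro member_le_sum) auto
  have B0: "0 \<le> B" unfolding B_def using nonneg by (intro sum_nonneg) auto
  have AB: "A K (\<lambda>x. ennreal (g x)) \<le> ennreal B * a K" for K
  proof -
    have "A K (\<lambda>x. ennreal (g x)) \<le>
        (\<integral>\<^sup>+\<omega>. ennreal B * (if \<forall>i\<le>K. \<omega> i \<noteq> w then 1 else 0) \<partial>?C (Suc K))"
      unfolding A_def
    proof (rule nn_integral_mono)
      fix \<omega> assume "\<omega> \<in> space (?C (Suc K))"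
      then have v: "\<omega> K \<in> ?V" unfolding spC by (auto simp: space_PiM PiE_iff)
      show "(if \<forall>i\<le>K. \<omega> i \<noteq> w then ennreal (g (\<omega> K)) else 0)
         \<le> ennreal B * (if \<forall>i\<le>K. \<omega> i \<noteq> w then 1 else 0)"
        using B[OF v] by (auto intro: ennreal_leI)
    qed
    also have "\<dots> = ennreal B * a K"
      unfolding A_def a_def by (rule nn_integral_cmult[OF measC])
    finally show ?thesis .
  qed
  have le: "(\<Sum>k. a k) \<le> ennreal (g u)"
  proof (rule suminf_le_const)
    show "summable a" by simp
    show "sum a {..<K} \<le> ennreal (g u)" for K
      using sumA[of K] unfolding a_def by (metis le_iff_add)
  qed
  have a_fin: "a k < \<top>" for k
  proof -
    have "a k \<le> (\<Sum>k. a k)"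
      using sum_le_suminf[of a "{k}"] by simp
    also have "\<dots> < \<top>" using le by (rule le_less_trans) simp
    finally show ?thesis .
  qed
  define b where "b k = enn2real (a k)" for k
  have ab: "a k = ennreal (b k)" for k using a_fin[of k] by (simp add: b_def)
  have b0: "0 \<le> b k" for k by (simp add: b_def)
  have "summable b"
  proof (rule summable_suminf_not_top[OF b0])
    have "(\<Sum>k. ennreal (b k)) = (\<Sum>k. a k)" by (simp only: ab)
    then show "(\<Sum>k. ennreal (b k)) \<noteq> \<top>" using le by (metis ennreal_neq_top top_unique)
  qed
  then have "b \<longlonglongrightarrow> 0" by (rule summable_LIMSEQ_zero)
  \<comment> \<open>\<open>b\<close> is the real-valued copy of the tails \<open>a\<close>. As the
    general term of a convergent series it tends to 0, and \<open>B\<close>, the sum of all values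
    of g, bounds g on every vertex.\<close>
  then have lim: "(\<lambda>K. (\<Sum>k. a k) + ennreal (B * b K)) \<longlonglongrightarrow> (\<Sum>k. a k) + ennreal (B * 0)"
    by (intro tendsto_intros tendsto_ennrealI)
  have bound: "ennreal (g u) \<le> (\<Sum>k. a k) + ennreal (B * b K)" for K
  proof -
    have "ennreal (g u) = (\<Sum>k<K. a k) + A K (\<lambda>x. ennreal (g x))"
      using sumA[of K] by (simp add: a_def)
    also have "\<dots> \<le> (\<Sum>k. a k) + ennreal B * a K"
      by (intro add_mono AB sum_le_suminf) auto
    also have "ennreal B * a K = ennreal (B * b K)"
      using B0 b0 by (simp add: ab ennreal_mult)
    finally show ?thesis .
  qed
  have "ennreal (g u) \<le> (\<Sum>k. a k) + ennreal (B * 0)"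
    by (rule LIMSEQ_le_const[OF lim]) (use bound in blast)
  with le have eq: "(\<Sum>k. a k) = ennreal (g u)" by simp
  have "expected_hitting_time G u w = (\<integral>\<^sup>+\<omega>. (\<Sum>k. if \<forall>i\<le>k. \<omega> i \<noteq> w then 1 else 0) \<partial>PF.lim)"
    by (simp add: expected_hitting_time_def srw_def hitting_time_eq_suminf)
  also have "\<dots> = (\<Sum>k. \<integral>\<^sup>+\<omega>. (if \<forall>i\<le>k. \<omega> i \<noteq> w then 1 else 0) \<partial>PF.lim)"
  proof (rule nn_integral_suminf)
    fix k
    have eq: "(\<forall>i\<le>k. restrict \<omega> {0..<Suc k} i \<noteq> w) \<longleftrightarrow> (\<forall>i\<le>k. \<omega> i \<noteq> w)" for \<omega>
      by auto
    have "(\<lambda>\<omega>. if \<forall>i\<le>k. restrict \<omega> {0..<Suc k} i \<noteq> w then 1 else 0 :: ennreal) \<in>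
        borel_measurable (PiM UNIV (\<lambda>_. count_space ?V))"
      by (rule measurable_compose[OF measurable_restrict_subset meas[of k "\<lambda>_. 1"]]) simp
    then show "(\<lambda>\<omega>. if \<forall>i\<le>k. \<omega> i \<noteq> w then 1 else 0 :: ennreal) \<in> borel_measurable PF.lim"
      unfolding eq measurable_cong_sets[OF PF.sets_lim refl] .
  qed
  also have "\<dots> = (\<Sum>k. a k)"
  proof (rule arg_cong[where f = suminf], rule ext)
    fix k
    have eq: "(\<forall>i\<le>k. restrict \<omega> {0..<Suc k} i \<noteq> w) \<longleftrightarrow> (\<forall>i\<le>k. \<omega> i \<noteq> w)" for \<omega>
      by auto
    show "(\<integral>\<^sup>+\<omega>. (if \<forall>i\<le>k. \<omega> i \<noteq> w then 1 else 0) \<partial>PF.lim) = a k"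
      using nn_integral_lim[OF meas[of k "\<lambda>_. 1"]] unfolding a_def A_def eq .
  qed
  also have "(\<Sum>k. a k) = ennreal (g u)" by (rule eq)
  finally show ?thesis .
qed

section \<open>Rooted trees\<close>


text \<open>A non-root vertex stands for the edge to its parent, so sums over edges are sums over
  \<open>verts G - {r}\<close>. The depth function makes the parent map well-founded. The set
  \<open>desc a\<close> defined below is the side of the edge above a that does not contain the
  root.\<close>

locale rooted_tree =
  fixes G :: "'a ugraph" and r :: 'a and p :: "'a \<Rightarrow> 'a" and dep :: "'a \<Rightarrow> nat"
  assumes finite_verts: "finite (verts G)"
    and root: "r \<in> verts G"
    and dep_root: "dep r = 0"
    and parent: "\<And>v. v \<in> verts G \<Longrightarrow> v \<noteq> r \<Longrightarrow> p v \<in> verts G"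
    and dep_parent: "\<And>v. v \<in> verts G \<Longrightarrow> v \<noteq> r \<Longrightarrow> dep v = Suc (dep (p v))"
    and edges_eq: "edges G = (\<lambda>v. {v, p v}) ` (verts G - {r})"
begin

definition desc :: "'a \<Rightarrow> 'a set" where
  "desc a = {x \<in> verts G. (x, a) \<in> {(y, p y) |y. y \<in> verts G - {r}}\<^sup>*}"

definition children :: "'a \<Rightarrow> 'a set" where
  "children a = {c \<in> verts G - {r}. p c = a}"

lemma finite_desc [simp]: "finite (desc a)" and finite_children [simp]: "finite (children a)"
  using finite_verts by (auto simp: desc_def children_def)

lemma desc_subset: "desc a \<subseteq> verts G"
  by (auto simp: desc_def)

lemma desc_iff: "x \<in> verts G \<Longrightarrow> x \<in> desc a \<longleftrightarrow> x = a \<or> x \<noteq> r \<and> p x \<in> desc a"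
  unfolding desc_def using parent
  by (auto elim: converse_rtranclE intro: converse_rtrancl_into_rtrancl)

lemma verts_induct [consumes 1, case_names parent]:
  assumes "x \<in> verts G" and "\<And>x. x \<in> verts G \<Longrightarrow> (x \<noteq> r \<Longrightarrow> P (p x)) \<Longrightarrow> P x"
  shows "P x"
  using assms(1)
proof (induction "dep x" arbitrary: x rule: less_induct)
  case less
  show ?case
  proof (rule assms(2)[OF less.prems])
    assume "x \<noteq> r"
    with less show "P (p x)" using parent dep_parent by simp
  qed
qed

lemma desc_dep: "x \<in> desc a \<Longrightarrow> dep a \<le> dep x \<and> (dep x \<le> dep a \<longrightarrow> x = a)"
proof -
  assume x: "x \<in> desc a"
  then have "x \<in> verts G" using desc_subset by auto
  then show ?thesis using x
  proof (induction rule: verts_induct)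
    case (parent x)
    then show ?case using desc_iff[of x a] dep_parent[of x] by auto
  qed
qed

lemma desc_refl: "a \<in> verts G \<Longrightarrow> a \<in> desc a"
  by (simp add: desc_iff)

lemma parent_notin_desc: "a \<in> verts G \<Longrightarrow> a \<noteq> r \<Longrightarrow> p a \<notin> desc a"
  using desc_dep[of "p a" a] dep_parent[of a] by auto

lemma desc_root: "desc r = verts G"
proof -
  have "x \<in> desc r" if "x \<in> verts G" for x
    using that by (induction rule: verts_induct) (auto simp: desc_iff)
  then show ?thesis using desc_subset by auto
qed

lemma root_in_desc_iff: "r \<in> desc a \<longleftrightarrow> r = a"
  using desc_iff[OF root] by auto

lemma desc_trans: "x \<in> desc a \<Longrightarrow> a \<in> desc b \<Longrightarrow> x \<in> desc b"
  by (auto simp: desc_def)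

lemma desc_mono: "a \<in> desc b \<Longrightarrow> desc a \<subseteq> desc b"
  using desc_trans by auto

lemma desc_linear: "x \<in> desc a \<Longrightarrow> x \<in> desc b \<Longrightarrow> a \<in> desc b \<or> b \<in> desc a"
proof -
  assume x: "x \<in> desc a" "x \<in> desc b"
  then have "x \<in> verts G" using desc_subset by auto
  then show ?thesis using x
  proof (induction rule: verts_induct)
    case (parent x)
    then show ?case using desc_iff[of x a] desc_iff[of x b] by auto
  qed
qed

lemma children_disjoint:
  assumes "c \<in> children a" "c' \<in> children a" "c \<noteq> c'"
  shows "desc c \<inter> desc c' = {}"
proof -
  have "dep c = dep c'" using assms dep_parent by (simp add: children_def)
  then show ?thesis using desc_linear[of _ c c'] desc_dep[of c c'] desc_dep[of c' c] assms(3) by auto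
qed

lemma desc_eq_children:
  assumes "a \<in> verts G"
  shows "desc a = insert a (\<Union>c\<in>children a. desc c)"
proof -
  have "\<exists>c\<in>children a. x \<in> desc c" if "x \<in> verts G" "x \<in> desc a" "x \<noteq> a" for x
    using that
  proof (induction rule: verts_induct)
    case (parent x)
    then have x: "x \<noteq> r" "p x \<in> desc a" using desc_iff[of x a] by auto
    show ?case
    proof (cases "p x = a")
      case True
      then show ?thesis using parent x desc_refl by (auto simp: children_def)
    next
      case False
      then show ?thesis using parent x desc_iff[of x] by auto
    qed
  qed
  moreover have "c \<in> desc a" if "c \<in> children a" for c
    using that assms desc_refl desc_iff[of c a] by (auto simp: children_def)
  ultimately show ?thesis
    using desc_mono[of _ a] desc_refl[OF assms] desc_subset[of a] by (intro equalityI subsetI) blast+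
qed

lemma sum_desc:
  fixes f :: "'a \<Rightarrow> 'b::comm_monoid_add"
  assumes "a \<in> verts G"
  shows "sum f (desc a) = f a + (\<Sum>c\<in>children a. sum f (desc c))"
proof -
  have "a \<notin> (\<Union>c\<in>children a. desc c)"
  proof
    assume "a \<in> (\<Union>c\<in>children a. desc c)"
    then obtain c where "c \<in> verts G" "c \<noteq> r" "p c = a" "a \<in> desc c"
      by (auto simp: children_def)
    then show False using parent_notin_desc by blast
  qed
  moreover have "sum f (\<Union>c\<in>children a. desc c) = (\<Sum>c\<in>children a. sum f (desc c))"
    using children_disjoint by (intro sum.UNION_disjoint) auto
  ultimately show ?thesis
    unfolding desc_eq_children[OF assms] by (subst sum.insert) auto
qed

lemma desc_parent_iff:
  assumes "c \<in> verts G" "c \<noteq> r" "a \<in> verts G"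
  shows "(c \<in> desc a) = (p c \<in> desc a \<or> c = a)"
  using assms desc_iff[of c a] by auto

lemma neighbours:
  assumes "a \<in> verts G"
  shows "nbrs G a = children a \<union> (if a = r then {} else {p a})"
  unfolding nbrs_def edges_eq children_def using assms parent
  by (auto simp: doubleton_eq_iff)

lemma parent_notin_children: "a \<in> verts G \<Longrightarrow> a \<noteq> r \<Longrightarrow> p a \<notin> children a"
  using dep_parent[of a] dep_parent[of "p a"] by (auto simp: children_def)

lemma deg_eq: "a \<in> verts G \<Longrightarrow> deg G a = card (children a) + of_bool (a \<noteq> r)"
  unfolding deg_def by (auto simp: neighbours parent_notin_children)

lemma sum_card_children:
  assumes "a \<in> verts G"
  shows "(\<Sum>v\<in>desc a. card (children v)) = card (desc a) - 1"
proof -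
  have "(\<Sum>v\<in>desc a. card (children v)) = card (\<Union>v\<in>desc a. children v)"
    by (subst card_UN_disjoint) (auto simp: children_def finite_verts)
  also have "(\<Union>v\<in>desc a. children v) = desc a - {a}"
    using desc_iff assms desc_subset parent_notin_desc unfolding children_def by blast
  also have "card \<dots> = card (desc a) - 1"
    using desc_refl[OF assms] by simp
  finally show ?thesis .
qed

lemma card_desc_pos: "a \<in> verts G \<Longrightarrow> 0 < card (desc a)"
  using desc_refl finite_desc by (metis card_gt_0_iff empty_iff)

lemma card_edges: "card (edges G) = card (verts G) - 1"
proof -
  have "inj_on (\<lambda>v. {v, p v}) (verts G - {r})"
  proof (rule inj_onI)
    fix v w assume "v \<in> verts G - {r}" "w \<in> verts G - {r}" "{v, p v} = {w, p w}"
    then show "v = w"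
      using dep_parent[of v] dep_parent[of w] by (auto simp: doubleton_eq_iff)
  qed
  then show ?thesis unfolding edges_eq using root finite_verts by (simp add: card_image)
qed

text \<open>The s - 1 edges inside the subtree count twice and the edge to the parent once. The
  result 2 s - 1 is also the mean time to cross that edge upwards.\<close>

lemma sum_deg_desc:
  assumes "a \<in> verts G" "a \<noteq> r"
  shows "(\<Sum>v\<in>desc a. real (deg G v)) = 2 * real (card (desc a)) - 1"
proof -
  have "(\<Sum>v\<in>desc a. deg G v) = (\<Sum>v\<in>desc a. card (children v) + 1)"
  proof (rule sum.cong[OF refl])
    fix v assume v: "v \<in> desc a"
    then have "v \<noteq> r" using assms(2) root_in_desc_iff by auto
    then show "deg G v = card (children v) + 1" using v desc_subset by (auto simp: deg_eq subset_iff)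
  qed
  also have "\<dots> = (card (desc a) - 1) + card (desc a)"
    unfolding sum.distrib sum_card_children[OF assms(1)] by simp
  finally have "real (\<Sum>v\<in>desc a. deg G v) = real (card (desc a) - 1 + card (desc a))" by simp
  then show ?thesis using card_desc_pos[OF assms(1)] by (simp add: of_nat_diff)
qed

lemma sum_deg: "(\<Sum>v\<in>verts G. real (deg G v)) = 2 * real (card (verts G) - 1)"
proof -
  have "(\<Sum>v\<in>verts G. deg G v) = (\<Sum>v\<in>verts G. card (children v) + of_bool (v \<noteq> r))"
    by (intro sum.cong) (auto simp: deg_eq)
  also have "\<dots> = (card (verts G) - 1) + card (verts G - {r})"
    using sum_card_children[OF root] finite_verts
    by (simp add: sum.distrib desc_root set_diff_eq Int_def)
  also have "\<dots> = 2 * (card (verts G) - 1)" using root by simp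
  finally have "real (\<Sum>v\<in>verts G. deg G v) = real (2 * (card (verts G) - 1))" by simp
  then show ?thesis by simp
qed

section \<open>Hitting times in a rooted tree as sums over edges\<close>

abbreviation edge_count :: real where
  "edge_count \<equiv> real (card (verts G) - 1)"

text \<open>The hitting time of \<open>w\<close> from \<open>a\<close> minus that from the parent of \<open>a\<close>.\<close>

definition slope :: "'a \<Rightarrow> 'a \<Rightarrow> real" where
  "slope w a = 2 * real (card (desc a)) - 1 - 2 * edge_count * of_bool (w \<in> desc a)"

text \<open>The path from v to w uses exactly the edges above one of the two vertices but not above
  both: the coefficient is 1 for an edge crossed upwards and -1 for one crossed downwards. Downwards
  the crossing takes 2 (n - s) - 1 steps on average, which is minus the slope 2 s - 1 - 2 (n - 1),
  so all terms are nonnegative.\<close>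

definition hit :: "'a \<Rightarrow> 'a \<Rightarrow> real" where
  "hit w v = (\<Sum>a\<in>verts G - {r}. (of_bool (v \<in> desc a) - of_bool (w \<in> desc a)) * slope w a)"

lemma hit_parent:
  assumes c: "c \<in> verts G" "c \<noteq> r"
  shows "hit w c = hit w (p c) + slope w c"
proof -
  have "hit w c - hit w (p c) = (\<Sum>a\<in>verts G - {r}. if a = c then slope w a else 0)"
    unfolding hit_def sum_subtractf[symmetric]
    using c desc_parent_iff[OF c] parent_notin_desc[OF c] by (intro sum.cong) auto
  also have "\<dots> = slope w c" using c finite_verts by simp
  finally show ?thesis by simp
qed

lemma card_desc_less:
  assumes "a \<in> verts G" "a \<noteq> r"
  shows "card (desc a) < card (verts G)"
  using desc_subset[of a] root root_in_desc_iff[of a] assms finite_verts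
  by (intro psubset_card_mono) auto

lemma hit_nonneg: "0 \<le> hit w v"
  unfolding hit_def
proof (rule sum_nonneg)
  fix a assume a: "a \<in> verts G - {r}"
  have "0 < card (desc a)" "card (desc a) < card (verts G)"
    using a card_desc_pos card_desc_less by auto
  then show "0 \<le> (of_bool (v \<in> desc a) - of_bool (w \<in> desc a)) * slope w a"
    by (auto simp: slope_def of_bool_def)
qed

lemma hit_self: "hit w w = 0"
  by (simp add: hit_def)

lemma sum_slope_children:
  assumes v: "v \<in> verts G"
  shows "(\<Sum>c\<in>children v. slope w c) = 2 * (real (card (desc v)) - 1) - card (children v)
    - 2 * edge_count * (of_bool (w \<in> desc v) - of_bool (w = v))"
proof -
  \<comment> \<open>Writing membership of w as a sum over the subtree lets \<open>sum_desc\<close>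
    count the children whose subtree contains w.\<close>
  have one: "(\<Sum>x\<in>desc c. of_bool (w = x)) = (of_bool (w \<in> desc c) :: real)" for c
    by (simp add: of_bool_def)
  have "(\<Sum>c\<in>children v. of_bool (w \<in> desc c)) = (of_bool (w \<in> desc v) - of_bool (w = v) :: real)"
    using sum_desc[OF v, of "\<lambda>x. of_bool (w = x) :: real"] unfolding one by simp
  moreover have "(\<Sum>c\<in>children v. real (card (desc c))) = real (card (desc v)) - 1"
    using sum_desc[OF v, of "\<lambda>_. 1 :: real"] by simp
  ultimately show ?thesis
    unfolding slope_def by (simp add: sum_subtractf flip: sum_distrib_left)
qed

text \<open>The neighbours of v differ from v by the slopes of the children and by minus the slope
  of v. The subtree sizes cancel up to the degree; the target terms cancel because w, being
  different from v, lies below a child of v exactly when it lies below v. At the root, where there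
  is no parent, the term 2 m of the target takes over.\<close>

lemma hit_harmonic:
  assumes v: "v \<in> verts G" "v \<noteq> w" and w: "w \<in> verts G"
  shows "(\<Sum>x\<in>nbrs G v. hit w x) + deg G v = deg G v * hit w v"
proof -
  have ch: "(\<Sum>x\<in>children v. hit w x) = card (children v) * hit w v + (\<Sum>c\<in>children v. slope w c)"
  proof -
    have "(\<Sum>x\<in>children v. hit w x) = (\<Sum>c\<in>children v. hit w v + slope w c)"
      by (intro sum.cong refl) (auto simp: children_def hit_parent)
    then show ?thesis by (simp add: sum.distrib)
  qed
  show ?thesis
  proof (cases "v = r")
    case True
    have "0 < card (verts G)" using root finite_verts card_gt_0_iff by blast
    with True v w show ?thesis
      by (simp add: neighbours deg_eq ch[unfolded True] sum_slope_children desc_root of_nat_diff)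
  next
    case False
    have nb: "(\<Sum>x\<in>nbrs G v. hit w x) = (\<Sum>x\<in>children v. hit w x) + hit w (p v)"
      using False v parent_notin_children[of v] by (simp add: neighbours)
    have "hit w v = hit w (p v) + (2 * real (card (desc v)) - 1 - 2 * edge_count * of_bool (w \<in> desc v))"
      using hit_parent[OF v(1) False, of w] by (simp add: slope_def)
    then show ?thesis
      unfolding nb ch sum_slope_children[OF v(1)]
      using False v by (simp add: deg_eq algebra_simps)
  qed
qed

text \<open>After exchanging the sums, the coefficient of the slope of an edge is the degree sum
  below it minus 2 m if w lies below it, which is that slope once more. This produces the
  squares.\<close>

lemma sum_deg_hit:
  assumes w: "w \<in> verts G"
  shows "(\<Sum>v\<in>verts G. deg G v * hit w v) = (\<Sum>a\<in>verts G - {r}. (slope w a)\<^sup>2)"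
proof -
  have "(\<Sum>v\<in>verts G. deg G v * hit w v) = (\<Sum>a\<in>verts G - {r}. \<Sum>v\<in>verts G.
      deg G v * ((of_bool (v \<in> desc a) - of_bool (w \<in> desc a)) * slope w a))"
    unfolding hit_def sum_distrib_left by (rule sum.swap)
  also have "\<dots> = (\<Sum>a\<in>verts G - {r}. (slope w a)\<^sup>2)"
  proof (rule sum.cong[OF refl])
    fix a assume a: "a \<in> verts G - {r}"
    have "(\<Sum>v\<in>verts G. deg G v * ((of_bool (v \<in> desc a) - of_bool (w \<in> desc a)) * slope w a))
      = ((\<Sum>v\<in>verts G. if v \<in> desc a then real (deg G v) else 0)
         - (\<Sum>v\<in>verts G. real (deg G v)) * of_bool (w \<in> desc a)) * slope w a"
      unfolding sum_distrib_right sum_subtractf[symmetric]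
      by (intro sum.cong) (auto simp: algebra_simps)
    also have "(\<Sum>v\<in>verts G. if v \<in> desc a then real (deg G v) else 0) = (\<Sum>v\<in>desc a. real (deg G v))"
      using desc_subset[of a] finite_verts by (simp add: sum.If_cases Int_absorb1 flip: Int_def)
    also have "\<dots> = 2 * real (card (desc a)) - 1"
      using a by (intro sum_deg_desc) auto
    finally show "(\<Sum>v\<in>verts G. deg G v * ((of_bool (v \<in> desc a) - of_bool (w \<in> desc a)) * slope w a))
      = (slope w a)\<^sup>2"
      by (simp add: sum_deg slope_def power2_eq_square)
  qed
  finally show ?thesis .
qed

lemma simple: "simple_graph G"
proof -
  have "{v, p v} \<subseteq> verts G \<and> card {v, p v} = 2" if "v \<in> verts G" "v \<noteq> r" for v
  proof -
    have "v \<noteq> p v" using dep_parent[OF that] by auto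
    then show ?thesis using that parent by auto
  qed
  then show ?thesis unfolding simple_graph_def edges_eq using finite_verts by auto
qed

end

section \<open>Walks and distances\<close>


definition adj :: "'a ugraph \<Rightarrow> ('a \<times> 'a) set" where
  "adj G = {(x, y). x \<in> verts G \<and> y \<in> verts G \<and> {x, y} \<in> edges G}"

lemma sym_adj: "sym (adj G)"
  by (auto simp: sym_def adj_def insert_commute)

lemma walk_iff_relpow:
  "(\<exists>xs. walk_between G u xs v \<and> length xs = Suc k) \<longleftrightarrow> u \<in> verts G \<and> (u, v) \<in> adj G ^^ k"
proof (induction k arbitrary: u)
  case 0
  show ?case
  proof
    assume "\<exists>xs. walk_between G u xs v \<and> length xs = Suc 0"
    then show "u \<in> verts G \<and> (u, v) \<in> adj G ^^ 0"
      by (auto simp: walk_between_def is_walk_def length_Suc_conv)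
  next
    assume "u \<in> verts G \<and> (u, v) \<in> adj G ^^ 0"
    then show "\<exists>xs. walk_between G u xs v \<and> length xs = Suc 0"
      by (intro exI[of _ "[u]"]) (auto simp: walk_between_def is_walk_def)
  qed
next
  case (Suc k)
  show ?case
  proof
    assume "\<exists>xs. walk_between G u xs v \<and> length xs = Suc (Suc k)"
    then obtain y ys where ys: "walk_between G u (u # y # ys) v" "length ys = k"
      by (auto simp: walk_between_def length_Suc_conv)
    then have "walk_between G y (y # ys) v \<and> length (y # ys) = Suc k"
      by (auto simp: walk_between_def is_walk_def)
    then have "(y, v) \<in> adj G ^^ k" using Suc.IH by blast
    moreover have "(u, y) \<in> adj G" using ys by (auto simp: walk_between_def is_walk_def adj_def)
    ultimately show "u \<in> verts G \<and> (u, v) \<in> adj G ^^ Suc k"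
      using relpow_Suc_I2[of u y "adj G" v k] by (auto simp: adj_def simp del: relpow.simps)
  next
    assume u: "u \<in> verts G \<and> (u, v) \<in> adj G ^^ Suc k"
    then obtain y where y: "(u, y) \<in> adj G" "(y, v) \<in> adj G ^^ k"
      by (meson relpow_Suc_D2)
    then obtain xs where xs: "walk_between G y xs v" "length xs = Suc k"
      using Suc.IH[of y] by (auto simp: adj_def)
    then obtain ys where "xs = y # ys" by (auto simp: walk_between_def length_Suc_conv)
    with xs y show "\<exists>xs. walk_between G u xs v \<and> length xs = Suc (Suc k)"
      by (intro exI[of _ "u # xs"]) (auto simp: walk_between_def is_walk_def adj_def)
  qed
qed

lemma graph_dist_eq_relpow:
  "u \<in> verts G \<Longrightarrow> graph_dist G u v = (LEAST k. (u, v) \<in> adj G ^^ k)"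
  unfolding graph_dist_def walk_iff_relpow by simp

lemma graph_dist_le:
  "u \<in> verts G \<Longrightarrow> (u, v) \<in> adj G ^^ k \<Longrightarrow> graph_dist G u v \<le> k"
  unfolding graph_dist_eq_relpow by (rule Least_le)

lemma connected_graph_iff:
  "connected_graph G \<longleftrightarrow> verts G \<noteq> {} \<and> (\<forall>u\<in>verts G. \<forall>v\<in>verts G. (u, v) \<in> (adj G)\<^sup>*)"
proof -
  have "(\<exists>xs. walk_between G u xs v) \<longleftrightarrow> (u, v) \<in> (adj G)\<^sup>*" if "u \<in> verts G" for u v
  proof -
    have "(\<exists>xs. walk_between G u xs v) \<longleftrightarrow> (\<exists>k xs. walk_between G u xs v \<and> length xs = Suc k)"
      by (metis is_walk_def length_0_conv not0_implies_Suc walk_between_def)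
    also have "\<dots> \<longleftrightarrow> (u, v) \<in> (adj G)\<^sup>*"
      using that by (simp add: walk_iff_relpow rtrancl_power)
    finally show ?thesis .
  qed
  then show ?thesis unfolding connected_graph_def by auto
qed

lemma graph_dist_relpow:
  assumes "connected_graph G" "u \<in> verts G" "v \<in> verts G"
  shows "(u, v) \<in> adj G ^^ graph_dist G u v"
proof -
  have "\<exists>k. (u, v) \<in> adj G ^^ k"
    using assms by (auto simp: connected_graph_iff rtrancl_power)
  then show ?thesis unfolding graph_dist_eq_relpow[OF assms(2)] by (rule LeastI_ex)
qed

text \<open>Lower bounds on distances are certified by functions that grow by at most one along
  every edge. Integer values allow a signed depth as the certificate.\<close>

lemma Lipschitz_le_graph_dist:
  fixes f :: "'a \<Rightarrow> int"
  assumes G: "connected_graph G" "u \<in> verts G" "v \<in> verts G"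
    and f: "\<And>x y. x \<in> verts G \<Longrightarrow> y \<in> verts G \<Longrightarrow> {x, y} \<in> edges G \<Longrightarrow> f y \<le> f x + 1"
  shows "f v - f u \<le> int (graph_dist G u v)"
proof -
  have "f v - f u \<le> int k" if "(u, v) \<in> adj G ^^ k" for k
    using that
  proof (induction k arbitrary: v)
    case (Suc k)
    then obtain y where y: "(u, y) \<in> adj G ^^ k" "(y, v) \<in> adj G" by auto
    have "f v \<le> f y + 1" using y(2) by (intro f) (auto simp: adj_def)
    with Suc.IH[OF y(1)] show ?case by simp
  qed simp
  from this[OF graph_dist_relpow[OF G]] show ?thesis .
qed

lemma finite_graph_dist: "finite (verts G) \<Longrightarrow> finite {graph_dist G u v |u v. u \<in> verts G \<and> v \<in> verts G}"
  by (rule finite_subset[of _ "(\<lambda>(u, v). graph_dist G u v) ` (verts G \<times> verts G)"]) auto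

lemma graph_dist_le_diam:
  "finite (verts G) \<Longrightarrow> u \<in> verts G \<Longrightarrow> v \<in> verts G \<Longrightarrow> graph_dist G u v \<le> diam G"
  unfolding diam_def by (rule Max_ge[OF finite_graph_dist]) auto

lemma diam_attained:
  assumes "finite (verts G)" "verts G \<noteq> {}"
  obtains u v where "u \<in> verts G" "v \<in> verts G" "graph_dist G u v = diam G"
proof -
  have "diam G \<in> {graph_dist G u v |u v. u \<in> verts G \<and> v \<in> verts G}"
    unfolding diam_def using assms by (intro Max_in finite_graph_dist) auto
  then show ?thesis using that by auto
qed

text \<open>Loop erasure: if the new first vertex already occurs on the path, only the suffix from
  that occurrence is kept.\<close>

lemma rtrancl_imp_distinct_path:
  "(u, v) \<in> R\<^sup>* \<Longrightarrow> \<exists>xs. xs \<noteq> [] \<and> hd xs = u \<and> last xs = v \<and> distinct xs \<and>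
     successively (\<lambda>x y. (x, y) \<in> R) xs"
proof (induction rule: converse_rtrancl_induct)
  case base
  show ?case by (rule exI[of _ "[v]"]) simp
next
  case (step x y)
  then obtain xs where xs: "xs \<noteq> []" "hd xs = y" "last xs = v" "distinct xs"
     "successively (\<lambda>x y. (x, y) \<in> R) xs" by auto
  show ?case
  proof (cases "x \<in> set xs")
    case True
    then obtain as bs where "xs = as @ x # bs" by (meson split_list)
    with xs show ?thesis by (intro exI[of _ "x # bs"]) (auto simp: successively_append_iff)
  next
    case False
    with xs step show ?thesis
      by (intro exI[of _ "x # xs"]) (auto simp: successively_Cons)
  qed
qed

text \<open>Each vertex other than r has a neighbour one step closer to r. These chosen edges
  already connect everything, so a further edge would close a cycle with a simple path of chosen
  edges.\<close>

theorem is_tree_rooted: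
  assumes T: "is_tree G" and r: "r \<in> verts G"
  shows "\<exists>p. rooted_tree G r p (\<lambda>v. graph_dist G v r)"
proof -
  have fin: "finite (verts G)" and con: "connected_graph G" and nocyc: "\<And>xs. \<not> is_cycle G xs"
    and e: "\<And>e. e \<in> edges G \<Longrightarrow> e \<subseteq> verts G \<and> card e = 2"
    using T by (auto simp: is_tree_def simple_graph_def)
  let ?d = "\<lambda>v. graph_dist G v r"
  have dr: "?d r = 0" using graph_dist_le[OF r, of r 0] by simp
  have "\<exists>y. y \<in> verts G \<and> {v, y} \<in> edges G \<and> ?d v = Suc (?d y)" if v: "v \<in> verts G" "v \<noteq> r" for v
  proof -
    have pw: "(v, r) \<in> adj G ^^ ?d v" using graph_dist_relpow[OF con v(1) r] .
    then obtain k where k: "?d v = Suc k" using v(2) by (cases "?d v") auto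
    then obtain y where y: "(v, y) \<in> adj G" "(y, r) \<in> adj G ^^ k"
      using relpow_Suc_D2 pw by metis
    have yV: "y \<in> verts G" using y by (simp add: adj_def)
    have "?d y \<le> k" using graph_dist_le[OF yV y(2)] .
    moreover have "?d v \<le> Suc (?d y)"
      using relpow_Suc_I2[OF y(1) graph_dist_relpow[OF con yV r]] by (rule graph_dist_le[OF v(1)])
    ultimately show ?thesis using y k by (auto simp: adj_def)
  qed
  then obtain p where p: "\<And>v. v \<in> verts G \<Longrightarrow> v \<noteq> r \<Longrightarrow>
      p v \<in> verts G \<and> {v, p v} \<in> edges G \<and> ?d v = Suc (?d (p v))" by metis
  define F where "F = (\<lambda>v. {v, p v}) ` (verts G - {r})"
  define T where "T = {(x, y). x \<in> verts G \<and> y \<in> verts G \<and> {x, y} \<in> F}"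
  have FE: "F \<subseteq> edges G" using p by (auto simp: F_def)
  have to_root: "(v, r) \<in> T\<^sup>*" if "v \<in> verts G" for v
    using that
  proof (induction "?d v" arbitrary: v rule: less_induct)
    case less
    show ?case
    proof (cases "v = r")
      case False
      then have "(v, p v) \<in> T" using p less.prems by (auto simp: T_def F_def)
      moreover have "(p v, r) \<in> T\<^sup>*" using less p[of v] False by auto
      ultimately show ?thesis by (rule converse_rtrancl_into_rtrancl)
    qed simp
  qed
  have symT: "sym (T\<^sup>*)" by (intro sym_rtrancl) (auto simp: sym_def T_def insert_commute)
  have "edges G \<subseteq> F"
  proof (rule subsetI, rule ccontr)
    fix e0 assume e0: "e0 \<in> edges G" "e0 \<notin> F"
    then obtain u v where uv: "e0 = {u, v}" "u \<noteq> v" using e[of e0] by (auto simp: card_2_iff)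
    have V: "u \<in> verts G" "v \<in> verts G" using e[of e0] e0 uv by auto
    have "(u, v) \<in> T\<^sup>*"
      using to_root[OF V(1)] symD[OF symT to_root[OF V(2)]] by (rule rtrancl_trans)
    then obtain xs where xs: "xs \<noteq> []" "hd xs = u" "last xs = v" "distinct xs"
      "successively (\<lambda>x y. (x, y) \<in> T) xs"
      using rtrancl_imp_distinct_path by metis
    have "length xs \<ge> 3"
    proof (rule ccontr)
      assume "\<not> length xs \<ge> 3"
      moreover have "length xs \<noteq> 0" using xs(1) by simp
      ultimately consider "length xs = 1" | "length xs = 2" by linarith
      then show False
      proof cases
        case 1
        then show False using xs uv by (auto simp: length_Suc_conv)
      next
        case 2
        then obtain a b where "xs = [a, b]" by (auto simp: length_Suc_conv numeral_2_eq_2)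
        then show False using xs e0 uv by (auto simp: T_def)
      qed
    qed
    moreover have "is_walk G xs"
    proof -
      have "set xs \<subseteq> verts G"
      proof
        fix x assume x: "x \<in> set xs"
        then obtain i where i: "i < length xs" "x = xs ! i" by (auto simp: in_set_conv_nth)
        show "x \<in> verts G"
        proof (cases i)
          case 0
          then show ?thesis using i xs V by (simp add: hd_conv_nth)
        next
          case (Suc j)
          then show ?thesis
            using i successively_nth[OF xs(5), of j] by (auto simp: T_def)
        qed
      qed
      moreover have "successively (\<lambda>x y. {x, y} \<in> edges G) xs"
        by (rule successively_mono[OF xs(5)]) (use FE in \<open>auto simp: T_def\<close>)
      ultimately show ?thesis using xs(1) by (simp add: is_walk_def)
    qed
    ultimately have "is_cycle G xs" using xs e0 uv by (simp add: is_cycle_def insert_commute)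
    then show False using nocyc by simp
  qed
  with FE have "edges G = F" by simp
  then have "rooted_tree G r p ?d"
    using fin r dr p by unfold_locales (auto simp: F_def)
  then show ?thesis by blast
qed

section \<open>Rooted trees are trees, and their stationary hitting times\<close>

context rooted_tree
begin

lemma adj_parent: "v \<in> verts G \<Longrightarrow> v \<noteq> r \<Longrightarrow> (v, p v) \<in> adj G"
  using parent by (auto simp: adj_def edges_eq)

lemma relpow_root: "v \<in> verts G \<Longrightarrow> (v, r) \<in> adj G ^^ dep v"
proof (induction rule: verts_induct)
  case (parent v)
  show ?case
  proof (cases "v = r")
    case True
    then show ?thesis by (simp add: dep_root)
  next
    case False
    then show ?thesis
      using relpow_Suc_I2[OF adj_parent] parent by (simp add: dep_parent)
  qed
qed

lemma connected: "connected_graph G"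
  unfolding connected_graph_iff
proof (intro conjI ballI)
  show "verts G \<noteq> {}" using root by auto
  have to_root: "(v, r) \<in> (adj G)\<^sup>*" if "v \<in> verts G" for v
    using relpow_root[OF that] by (rule relpow_imp_rtrancl)
  fix u v assume "u \<in> verts G" "v \<in> verts G"
  then show "(u, v) \<in> (adj G)\<^sup>*"
    using to_root[of u] symD[OF sym_rtrancl[OF sym_adj] to_root[of v]] by (meson rtrancl_trans)
qed

lemma desc_edge_iff:
  assumes "{x, y} \<in> edges G" "a \<in> verts G" "{x, y} \<noteq> {a, p a}"
  shows "x \<in> desc a \<longleftrightarrow> y \<in> desc a"
  using assms desc_parent_iff[of _ a] unfolding edges_eq by (auto simp: doubleton_eq_iff)

text \<open>Every edge of a cycle other than the closing one stays on one side of the closing edge.\<close>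

lemma acyclic: "\<not> is_cycle G xs"
proof
  assume "is_cycle G xs"
  then have xs: "successively (\<lambda>x y. {x, y} \<in> edges G) xs" "distinct xs" "length xs \<ge> 3"
      "{last xs, hd xs} \<in> edges G"
    by (auto simp: is_cycle_def is_walk_def)
  have ne: "xs \<noteq> []" using xs(3) by auto
  obtain a where a: "a \<in> verts G" "a \<noteq> r" "{last xs, hd xs} = {a, p a}"
    using xs(4) by (auto simp: edges_eq)
  have "i < length xs \<Longrightarrow> xs ! i \<in> desc a \<longleftrightarrow> xs ! 0 \<in> desc a" for i
  proof (induction i)
    case (Suc i)
    have "{xs ! i, xs ! Suc i} \<noteq> {xs ! (length xs - 1), xs ! 0}"
    proof
      assume "{xs ! i, xs ! Suc i} = {xs ! (length xs - 1), xs ! 0}"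
      then have "{i, Suc i} = {length xs - 1, 0}"
        using xs(3) Suc.prems nth_eq_iff_index_eq[OF xs(2)] unfolding doubleton_eq_iff
        by (metis One_nat_def Suc_lessD diff_less length_greater_0_conv less_Suc_eq_0_disj ne)
      then show False using xs(3) by (auto simp: doubleton_eq_iff)
    qed
    then have "{xs ! i, xs ! Suc i} \<noteq> {a, p a}"
      using a(3) ne by (simp add: hd_conv_nth last_conv_nth)
    then show ?case
      using desc_edge_iff[OF successively_nth[OF xs(1) Suc.prems] a(1)] Suc by simp
  qed simp
  from this[of "length xs - 1"] have "last xs \<in> desc a \<longleftrightarrow> hd xs \<in> desc a"
    using ne by (simp add: hd_conv_nth last_conv_nth)
  then show False
    using a desc_refl[of a] parent_notin_desc[of a] by (auto simp: doubleton_eq_iff)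
qed

lemma tree: "is_tree G"
  using simple connected acyclic by (simp add: is_tree_def)

lemma deg_pos:
  assumes "2 \<le> card (verts G)" "v \<in> verts G"
  shows "0 < deg G v"
proof (cases "v = r")
  case True
  have "children r \<noteq> {}"
  proof
    assume "children r = {}"
    then have "card (verts G) = 1" using desc_eq_children[OF root] by (simp add: desc_root)
    with assms show False by simp
  qed
  then show ?thesis using True assms by (simp add: deg_eq card_gt_0_iff)
qed (use assms in \<open>simp add: deg_eq\<close>)

theorem H_stat_eq:
  assumes n: "2 \<le> card (verts G)" and w: "w \<in> verts G"
  shows "H_stat G w = ennreal ((\<Sum>a\<in>verts G - {r}. (slope w a)\<^sup>2) / (2 * edge_count))"
proof -
  have ht: "expected_hitting_time G v w = ennreal (hit w v)" if "v \<in> verts G" for v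
    by (rule expected_hitting_time_eqI[where g = "hit w", OF simple connected n that w])
      (auto simp: hit_nonneg hit_self hit_harmonic w deg_pos n)
  have "H_stat G w = (\<Sum>v\<in>verts G. ennreal (stat G v * hit w v))"
    unfolding H_stat_def
    by (intro sum.cong refl) (simp only: ht, simp add: stat_def hit_nonneg flip: ennreal_mult)
  also have "\<dots> = ennreal (\<Sum>v\<in>verts G. stat G v * hit w v)"
    by (intro sum_ennreal) (simp add: stat_def hit_nonneg)
  also have "(\<Sum>v\<in>verts G. stat G v * hit w v) = (\<Sum>v\<in>verts G. deg G v * hit w v) / (2 * edge_count)"
    by (simp add: stat_def card_edges sum_divide_distrib)
  finally show ?thesis by (simp add: sum_deg_hit[OF w])
qed

end

section \<open>Integer sequences with gaps\<close>


lemma gap_le: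
  fixes z :: "nat \<Rightarrow> int"
  assumes gap: "\<And>j. 1 \<le> j \<Longrightarrow> j < N \<Longrightarrow> 2 \<le> z j - z (Suc j)"
    and "1 \<le> i" "i \<le> j" "j \<le> N"
  shows "2 * (int j - int i) \<le> z i - z j"
  using assms(3,4)
proof (induction j rule: dec_induct)
  case (step j)
  with gap[of j] assms(2) show ?case by simp
qed simp

lemma sum_reverse:
  fixes f :: "nat \<Rightarrow> 'b::comm_monoid_add"
  shows "(\<Sum>j=1..N. f (N + 1 - j)) = (\<Sum>j=1..N. f j)"
  by (rule sum.reindex_bij_witness[of _ "\<lambda>j. N + 1 - j" "\<lambda>j. N + 1 - j"]) auto

text \<open>Pair j with N + 1 - j and use 2 (a^2 + b^2) = (a + b)^2 + (a - b)^2: the gaps bound the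
  difference from below, and the square of the sum is at best 0. The shift c leaves the gaps
  unchanged.\<close>

lemma sum_shifted_squares_ge:
  fixes z :: "nat \<Rightarrow> int" and c :: int
  assumes gap: "\<And>j. 1 \<le> j \<Longrightarrow> j < N \<Longrightarrow> 2 \<le> z j - z (Suc j)"
  shows "(\<Sum>j=1..N. (int N + 1 - 2 * int j)\<^sup>2) \<le> (\<Sum>j=1..N. (z j + c)\<^sup>2)"
    and "(\<Sum>j=1..N. (z j + c)\<^sup>2) = (\<Sum>j=1..N. (int N + 1 - 2 * int j)\<^sup>2) \<Longrightarrow> j \<in> {1..N} \<Longrightarrow>
      z j + c = int N + 1 - 2 * int j"
proof -
  define a where "a j = z j + c" for j
  define t where "t j = int N + 1 - 2 * int j" for j
  have dbl: "(\<Sum>j=1..N. (a j)\<^sup>2 + (a (N + 1 - j))\<^sup>2 - 2 * (t j)\<^sup>2) =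
      2 * ((\<Sum>j=1..N. (a j)\<^sup>2) - (\<Sum>j=1..N. (t j)\<^sup>2))"
    using sum_reverse[of "\<lambda>j. (a j)\<^sup>2" N]
    by (simp add: sum.distrib sum_subtractf flip: sum_distrib_left)
  \<comment> \<open>The signs are kept along with the sizes: in the equality case the absolute value
    of the difference alone would not distinguish t j from its negative.\<close>
  have diff: "0 \<le> t j \<and> 2 * t j \<le> a j - a (N + 1 - j) \<or> t j \<le> 0 \<and> a j - a (N + 1 - j) \<le> 2 * t j"
    if "j \<in> {1..N}" for j
  proof (cases "j \<le> N + 1 - j")
    case True
    then have "2 * (int (N + 1 - j) - int j) \<le> z j - z (N + 1 - j)"
      using that by (intro gap_le[of N] gap) auto
    then show ?thesis using True that by (auto simp: a_def t_def of_nat_diff)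
  next
    case False
    then have "2 * (int j - int (N + 1 - j)) \<le> z (N + 1 - j) - z j"
      using that by (intro gap_le[of N] gap) auto
    then show ?thesis using False that by (auto simp: a_def t_def of_nat_diff)
  qed
  have sq: "4 * (t j)\<^sup>2 \<le> (a j - a (N + 1 - j))\<^sup>2" if "j \<in> {1..N}" for j
  proof -
    have "\<bar>2 * t j\<bar> \<le> \<bar>a j - a (N + 1 - j)\<bar>" using diff[OF that] by auto
    then have "(2 * t j)\<^sup>2 \<le> (a j - a (N + 1 - j))\<^sup>2" by (simp only: abs_le_square_iff)
    then show ?thesis by (simp add: power_mult_distrib)
  qed
  have id: "2 * ((a j)\<^sup>2 + (a (N + 1 - j))\<^sup>2 - 2 * (t j)\<^sup>2) =
      (a j + a (N + 1 - j))\<^sup>2 + ((a j - a (N + 1 - j))\<^sup>2 - 4 * (t j)\<^sup>2)" for j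
    by (simp add: power2_eq_square algebra_simps)
  have nonneg: "0 \<le> (a j)\<^sup>2 + (a (N + 1 - j))\<^sup>2 - 2 * (t j)\<^sup>2" if "j \<in> {1..N}" for j
  proof -
    have "0 \<le> 2 * ((a j)\<^sup>2 + (a (N + 1 - j))\<^sup>2 - 2 * (t j)\<^sup>2)"
      unfolding id using sq[OF that] by (intro add_nonneg_nonneg) auto
    then show ?thesis by simp
  qed
  show "(\<Sum>j=1..N. (int N + 1 - 2 * int j)\<^sup>2) \<le> (\<Sum>j=1..N. (z j + c)\<^sup>2)"
  proof -
    have "0 \<le> (\<Sum>j=1..N. (a j)\<^sup>2 + (a (N + 1 - j))\<^sup>2 - 2 * (t j)\<^sup>2)"
      by (rule sum_nonneg) (rule nonneg)
    then have "(\<Sum>j=1..N. (t j)\<^sup>2) \<le> (\<Sum>j=1..N. (a j)\<^sup>2)" unfolding dbl by simp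
    then show ?thesis by (simp add: a_def t_def)
  qed
  assume eq: "(\<Sum>j=1..N. (z j + c)\<^sup>2) = (\<Sum>j=1..N. (int N + 1 - 2 * int j)\<^sup>2)"
    and j: "j \<in> {1..N}"
  have "(\<Sum>j=1..N. (a j)\<^sup>2 + (a (N + 1 - j))\<^sup>2 - 2 * (t j)\<^sup>2) = 0"
    unfolding dbl using eq by (simp add: a_def t_def)
  then have "(a j)\<^sup>2 + (a (N + 1 - j))\<^sup>2 - 2 * (t j)\<^sup>2 = 0"
    using nonneg j by (subst (asm) sum_nonneg_eq_0_iff) auto
  then have "(a j + a (N + 1 - j))\<^sup>2 + ((a j - a (N + 1 - j))\<^sup>2 - 4 * (t j)\<^sup>2) = 0"
    using id[of j] by (simp only: mult_zero_right)
  then have "(a j + a (N + 1 - j))\<^sup>2 = 0 \<and> (a j - a (N + 1 - j))\<^sup>2 - 4 * (t j)\<^sup>2 = 0"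
    using sq[OF j] by (subst (asm) add_nonneg_eq_0_iff) auto
  then have "(a j + a (N + 1 - j))\<^sup>2 = 0" and "(a j - a (N + 1 - j))\<^sup>2 = (2 * t j)\<^sup>2"
    by (simp_all only: power_mult_distrib) simp_all
  then have "a j + a (N + 1 - j) = 0" and "\<bar>a j - a (N + 1 - j)\<bar> = \<bar>2 * t j\<bar>"
    by (simp, metis power2_eq_iff abs_eq_iff)
  then have "a j = t j" using diff[OF j] by auto
  then show "z j + c = int N + 1 - 2 * int j" by (simp add: a_def t_def)
qed

lemma sum_of_nat_Suc: "2 * (\<Sum>j=1..N. int j) = int N * (int N + 1)"
  by (induction N) (auto simp: algebra_simps)

lemma sum_of_squares: "6 * (\<Sum>j=1..N. (int j)\<^sup>2) = int N * (int N + 1) * (2 * int N + 1)"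
  by (induction N) (auto simp: algebra_simps power2_eq_square)

lemma sum_centered_squares:
  "3 * (\<Sum>j=1..N. (int N + 1 - 2 * int j)\<^sup>2) = int N * ((int N)\<^sup>2 - 1)"
proof -
  have "(\<Sum>j=1..N. (int N + 1 - 2 * int j)\<^sup>2) =
      (\<Sum>j=1..N. (int N + 1)\<^sup>2 - 4 * (int N + 1) * int j + 4 * (int j)\<^sup>2)"
    by (rule sum.cong) (auto simp: power2_eq_square algebra_simps)
  also have "\<dots> = int N * (int N + 1)\<^sup>2 - 4 * (int N + 1) * (\<Sum>j=1..N. int j) + 4 * (\<Sum>j=1..N. (int j)\<^sup>2)"
    by (simp add: sum.distrib sum_subtractf flip: sum_distrib_left)
  finally have "3 * (\<Sum>j=1..N. (int N + 1 - 2 * int j)\<^sup>2) = 3 * int N * (int N + 1)\<^sup>2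
      - 6 * (int N + 1) * (2 * (\<Sum>j=1..N. int j)) + 2 * (6 * (\<Sum>j=1..N. (int j)\<^sup>2))"
    by simp
  then show ?thesis
    unfolding sum_of_nat_Suc sum_of_squares by (simp add: power2_eq_square algebra_simps)
qed

lemma sum_split_at:
  fixes f :: "nat \<Rightarrow> 'b::comm_monoid_add"
  shows "(\<Sum>j=1..p + q. f j) = (\<Sum>j=1..p. f (p + 1 - j)) + (\<Sum>j=1..q. f (p + j))"
proof -
  have "(\<Sum>j=1..p + q. f j) = (\<Sum>j=1..p. f j) + (\<Sum>j=p+1..p + q. f j)"
    using sum.ub_add_nat[of 1 p f q] by simp
  also have "(\<Sum>j=p+1..p + q. f j) = (\<Sum>j=1..q. f (p + j))"
    using sum.shift_bounds_cl_nat_ivl[of f 1 p q] by (simp add: add.commute)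
  finally show ?thesis unfolding sum_reverse .
qed

text \<open>Completing the square turns the penalty \<open>2 c \<Sum> z\<close> into a shift of the last \<open>b\<close> values.\<close>

lemma unbalanced_bound:
  fixes z :: "nat \<Rightarrow> int" and c e :: int
  assumes gap: "\<And>j. 1 \<le> j \<Longrightarrow> j < K + b \<Longrightarrow> 2 \<le> z j - z (Suc j)"
    and K: "1 \<le> K" "- e \<le> z K" and e: "e \<le> c"
  shows "(\<Sum>k=1..K. (2 * (int k - 1) - e)\<^sup>2 + 2 * c * (2 * (int k - 1) - e))
     + (\<Sum>j=1..b. (int b + 1 - 2 * int j)\<^sup>2) - int b * c\<^sup>2
    \<le> (\<Sum>j=1..K + b. (z j)\<^sup>2) + 2 * c * (\<Sum>j=1..K + b. z j)"
proof -
  have "(\<Sum>j=1..K + b. (z j)\<^sup>2) + 2 * c * (\<Sum>j=1..K + b. z j) = (\<Sum>j=1..K + b. (z j)\<^sup>2 + 2 * c * z j)"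
    by (simp add: sum.distrib sum_distrib_left)
  also have "\<dots> = (\<Sum>k=1..K. (z (K + 1 - k))\<^sup>2 + 2 * c * z (K + 1 - k))
      + (\<Sum>j=1..b. (z (K + j))\<^sup>2 + 2 * c * z (K + j))"
    by (rule sum_split_at)
  also have "(\<Sum>j=1..b. (z (K + j))\<^sup>2 + 2 * c * z (K + j)) = (\<Sum>j=1..b. (z (K + j) + c)\<^sup>2 - c\<^sup>2)"
    by (rule sum.cong) (auto simp: power2_eq_square algebra_simps)
  also have "\<dots> = (\<Sum>j=1..b. (z (K + j) + c)\<^sup>2) - int b * c\<^sup>2"
    by (simp add: sum_subtractf)
  also have "(\<Sum>j=1..b. (int b + 1 - 2 * int j)\<^sup>2) \<le> (\<Sum>j=1..b. (z (K + j) + c)\<^sup>2)"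
    by (rule sum_shifted_squares_ge(1)) (use gap in auto)
  \<comment> \<open>On x \<ge> - c the function x^2 + 2 c x increases, so the first K values, read
    from index K backwards, may be replaced by their least possible values -e, 2 - e, 4 - e,
    ...\<close>
  moreover have "(\<Sum>k=1..K. (2 * (int k - 1) - e)\<^sup>2 + 2 * c * (2 * (int k - 1) - e))
      \<le> (\<Sum>k=1..K. (z (K + 1 - k))\<^sup>2 + 2 * c * z (K + 1 - k))"
  proof (rule sum_mono)
    fix k assume k: "k \<in> {1..K}"
    define x where "x = 2 * (int k - 1) - e"
    have "2 * (int K - int (K + 1 - k)) \<le> z (K + 1 - k) - z K"
      using k K by (intro gap_le[of "K + b"] gap) auto
    then have x: "x \<le> z (K + 1 - k)" using K k by (simp add: x_def of_nat_diff)
    moreover have "- c \<le> x" using e k by (simp add: x_def)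
    ultimately have "0 \<le> (z (K + 1 - k) - x) * (z (K + 1 - k) + x + 2 * c)"
      by (intro mult_nonneg_nonneg) auto
    then show "(2 * (int k - 1) - e)\<^sup>2 + 2 * c * (2 * (int k - 1) - e)
        \<le> (z (K + 1 - k))\<^sup>2 + 2 * c * z (K + 1 - k)"
      unfolding x_def[symmetric] by (simp add: power2_eq_square algebra_simps)
  qed
  ultimately show ?thesis by simp
qed

lemma sum_unbalanced_bound:
  fixes c e :: int
  shows "3 * (\<Sum>k=1..K. (2 * (int k - 1) - e)\<^sup>2 + 2 * c * (2 * (int k - 1) - e)) =
    2 * (int K - 1) * int K * (2 * int K - 1) + 6 * (c - e) * (int K - 1) * int K
      + 3 * int K * (e\<^sup>2 - 2 * c * e)"
  by (induction K) (auto simp: algebra_simps power2_eq_square)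

text \<open>The run N, N - 2, ..., - N has N + 1 terms; this is the run without 0 if N is even and
  without 1 if N is odd. Leaving out -1 for odd N gives the negated reverse.\<close>

definition skip_middle :: "nat \<Rightarrow> nat \<Rightarrow> int" where
  "skip_middle N j = (if j \<le> N div 2 then int N + 2 - 2 * int j else int N - 2 * int j)"

lemma sum_skip_middle: "(\<Sum>j=1..N. skip_middle N j) = - int (N mod 2)"
proof -
  have "(\<Sum>j=1..N. skip_middle N j) = (\<Sum>j=1..N. int N - 2 * int j + 2 * of_bool (j \<le> N div 2))"
    by (rule sum.cong) (auto simp: skip_middle_def)
  also have "\<dots> = int N * int N - 2 * (\<Sum>j=1..N. int j) + 2 * (\<Sum>j=1..N. of_bool (j \<le> N div 2))"
    by (simp add: sum.distrib sum_subtractf flip: sum_distrib_left)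
  also have "(\<Sum>j=1..N. of_bool (j \<le> N div 2)) = int (card {1..N div 2})"
  proof -
    have "{1..N} \<inter> {j. j \<le> N div 2} = {1..N div 2}" by auto
    then show ?thesis by simp
  qed
  also have "int N * int N - 2 * (\<Sum>j=1..N. int j) + 2 * int (card {1..N div 2}) = - int (N mod 2)"
    unfolding sum_of_nat_Suc by (simp add: algebra_simps) presburger
  finally show ?thesis .
qed

text \<open>With t = N + 1 - 2 j the entry is t + 1 in the first half and t - 1 afterwards, so its
  square is t^2 + 1 - 2 t plus 4 t in the first half.\<close>

lemma sum_skip_middle_squares:
  "(\<Sum>j=1..N. (skip_middle N j)\<^sup>2) =
    (\<Sum>j=1..N. (int N + 1 - 2 * int j)\<^sup>2) + (int N)\<^sup>2 + int N - int (N mod 2)"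
proof -
  define h where "h = N div 2"
  have "(\<Sum>j=1..N. (skip_middle N j)\<^sup>2) = (\<Sum>j=1..N. (int N + 1 - 2 * int j)\<^sup>2
      + (1 - 2 * (int N + 1 - 2 * int j)) + of_bool (j \<le> h) * (4 * (int N + 1 - 2 * int j)))"
    by (rule sum.cong) (auto simp: skip_middle_def h_def power2_eq_square algebra_simps)
  also have "\<dots> = (\<Sum>j=1..N. (int N + 1 - 2 * int j)\<^sup>2) + (\<Sum>j=1..N. 1 - 2 * (int N + 1 - 2 * int j))
      + (\<Sum>j=1..N. of_bool (j \<le> h) * (4 * (int N + 1 - 2 * int j)))"
    by (simp only: sum.distrib)
  also have "(\<Sum>j=1..N. of_bool (j \<le> h) * (4 * (int N + 1 - 2 * int j))) =
      (\<Sum>j=1..h. 4 * (int N + 1 - 2 * int j))"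
    by (rule sum.mono_neutral_cong_right) (auto simp: h_def)
  also have "\<dots> = 4 * int h * (int N + 1) - 4 * (2 * (\<Sum>j=1..h. int j))"
    by (simp add: sum_subtractf sum_distrib_left algebra_simps)
  also have "(\<Sum>j=1..N. 1 - 2 * (int N + 1 - 2 * int j)) = int N - 2 * int N * (int N + 1) + 2 * (2 * (\<Sum>j=1..N. int j))"
    by (simp add: sum_subtractf sum.distrib sum_distrib_left algebra_simps)
  also have "(\<Sum>j=1..N. (int N + 1 - 2 * int j)\<^sup>2) + (int N - 2 * int N * (int N + 1) + 2 * (2 * (\<Sum>j=1..N. int j)))
       + (4 * int h * (int N + 1) - 4 * (2 * (\<Sum>j=1..h. int j))) =
     (\<Sum>j=1..N. (int N + 1 - 2 * int j)\<^sup>2) + int N + 4 * int h * (int N - int h)"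
    unfolding sum_of_nat_Suc by (simp add: algebra_simps)
  also have "4 * int h * (int N - int h) = (int N)\<^sup>2 - int (N mod 2)"
  proof -
    have N: "int N = 2 * int h + int (N mod 2)"
      unfolding h_def by (metis mult_div_mod_eq of_nat_add of_nat_mult of_nat_numeral)
    have "int (N mod 2) * int (N mod 2) = int (N mod 2)" by (cases "even N") auto
    then show ?thesis unfolding N by (simp add: power2_eq_square algebra_simps)
  qed
  finally show ?thesis by simp
qed

text \<open>Gaps of at least 2 propagate the two middle inequalities outwards, so every value lies
  at least as far from zero as the corresponding entry of \<open>skip_middle\<close>, and on the
  same side.\<close>

lemma balanced_bound:
  fixes z :: "nat \<Rightarrow> int"
  assumes gap: "\<And>j. 1 \<le> j \<Longrightarrow> j < N \<Longrightarrow> 2 \<le> z j - z (Suc j)"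
    and N: "2 \<le> N"
    and mid: "skip_middle N (N div 2) \<le> z (N div 2)"
      "z (Suc (N div 2)) \<le> skip_middle N (Suc (N div 2))"
  shows "(\<Sum>j=1..N. (skip_middle N j)\<^sup>2) \<le> (\<Sum>j=1..N. (z j)\<^sup>2)"
    and "(\<Sum>j=1..N. (z j)\<^sup>2) = (\<Sum>j=1..N. (skip_middle N j)\<^sup>2) \<Longrightarrow> j \<in> {1..N} \<Longrightarrow>
      z j = skip_middle N j"
proof -
  have bd: "0 \<le> skip_middle N j \<and> skip_middle N j \<le> z j \<or> z j \<le> skip_middle N j \<and> skip_middle N j \<le> 0"
    if j: "j \<in> {1..N}" for j
  proof (cases "j \<le> N div 2")
    case True
    then show ?thesis
      using gap_le[of N z j "N div 2", OF gap] mid(1) j by (auto simp: skip_middle_def)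
  next
    case False
    then show ?thesis
      using gap_le[of N z "Suc (N div 2)" j, OF gap] mid(2) j N by (auto simp: skip_middle_def)
  qed
  have le: "(skip_middle N j)\<^sup>2 \<le> (z j)\<^sup>2" if "j \<in> {1..N}" for j
    unfolding abs_le_square_iff[symmetric] using bd[OF that] by auto
  show "(\<Sum>j=1..N. (skip_middle N j)\<^sup>2) \<le> (\<Sum>j=1..N. (z j)\<^sup>2)"
    by (rule sum_mono) (rule le)
  assume eq: "(\<Sum>j=1..N. (z j)\<^sup>2) = (\<Sum>j=1..N. (skip_middle N j)\<^sup>2)" and j: "j \<in> {1..N}"
  have "(\<Sum>j=1..N. (z j)\<^sup>2 - (skip_middle N j)\<^sup>2) = 0" using eq by (simp add: sum_subtractf)
  then have "(z j)\<^sup>2 = (skip_middle N j)\<^sup>2"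
    using le j by (subst (asm) sum_nonneg_eq_0_iff) auto
  then have "\<bar>z j\<bar> = \<bar>skip_middle N j\<bar>" by (simp add: power2_eq_iff abs_eq_iff)
  then show "z j = skip_middle N j" using bd[OF j] by auto
qed

text \<open>More than half of the values are nonnegative, so the sum tends to be large. Replacing
  the absolute value with weight M by the linear term c L with c \<le> M makes the quadratic bound
  \<open>unbalanced_bound\<close> applicable, with K = h + 1 and e = 0.\<close>

lemma unbalanced_bound_even:
  fixes z :: "nat \<Rightarrow> int"
  assumes gap: "\<And>j. 1 \<le> j \<Longrightarrow> j < 2 * h \<Longrightarrow> 2 \<le> z j - z (Suc j)"
    and h: "1 \<le> h" and mid: "0 \<le> z (Suc h)" and M: "int h + 2 \<le> M"
  shows "(\<Sum>j=1..2 * h. (skip_middle (2 * h) j)\<^sup>2) < (\<Sum>j=1..2 * h. (z j)\<^sup>2) + 2 * M * \<bar>\<Sum>j=1..2 * h. z j\<bar>"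
proof -
  obtain b where b: "h = Suc b" using h by (cases h) auto
  \<comment> \<open>The resulting bound depends on c through 2 c h (h + 1) - (h - 1) c^2, which for
    h > 1 is largest at h + 2 + 2 / (h - 1). The nearby integer h + 2 beats
    \<open>skip_middle\<close> by 4 h + 4.\<close>
  define c where "c = int h + 2"
  define L where "L = (\<Sum>j=1..2 * h. z j)"
  have N: "2 * h = Suc h + b" by (simp add: b)
  have "c * L \<le> M * \<bar>L\<bar>"
  proof -
    have "c * L \<le> c * \<bar>L\<bar>" by (intro mult_left_mono) (auto simp: c_def)
    also have "\<dots> \<le> M * \<bar>L\<bar>" using M by (intro mult_right_mono) (auto simp: c_def)
    finally show ?thesis .
  qed
  moreover have "(\<Sum>k=1..Suc h. (2 * (int k - 1) - 0)\<^sup>2 + 2 * c * (2 * (int k - 1) - 0))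
     + (\<Sum>j=1..b. (int b + 1 - 2 * int j)\<^sup>2) - int b * c\<^sup>2
    \<le> (\<Sum>j=1..2 * h. (z j)\<^sup>2) + 2 * c * L"
    unfolding L_def N by (rule unbalanced_bound) (use gap mid in \<open>auto simp: b c_def\<close>)
  moreover have "3 * (\<Sum>j=1..2 * h. (skip_middle (2 * h) j)\<^sup>2) <
     3 * (\<Sum>k=1..Suc h. (2 * (int k - 1) - 0)\<^sup>2 + 2 * c * (2 * (int k - 1) - 0))
     + 3 * (\<Sum>j=1..b. (int b + 1 - 2 * int j)\<^sup>2) - 3 * (int b * c\<^sup>2)"
    (is "3 * ?D < 3 * ?A + 3 * ?B - _")
  proof -
    define C where "C = (\<Sum>j=1..2 * h. (int (2 * h) + 1 - 2 * int j)\<^sup>2)"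
    have "?D = C + (int (2 * h))\<^sup>2 + int (2 * h) - 0"
      unfolding sum_skip_middle_squares C_def by simp
    moreover have "3 * C = int (2 * h) * ((int (2 * h))\<^sup>2 - 1)"
      unfolding C_def by (rule sum_centered_squares)
    ultimately show ?thesis
      using sum_unbalanced_bound[where K = "Suc h" and e = 0 and c = c] sum_centered_squares[of b]
      by (simp add: c_def b power2_eq_square algebra_simps del: sum.cl_ivl_Suc)
  qed
  ultimately show ?thesis unfolding L_def by linarith
qed

text \<open>As in the even case, but both sides now pay for a nonzero sum:
  \<open>skip_middle\<close> has sum -1, whence the term 2 M on the left, and the sum of z has
  absolute value at least 1. Here K = h + 2 and e = 1.\<close>

lemma unbalanced_bound_odd:
  fixes z :: "nat \<Rightarrow> int"
  assumes gap: "\<And>j. 1 \<le> j \<Longrightarrow> j < 2 * h + 1 \<Longrightarrow> 2 \<le> z j - z (Suc j)"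
    and h: "1 \<le> h" and mid: "-1 \<le> z (Suc (Suc h))" and M: "int h + 3 \<le> M"
    and L: "1 \<le> \<bar>\<Sum>j=1..2 * h + 1. z j\<bar>"
  shows "(\<Sum>j=1..2 * h + 1. (skip_middle (2 * h + 1) j)\<^sup>2) + 2 * M <
    (\<Sum>j=1..2 * h + 1. (z j)\<^sup>2) + 2 * M * \<bar>\<Sum>j=1..2 * h + 1. z j\<bar>"
proof -
  obtain b where b: "h = Suc b" using h by (cases h) auto
  \<comment> \<open>For h > 1 the maximum over c of 2 c (h^2 + 2 h - 1) - (h - 1) c^2 lies at h + 3
    + 2 / (h - 1); with c = h + 3 the margin is again 4 h + 4.\<close>
  define c where "c = int h + 3"
  define L where "L = (\<Sum>j=1..2 * h + 1. z j)"
  have N: "2 * h + 1 = Suc (Suc h) + b" by (simp add: b)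
  have "c * (L - 1) \<le> M * (\<bar>L\<bar> - 1)"
  proof -
    have "c * (L - 1) \<le> c * (\<bar>L\<bar> - 1)" by (intro mult_left_mono) (auto simp: c_def)
    also have "\<dots> \<le> M * (\<bar>L\<bar> - 1)" using M L by (intro mult_right_mono) (auto simp: c_def L_def)
    finally show ?thesis .
  qed
  then have "c * L - c \<le> M * \<bar>L\<bar> - M" by (simp add: algebra_simps)
  moreover have "(\<Sum>k=1..Suc (Suc h). (2 * (int k - 1) - 1)\<^sup>2 + 2 * c * (2 * (int k - 1) - 1))
     + (\<Sum>j=1..b. (int b + 1 - 2 * int j)\<^sup>2) - int b * c\<^sup>2
    \<le> (\<Sum>j=1..2 * h + 1. (z j)\<^sup>2) + 2 * c * L"
    unfolding L_def N by (rule unbalanced_bound) (use gap mid in \<open>auto simp: b c_def\<close>)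
  moreover have "3 * (\<Sum>j=1..2 * h + 1. (skip_middle (2 * h + 1) j)\<^sup>2) <
     3 * (\<Sum>k=1..Suc (Suc h). (2 * (int k - 1) - 1)\<^sup>2 + 2 * c * (2 * (int k - 1) - 1))
     + 3 * (\<Sum>j=1..b. (int b + 1 - 2 * int j)\<^sup>2) - 3 * (int b * c\<^sup>2) - 6 * c"
    (is "3 * ?D < 3 * ?A + 3 * ?B - _ - _")
  proof -
    define C where "C = (\<Sum>j=1..2 * h + 1. (int (2 * h + 1) + 1 - 2 * int j)\<^sup>2)"
    have "?D = C + (int (2 * h + 1))\<^sup>2 + int (2 * h + 1) - 1"
      unfolding sum_skip_middle_squares C_def by simp
    moreover have "3 * C = int (2 * h + 1) * ((int (2 * h + 1))\<^sup>2 - 1)"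
      unfolding C_def by (rule sum_centered_squares)
    ultimately show ?thesis
      using sum_unbalanced_bound[where K = "Suc (Suc h)" and e = 1 and c = c] sum_centered_squares[of b]
      by (simp add: c_def b power2_eq_square algebra_simps del: sum.cl_ivl_Suc)
  qed
  ultimately show ?thesis unfolding L_def by linarith
qed

text \<open>If the two middle values straddle zero as in \<^const>\<open>skip_middle\<close>, the squares compare termwise;
  otherwise the sequence is so lopsided that the penalty for its sum dominates. Sequences with the
  opposite sign in the middle are reversed and negated.\<close>

theorem skip_middle_optimal:
  fixes z :: "nat \<Rightarrow> int"
  assumes gap: "\<And>j. 1 \<le> j \<Longrightarrow> j < N \<Longrightarrow> 2 \<le> z j - z (Suc j)"
    and N: "2 \<le> N" and par: "\<And>j. j \<in> {1..N} \<Longrightarrow> even (z j + int N)"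
    and M: "int N + 3 \<le> M"
  defines "P \<equiv> \<lambda>z. (\<Sum>j=1..N. (z j)\<^sup>2) + 2 * M * \<bar>\<Sum>j=1..N. z j\<bar>"
  shows "P (skip_middle N) \<le> P z"
    and "P z = P (skip_middle N) \<Longrightarrow>
      (\<forall>j\<in>{1..N}. z j = skip_middle N j) \<or> (\<forall>j\<in>{1..N}. z j = - skip_middle N (N + 1 - j))"
proof -
  define h where "h = N div 2"
  have h: "1 \<le> h" using N by (simp add: h_def)
  have PS: "P (skip_middle N) = (\<Sum>j=1..N. (skip_middle N j)\<^sup>2) + 2 * M * int (N mod 2)"
    unfolding P_def sum_skip_middle by simp
  have main: "P (skip_middle N) \<le> P z \<and> (P z = P (skip_middle N) \<longrightarrow> (\<forall>j\<in>{1..N}. z j = skip_middle N j))"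
    if gap: "\<And>j. 1 \<le> j \<Longrightarrow> j < N \<Longrightarrow> 2 \<le> z j - z (Suc j)"
      and par: "\<And>j. j \<in> {1..N} \<Longrightarrow> even (z j + int N)"
      and mid: "z (Suc h) \<le> 0" and bal: "2 \<le> z h"
      and bal': "even N \<Longrightarrow> z (Suc h) \<noteq> 0"
    for z
  proof -
    have L: "int (N mod 2) \<le> \<bar>\<Sum>j=1..N. z j\<bar>"
    proof (cases "even N")
      case False
      have "odd (\<Sum>j=1..N. z j)"
      proof -
        have "even (\<Sum>j=1..N. z j + int N)" by (rule dvd_sum) (rule par)
        then show ?thesis using False by (simp add: sum.distrib)
      qed
      then have "(\<Sum>j=1..N. z j) \<noteq> 0" by auto
      then show ?thesis by (simp add: False odd_iff_mod_2_eq_one[THEN iffD1])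
    qed auto
    have sm: "skip_middle N h = int N + 2 - 2 * int h" "skip_middle N (Suc h) = int N - 2 - 2 * int h"
      by (auto simp: skip_middle_def h_def)
    \<comment> \<open>Parity sharpens the hypotheses to the exact middle entries: 2 and -2 for even
      N, 3 and -1 for odd N.\<close>
    have "skip_middle N h \<le> z h \<and> z (Suc h) \<le> skip_middle N (Suc h)"
    proof (cases "even N")
      case True
      then have "N = 2 * h" "even (z h)" "even (z (Suc h))"
        using par[of h] par[of "Suc h"] h by (auto simp: h_def)
      then show ?thesis unfolding sm using bal mid bal' True by simp presburger
    next
      case False
      then have "N = 2 * h + 1" "odd (z h)" "odd (z (Suc h))"
        using par[of h] par[of "Suc h"] h by (auto simp: h_def elim!: oddE)
      then show ?thesis unfolding sm using bal mid by simp presburger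
    qed
    then have mid1: "skip_middle N h \<le> z h" and mid2: "z (Suc h) \<le> skip_middle N (Suc h)" by auto
    note B = balanced_bound[of N z, OF gap N mid1[unfolded h_def] mid2[unfolded h_def]]
    have "2 * M * int (N mod 2) \<le> 2 * M * \<bar>\<Sum>j=1..N. z j\<bar>"
      using L M by (intro mult_left_mono) auto
    then have "P (skip_middle N) \<le> P z"
      and "P z = P (skip_middle N) \<Longrightarrow> (\<Sum>j=1..N. (z j)\<^sup>2) = (\<Sum>j=1..N. (skip_middle N j)\<^sup>2)"
      using B(1) unfolding PS unfolding P_def by linarith+
    then show ?thesis using B(2) by blast
  qed
  have unbal: "P (skip_middle N) < P z"
    if gap: "\<And>j. 1 \<le> j \<Longrightarrow> j < N \<Longrightarrow> 2 \<le> z j - z (Suc j)"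
      and par: "\<And>j. j \<in> {1..N} \<Longrightarrow> even (z j + int N)"
      and mid: "- int (N mod 2) \<le> z (Suc (h + N mod 2))"
    for z
  proof (cases "even N")
    case True
    then have N2: "N = 2 * h" by (simp add: h_def)
    show ?thesis
      unfolding PS unfolding P_def N2
      using unbalanced_bound_even[of h z M] gap mid M h by (simp add: N2)
  next
    case False
    then have N2: "N = 2 * h + 1" by (simp add: h_def)
    have "odd (\<Sum>j=1..N. z j)"
    proof -
      have "even (\<Sum>j=1..N. z j + int N)" by (rule dvd_sum) (rule par)
      then show ?thesis using False by (simp add: sum.distrib)
    qed
    then have "1 \<le> \<bar>\<Sum>j=1..N. z j\<bar>" by (cases "(\<Sum>j=1..N. z j) = 0") auto
    moreover have "-1 \<le> z (Suc (Suc h))" using mid by (simp add: N2)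
    ultimately show ?thesis
      unfolding PS unfolding P_def N2
      using unbalanced_bound_odd[of h z M] gap M h by (simp add: N2)
  qed
  define z' where "z' j = - z (N + 1 - j)" for j
  have gap': "2 \<le> z' j - z' (Suc j)" if "1 \<le> j" "j < N" for j
    using gap[of "N - j"] that by (simp add: z'_def Suc_diff_le)
  have par': "even (z' j + int N)" if "j \<in> {1..N}" for j
  proof -
    have "N + 1 - j \<in> {1..N}" using that by auto
    from par[OF this] show ?thesis by (simp add: z'_def)
  qed
  have P': "P z' = P z"
    using sum_reverse[of "\<lambda>j. (z j)\<^sup>2" N] sum_reverse[of z N] unfolding P_def z'_def
    by (simp add: sum_negf)
  have "P (skip_middle N) \<le> P z \<and> (P z = P (skip_middle N) \<longrightarrow>
      (\<forall>j\<in>{1..N}. z j = skip_middle N j) \<or> (\<forall>j\<in>{1..N}. z' j = skip_middle N j))"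
  proof (cases "even N")
    case True
    have idx: "N + 1 - h = Suc h" "N + 1 - Suc h = h" using True by (auto simp: h_def)
    have eh: "even (z h)" "even (z (Suc h))" using par[of h] par[of "Suc h"] h True by (auto simp: h_def)
    consider "0 \<le> z (Suc h)" | "z h \<le> 0" | "z (Suc h) < 0" "2 \<le> z h"
    proof -
      have "0 \<le> z (Suc h) \<or> z h \<le> 0 \<or> z (Suc h) < 0 \<and> 2 \<le> z h"
        using eh(1) by presburger
      then show thesis using that by blast
    qed
    then show ?thesis
    proof cases
      case 1
      then show ?thesis using unbal[of z, OF gap par] True by simp
    next
      case 2
      then have "0 \<le> z' (Suc h)" unfolding z'_def idx by simp
      then show ?thesis using unbal[of z', OF gap' par'] True P' by simp
    next
      case 3
      then show ?thesis using main[of z, OF gap par] by auto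
    qed
  next
    case False
    have idx: "N + 1 - h = Suc (Suc h)" "N + 1 - Suc h = Suc h" "N + 1 - Suc (Suc h) = h"
      using False by (auto simp: h_def elim!: oddE)
    have od: "odd (z h)" "odd (z (Suc h))" "odd (z (Suc (Suc h)))"
      using par[of h] par[of "Suc h"] par[of "Suc (Suc h)"] h N False
      by (auto simp: h_def elim!: oddE)
    \<comment> \<open>The value at the exact middle \<open>Suc h\<close> is odd, hence nonzero, and
      its sign decides which neighbour has to lie beyond zero on the other side. If that neighbour
      does, the sequence straddles zero, possibly after reflection; if not, it is lopsided.\<close>
    consider "z (Suc h) < 0" "2 \<le> z h" | "z (Suc h) < 0" "z h \<le> 1"
      | "0 < z (Suc h)" "z (Suc (Suc h)) \<le> -2" | "0 < z (Suc h)" "-1 \<le> z (Suc (Suc h))"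
    proof -
      have "z (Suc h) \<noteq> 0" "z (Suc (Suc h)) \<le> -2 \<or> -1 \<le> z (Suc (Suc h))" "2 \<le> z h \<or> z h \<le> 1"
        using od(2) by auto
      then show thesis using that by linarith
    qed
    then show ?thesis
    proof cases
      case 1
      then show ?thesis using main[of z, OF gap par] False by auto
    next
      case 2
      then have "-1 \<le> z' (Suc (Suc h))" unfolding z'_def idx by simp
      then show ?thesis using unbal[of z', OF gap' par'] False P' by (simp add: odd_iff_mod_2_eq_one[THEN iffD1])
    next
      case 3
      then have "z' (Suc h) < 0" "2 \<le> z' h" unfolding z'_def idx by simp_all
      then show ?thesis using main[of z', OF gap' par'] False P' by auto
    next
      case 4
      then show ?thesis using unbal[of z, OF gap par] False by (simp add: odd_iff_mod_2_eq_one[THEN iffD1])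
    qed
  qed
  moreover have "z j = - skip_middle N (N + 1 - j)"
    if "\<forall>j\<in>{1..N}. z' j = skip_middle N j" "j \<in> {1..N}" for j
  proof -
    have "N + 1 - j \<in> {1..N}" using that(2) by auto
    with that(1) have "z' (N + 1 - j) = skip_middle N (N + 1 - j)" by blast
    then show ?thesis using that(2) by (simp add: z'_def)
  qed
  ultimately show "P (skip_middle N) \<le> P z"
    and "P z = P (skip_middle N) \<Longrightarrow>
      (\<forall>j\<in>{1..N}. z j = skip_middle N j) \<or> (\<forall>j\<in>{1..N}. z j = - skip_middle N (N + 1 - j))"
    by blast+
qed

section \<open>Trees with a spine\<close>


text \<open>The partial sums of a decreasing sequence first rise and then fall, so they are smallest
  at an end. This is why no target in a caterpillar beats both ends of the spine.\<close>

lemma partial_sum_ge_min: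
  fixes y :: "nat \<Rightarrow> int"
  assumes dec: "\<And>i j. a \<le> i \<Longrightarrow> i \<le> j \<Longrightarrow> j \<le> b \<Longrightarrow> y j \<le> y i" and k: "k \<le> b"
  shows "min 0 (\<Sum>i=a..b. y i) \<le> (\<Sum>i=a..k. y i)"
proof (cases "k < a")
  case False
  show ?thesis
  proof (cases "0 \<le> y k")
    case True
    have "0 \<le> (\<Sum>i=a..k. y i)" using dec[of _ k] True k by (intro sum_nonneg) force
    then show ?thesis by simp
  next
    case neg: False
    have "(\<Sum>i=a..b. y i) = (\<Sum>i=a..k. y i) + (\<Sum>i=Suc k..b. y i)"
      using sum.ub_add_nat[of a k y "b - k"] False k by simp
    moreover have "(\<Sum>i=Suc k..b. y i) \<le> 0"
    proof (rule sum_nonpos)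
      fix i assume "i \<in> {Suc k..b}"
      then show "y i \<le> 0" using dec[of k i] neg False by simp
    qed
    ultimately show ?thesis by simp
  qed
qed auto

text \<open>The spine descends from the root to \<open>v d\<close>, and the last two assumptions
  make both its ends leaves. This fixes the subtree sizes at the first and last spine edge, and
  thereby the outermost values of y.\<close>

locale spined_tree = rooted_tree G r p dep
  for G :: "'a ugraph" and r p dep +
  fixes v :: "nat \<Rightarrow> 'a" and d :: nat
  assumes spine_root: "v 0 = r"
    and spine_Suc: "\<And>i. i < d \<Longrightarrow> v (Suc i) \<in> verts G \<and> v (Suc i) \<noteq> r \<and> p (v (Suc i)) = v i"
    and d_ge: "2 \<le> d"
    and children_first: "children (v 0) = {v 1}"
    and children_last: "children (v d) = {}"
begin

definition off :: "'a set" where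
  "off = verts G - v ` {0..d}"

definition y :: "nat \<Rightarrow> int" where
  "y i = 2 * int (card (desc (v i))) - int (card (verts G))"

text \<open>The part of the sum of squared slopes that is common to all targets on the spine: a
  spine edge contributes (y + m)^2 or (y - m)^2 with m = n - 1, and only the cross term is left out
  here.\<close>

definition base :: int where
  "base = (\<Sum>i=1..d. (y i)\<^sup>2) + int d * (int (card (verts G)) - 1)\<^sup>2
     + (\<Sum>a\<in>off. (2 * int (card (desc a)) - 1)\<^sup>2)"

lemma spine_in: "i \<le> d \<Longrightarrow> v i \<in> verts G"
  using spine_root root spine_Suc by (cases i) auto

lemma spine_parent: "1 \<le> i \<Longrightarrow> i \<le> d \<Longrightarrow> v i \<noteq> r \<and> p (v i) = v (i - 1)"
  using spine_Suc[of "i - 1"] by simp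

lemma dep_spine: "i \<le> d \<Longrightarrow> dep (v i) = i"
proof (induction i)
  case (Suc i)
  then show ?case using dep_parent[of "v (Suc i)"] spine_Suc[of i] by simp
qed (simp add: spine_root dep_root)

lemma inj_spine: "inj_on v {0..d}"
  using dep_spine by (intro inj_onI) (metis atLeastAtMost_iff)

lemma spine_desc_iff: "j \<le> d \<Longrightarrow> v j \<in> desc a \<longleftrightarrow> (\<exists>i\<le>j. a = v i)"
proof (induction j)
  case 0
  show ?case using root_in_desc_iff spine_root by auto
next
  case (Suc j)
  then show ?case
    using desc_iff[of "v (Suc j)" a] spine_Suc[of j] by (auto simp: le_Suc_eq)
qed

lemma spine_desc_spine: "i \<le> d \<Longrightarrow> j \<le> d \<Longrightarrow> v j \<in> desc (v i) \<longleftrightarrow> i \<le> j"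
  using spine_desc_iff[of j "v i"] inj_onD[OF inj_spine, of i] by fastforce

lemma finite_off [simp]: "finite off"
  using finite_verts by (simp add: off_def)

lemma sum_nonroot:
  fixes f :: "'a \<Rightarrow> 'b::comm_monoid_add"
  shows "sum f (verts G - {r}) = (\<Sum>i=1..d. f (v i)) + sum f off"
proof -
  have "verts G - {r} = v ` {1..d} \<union> off"
  proof -
    have "{0..d} = insert 0 {1..d}" by auto
    moreover have "v ` {1..d} \<subseteq> verts G - {r}"
    proof (rule image_subsetI)
      fix i assume "i \<in> {1..d}"
      then show "v i \<in> verts G - {r}" using spine_in[of i] spine_parent[of i] by simp
    qed
    ultimately show ?thesis using spine_root root by (auto simp: off_def)
  qed
  moreover have "sum f (v ` {1..d} \<union> off) = sum f (v ` {1..d}) + sum f off"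
    by (intro sum.union_disjoint) (auto simp: off_def finite_verts)
  moreover have "sum f (v ` {1..d}) = (\<Sum>i=1..d. f (v i))"
    by (subst sum.reindex) (auto intro: inj_on_subset[OF inj_spine])
  ultimately show ?thesis by simp
qed

lemma card_verts_pos: "0 < card (verts G)"
  using root finite_verts card_gt_0_iff by blast

lemma edge_count_eq: "real (card (verts G) - Suc 0) = real (card (verts G)) - 1"
  using card_verts_pos by simp

lemma slope_spine:
  assumes "\<And>i. i \<in> {1..d} \<Longrightarrow> w \<in> desc (v i) \<longleftrightarrow> i \<le> j" and "i \<in> {1..d}"
  shows "slope w (v i) = real_of_int (y i) + edge_count - 2 * edge_count * of_bool (i \<le> j)"
  using assms by (simp add: slope_def y_def edge_count_eq)

text \<open>The target enters only through the number j of spine edges above it, so the formula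
  serves targets off the spine as well.\<close>

lemma sum_slope_spine:
  assumes "\<And>i. i \<in> {1..d} \<Longrightarrow> w \<in> desc (v i) \<longleftrightarrow> i \<le> j" and j: "j \<le> d"
  shows "(\<Sum>i=1..d. (slope w (v i))\<^sup>2) = (\<Sum>i=1..d. (real_of_int (y i))\<^sup>2) + real d * edge_count\<^sup>2
    + 2 * edge_count * (real_of_int (\<Sum>i=1..d. y i) - 2 * real_of_int (\<Sum>i=1..j. y i))"
proof -
  have "(\<Sum>i=1..d. (slope w (v i))\<^sup>2) = (\<Sum>i=1..d. (real_of_int (y i))\<^sup>2 + edge_count\<^sup>2
     + 2 * edge_count * real_of_int (y i) - 4 * edge_count * (of_bool (i \<le> j) * real_of_int (y i)))"
  proof (rule sum.cong[OF refl])
    fix i assume "i \<in> {1..d}"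
    from slope_spine[OF assms(1) this]
    have sl: "slope w (v i) = real_of_int (y i) + edge_count - 2 * edge_count * of_bool (i \<le> j)" .
    then show "(slope w (v i))\<^sup>2 = (real_of_int (y i))\<^sup>2 + edge_count\<^sup>2
     + 2 * edge_count * real_of_int (y i) - 4 * edge_count * (of_bool (i \<le> j) * real_of_int (y i))"
      unfolding sl by (cases "i \<le> j") (simp_all add: power2_eq_square algebra_simps)
  qed
  also have "\<dots> = (\<Sum>i=1..d. (real_of_int (y i))\<^sup>2) + real d * edge_count\<^sup>2
     + 2 * edge_count * (\<Sum>i=1..d. real_of_int (y i))
     - 4 * edge_count * (\<Sum>i=1..d. of_bool (i \<le> j) * real_of_int (y i))"
    unfolding sum.distrib sum_subtractf sum_distrib_left by simp
  also have "(\<Sum>i=1..d. of_bool (i \<le> j) * real_of_int (y i)) = (\<Sum>i=1..j. real_of_int (y i))"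
    using j by (intro sum.mono_neutral_cong_right) auto
  finally show ?thesis by (simp add: algebra_simps)
qed

lemma sum_slope_at_spine:
  assumes j: "j \<le> d"
  shows "(\<Sum>a\<in>verts G - {r}. (slope (v j) a)\<^sup>2) = real_of_int base
    + 2 * edge_count * (real_of_int (\<Sum>i=1..d. y i) - 2 * real_of_int (\<Sum>i=1..j. y i))"
proof -
  have "v j \<in> desc (v i) \<longleftrightarrow> i \<le> j" if "i \<in> {1..d}" for i
    using that j by (simp add: spine_desc_spine)
  note spine = sum_slope_spine[OF this j]
  have "(\<Sum>a\<in>off. (slope (v j) a)\<^sup>2) = (\<Sum>a\<in>off. (2 * real (card (desc a)) - 1)\<^sup>2)"
    using spine_desc_iff[OF j] j
    by (intro sum.cong refl) (auto simp: slope_def off_def)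
  then show ?thesis
    using spine unfolding sum_nonroot base_def by (simp add: edge_count_eq)
qed

text \<open>The larger of the values at the two spine ends, whose cross terms are opposite.\<close>

definition T_real :: real where
  "T_real = (real_of_int base + 2 * edge_count * \<bar>real_of_int (\<Sum>i=1..d. y i)\<bar>) / (2 * edge_count)"

lemma card_verts_gt: "d < card (verts G)"
proof -
  have "v ` {0..d} \<subseteq> verts G" using spine_in by auto
  then have "card (v ` {0..d}) \<le> card (verts G)" using finite_verts by (intro card_mono) auto
  then show ?thesis using inj_spine by (simp add: card_image)
qed

lemma H_stat_spine:
  assumes "j \<le> d"
  shows "H_stat G (v j) = ennreal ((real_of_int base
    + 2 * edge_count * (real_of_int (\<Sum>i=1..d. y i) - 2 * real_of_int (\<Sum>i=1..j. y i))) / (2 * edge_count))"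
  using H_stat_eq[of "v j"] spine_in[OF assms] card_verts_gt d_ge sum_slope_at_spine[OF assms] by simp

lemma H_stat_first: "H_stat G (v 0) = ennreal ((real_of_int base
    + 2 * edge_count * real_of_int (\<Sum>i=1..d. y i)) / (2 * edge_count))"
  using H_stat_spine[of 0] by simp

lemma H_stat_last: "H_stat G (v d) = ennreal ((real_of_int base
    - 2 * edge_count * real_of_int (\<Sum>i=1..d. y i)) / (2 * edge_count))"
  using H_stat_spine[of d] by simp

lemma H_stat_le_T_meet: "w \<in> verts G \<Longrightarrow> H_stat G w \<le> T_meet G"
  unfolding T_meet_def using finite_verts by (intro Max_ge) auto

lemma T_meet_ge: "ennreal T_real \<le> T_meet G"
proof (cases "0 \<le> (\<Sum>i=1..d. y i)")
  case True
  then have "ennreal T_real = H_stat G (v 0)" unfolding H_stat_first T_real_def by (simp del: of_int_sum)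
  then show ?thesis using H_stat_le_T_meet[of "v 0"] spine_in[of 0] by simp
next
  case False
  then have "ennreal T_real = H_stat G (v d)"
    unfolding H_stat_last T_real_def by (simp del: of_int_sum)
  then show ?thesis using H_stat_le_T_meet[of "v d"] spine_in[of d] by simp
qed

lemma y_first: "y 1 = int (card (verts G)) - 2"
proof -
  have "card (desc (v 0)) = Suc (card (desc (v 1)))"
    using sum_desc[of "v 0" "\<lambda>_. 1 :: nat"] spine_in[of 0] by (simp add: children_first)
  then show ?thesis by (simp add: y_def spine_root desc_root)
qed

lemma y_last: "y d = 2 - int (card (verts G))"
proof -
  have "card (desc (v d)) = 1"
    using desc_eq_children[of "v d"] spine_in[of d] by (simp add: children_last)
  then show ?thesis by (simp add: y_def)
qed

lemma y_step:
  assumes "1 \<le> i" "i < d"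
  shows "y i - y (Suc i) = 2 + 2 * (\<Sum>c\<in>{x \<in> off. p x = v i}. int (card (desc c)))"
proof -
  have ch: "children (v i) = insert (v (Suc i)) {x \<in> off. p x = v i}" (is "_ = insert _ ?X")
  proof -
    have "c = v (Suc i)" if c: "c \<noteq> r" "p c = v i" "c \<in> v ` {0..d}" for c
    proof -
      obtain j where j: "c = v j" "j \<le> d" using c(3) by auto
      then have "j \<noteq> 0" using c(1) spine_root by metis
      then have "v (j - 1) = v i" using spine_parent[of j] j c by simp
      then have "j - 1 = i" using j assms inj_onD[OF inj_spine, of "j - 1" i] by simp
      then show ?thesis using j \<open>j \<noteq> 0\<close> by auto
    qed
    moreover have "off \<subseteq> verts G - {r}"
      using spine_root by (auto simp: off_def image_iff)
    ultimately show ?thesis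
      using spine_Suc[OF assms(2)] by (auto simp: children_def off_def)
  qed
  have "v (Suc i) \<notin> ?X" using assms by (auto simp: off_def)
  then have "int (card (desc (v i))) = 1 + (int (card (desc (v (Suc i)))) + (\<Sum>c\<in>?X. int (card (desc c))))"
    using sum_desc[of "v i" "\<lambda>_. 1 :: int"] spine_in[of i] assms by (simp add: ch)
  then show ?thesis by (simp add: y_def)
qed

lemma y_gap: "1 \<le> i \<Longrightarrow> i < d \<Longrightarrow> 2 \<le> y i - y (Suc i)"
  using y_step by (simp add: sum_nonneg)

lemma y_antimono:
  assumes "1 \<le> i" "i \<le> j" "j \<le> d"
  shows "y j \<le> y i"
  using assms(2,3)
proof (induction j rule: dec_induct)
  case (step j)
  with y_gap[of j] assms(1) show ?case by simp
qed simp

lemma sum_inner: "(\<Sum>i=1..d. f (y i)) = f (y 1) + (\<Sum>j=1..d - 2. f (y (Suc j))) + (f (y d) :: int)"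
proof -
  obtain N where N: "d = Suc (Suc N)"
    using d_ge by (intro that[of "d - 2"]) simp
  have "(\<Sum>i=1..Suc (Suc N). f (y i)) = (\<Sum>i=1..Suc N. f (y i)) + f (y (Suc (Suc N)))"
    by simp
  also have "(\<Sum>i=1..Suc N. f (y i)) = f (y 1) + (\<Sum>i=Suc 1..Suc N. f (y i))"
    by (rule sum.atLeast_Suc_atMost) simp
  also have "(\<Sum>i=Suc 1..Suc N. f (y i)) = (\<Sum>j=1..N. f (y (Suc j)))"
    by (rule sum.shift_bounds_cl_Suc_ivl)
  finally show ?thesis by (simp add: N)
qed

text \<open>The outermost values are n - 2 and 2 - n and cancel, so only the d - 2 inner ones
  matter.\<close>

lemma sum_y: "(\<Sum>i=1..d. y i) = (\<Sum>j=1..d - 2. y (Suc j))"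
  using sum_inner[of "\<lambda>x. x"] by (simp add: y_first y_last del: One_nat_def)

lemma base_eq: "base = 2 * (int (card (verts G)) - 2)\<^sup>2 + (\<Sum>j=1..d - 2. (y (Suc j))\<^sup>2)
   + int d * (int (card (verts G)) - 1)\<^sup>2 + (\<Sum>a\<in>off. (2 * int (card (desc a)) - 1)\<^sup>2)"
  unfolding base_def sum_inner[of power2] y_first y_last by (simp add: power2_eq_square algebra_simps)

lemma card_off: "card off = card (verts G) - 1 - d"
proof -
  have "v ` {0..d} \<subseteq> verts G" using spine_in by auto
  then have "card off = card (verts G) - card (v ` {0..d})"
    unfolding off_def by (intro card_Diff_subset) auto
  then show ?thesis using inj_spine by (simp add: card_image)
qed

lemma off_sq_ge: "x \<in> off \<Longrightarrow> 1 \<le> (2 * int (card (desc x)) - 1)\<^sup>2"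
  using card_desc_pos[of x] by (auto simp: off_def)

lemma off_sum_ge: "int (card off) \<le> (\<Sum>a\<in>off. (2 * int (card (desc a)) - 1)\<^sup>2)"
  using sum_mono[of off "\<lambda>_. 1" "\<lambda>a. (2 * int (card (desc a)) - 1)\<^sup>2"] off_sq_ge by simp

lemma off_sum_eqD:
  assumes "(\<Sum>a\<in>off. (2 * int (card (desc a)) - 1)\<^sup>2) = int (card off)" "x \<in> off"
  shows "desc x = {x}"
proof -
  have "(\<Sum>a\<in>off. (2 * int (card (desc a)) - 1)\<^sup>2 - 1) = 0"
    using assms(1) by (simp add: sum_subtractf)
  then have "(2 * int (card (desc x)) - 1)\<^sup>2 - 1 = 0"
    using assms(2) by (subst (asm) sum_nonneg_eq_0_iff) (use off_sq_ge in \<open>simp_all only: finite_off diff_ge_0_iff_ge\<close>)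
  then have "card (desc x) = 1"
    using card_desc_pos[of x] assms(2) by (auto simp: power2_eq_1_iff off_def)
  then show ?thesis
    using desc_refl[of x] assms(2) by (auto simp: card_1_singleton_iff off_def)
qed

end

locale rooted_caterpillar = spined_tree +
  assumes desc_off: "\<And>x. x \<in> off \<Longrightarrow> desc x = {x}"
begin

lemma off_parent:
  assumes x: "x \<in> off"
  shows "\<exists>k\<in>{1..d - 1}. p x = v k"
proof -
  have xr: "x \<in> verts G" "x \<noteq> r" using x spine_root by (auto simp: off_def image_iff)
  have "p x \<notin> off"
  proof
    assume "p x \<in> off"
    then have "x \<in> {p x}" using desc_off[of "p x"] desc_iff[of x "p x"] desc_refl[of "p x"] xr parent by auto
    then show False using dep_parent[OF xr] by auto
  qed
  then obtain k where k: "k \<le> d" "p x = v k" using parent[OF xr] by (auto simp: off_def)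
  have xc: "x \<in> children (v k)" using xr k by (simp add: children_def)
  have "k \<noteq> 0"
  proof
    assume "k = 0"
    then have "x = v 1" using xc children_first by auto
    then show False using x d_ge by (auto simp: off_def)
  qed
  moreover have "k \<noteq> d" using xc children_last by auto
  ultimately show ?thesis using k by auto
qed

lemma y_step_card:
  "1 \<le> i \<Longrightarrow> i < d \<Longrightarrow> y i - y (Suc i) = 2 + 2 * int (card {x \<in> off. p x = v i})"
  using y_step[of i] desc_off by simp

text \<open>Aiming at the leaf x changes the slope of its own edge from 1 to 1 - 2 m, which adds 4 m
  (m - 1) to the squares. Since \<open>y 1\<close> equals m - 1, this cancels exactly the
  contribution of \<open>y 1\<close> to the partial sum.\<close>

lemma sum_slope_at_off:
  assumes x: "x \<in> off" and k: "k \<in> {1..d - 1}" "p x = v k"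
  shows "(\<Sum>a\<in>verts G - {r}. (slope x a)\<^sup>2) = real_of_int base
    + 2 * edge_count * (real_of_int (\<Sum>i=1..d. y i) - 2 * real_of_int ((\<Sum>i=1..k. y i) - y 1))"
proof -
  have xr: "x \<in> verts G" "x \<noteq> r" using x spine_root by (auto simp: off_def image_iff)
  have "x \<in> desc (v i) \<longleftrightarrow> i \<le> k" if "i \<in> {1..d}" for i
  proof -
    have "x \<noteq> v i" using that x by (auto simp: off_def)
    then have "x \<in> desc (v i) \<longleftrightarrow> v k \<in> desc (v i)"
      using desc_iff[OF xr(1), of "v i"] xr k by simp
    moreover have "k \<le> d" "i \<le> d" using that k by auto
    ultimately show ?thesis using spine_desc_spine[of i k] by simp
  qed
  moreover have "k \<le> d" using k by auto
  ultimately have spine: "(\<Sum>i=1..d. (slope x (v i))\<^sup>2) =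
      (\<Sum>i=1..d. (real_of_int (y i))\<^sup>2) + real d * edge_count\<^sup>2
      + 2 * edge_count * (real_of_int (\<Sum>i=1..d. y i) - 2 * real_of_int (\<Sum>i=1..k. y i))"
    by (rule sum_slope_spine)
  have "(\<Sum>a\<in>off. (slope x a)\<^sup>2) = (\<Sum>a\<in>off. 1 + (if a = x then 4 * edge_count\<^sup>2 - 4 * edge_count else 0))"
    by (intro sum.cong refl) (auto simp: slope_def desc_off power2_eq_square algebra_simps)
  also have "\<dots> = real (card off) + (4 * edge_count\<^sup>2 - 4 * edge_count)"
    using x by (simp add: sum.distrib)
  finally have offs: "(\<Sum>a\<in>off. (slope x a)\<^sup>2) = real (card off) + (4 * edge_count\<^sup>2 - 4 * edge_count)" .
  have b: "real_of_int base = (\<Sum>i=1..d. (real_of_int (y i))\<^sup>2) + real d * edge_count\<^sup>2 + real (card off)"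
    unfolding base_def by (simp add: desc_off edge_count_eq)
  show ?thesis
    unfolding sum_nonroot offs b using spine k
    by (simp add: y_first[simplified] edge_count_eq power2_eq_square algebra_simps)
qed

lemma H_stat_le:
  assumes w: "w \<in> verts G"
  shows "H_stat G w \<le> ennreal T_real"
proof -
  have "\<exists>Y. (\<Sum>a\<in>verts G - {r}. (slope w a)\<^sup>2) = real_of_int base
      + 2 * edge_count * (real_of_int (\<Sum>i=1..d. y i) - 2 * real_of_int Y) \<and> min 0 (\<Sum>i=1..d. y i) \<le> Y"
  proof (cases "w \<in> off")
    case True
    then obtain k where k: "k \<in> {1..d - 1}" "p w = v k" using off_parent by blast
    \<comment> \<open>With \<open>y 1\<close> removed, the relevant sequence is the inner one, and
      its total equals the full total because the outermost values cancel.\<close>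
    have "min 0 (\<Sum>i=2..d - 1. y i) \<le> (\<Sum>i=2..k. y i)"
      using k d_ge by (intro partial_sum_ge_min) (auto intro!: y_antimono)
    moreover have "(\<Sum>i=1..k. y i) - y 1 = (\<Sum>i=2..k. y i)"
      using k sum.atLeast_Suc_atMost[of 1 k y] by (simp add: numeral_2_eq_2)
    moreover have "(\<Sum>i=1..d. y i) = (\<Sum>i=2..d - 1. y i)"
      unfolding sum_y using d_ge sum.shift_bounds_cl_Suc_ivl[of y 1 "d - 2"]
      by (simp add: numeral_2_eq_2 Suc_diff_Suc)
    ultimately have "min 0 (\<Sum>i=1..d. y i) \<le> (\<Sum>i=1..k. y i) - y 1" by simp
    then show ?thesis using sum_slope_at_off[OF True k] by blast
  next
    case False
    then obtain j where j: "j \<le> d" "w = v j" using w by (auto simp: off_def)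
    have "min 0 (\<Sum>i=1..d. y i) \<le> (\<Sum>i=1..j. y i)"
      using j by (intro partial_sum_ge_min) (auto intro!: y_antimono)
    then show ?thesis using sum_slope_at_spine[OF j(1)] j(2) by blast
  qed
  then obtain Y where Y: "(\<Sum>a\<in>verts G - {r}. (slope w a)\<^sup>2) = real_of_int base
      + 2 * edge_count * (real_of_int (\<Sum>i=1..d. y i) - 2 * real_of_int Y)" "min 0 (\<Sum>i=1..d. y i) \<le> Y"
    by blast
  have "(\<Sum>i=1..d. y i) - 2 * Y \<le> \<bar>\<Sum>i=1..d. y i\<bar>" using Y(2) by linarith
  then have "real_of_int ((\<Sum>i=1..d. y i) - 2 * Y) \<le> real_of_int \<bar>\<Sum>i=1..d. y i\<bar>"
    by (simp only: of_int_le_iff)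
  then have "real_of_int (\<Sum>i=1..d. y i) - 2 * real_of_int Y \<le> \<bar>real_of_int (\<Sum>i=1..d. y i)\<bar>"
    by (simp only: of_int_diff of_int_mult of_int_numeral of_int_abs)
  then show ?thesis
    using H_stat_eq[OF _ w] card_verts_gt d_ge unfolding Y T_real_def
    by (auto intro!: ennreal_leI divide_right_mono mult_left_mono add_left_mono simp del: of_int_sum)
qed

theorem T_meet_eq: "T_meet G = ennreal T_real"
proof (rule antisym)
  show "T_meet G \<le> ennreal T_real"
    unfolding T_meet_def using finite_verts root H_stat_le by (intro Max.boundedI) auto
qed (rule T_meet_ge)

end

section \<open>Caterpillars\<close>


text \<open>The spine is the chain of ancestors of u. Its lower end is a leaf because no vertex is
  deeper. A second child of the root would be at distance d + 1 from u, so the root is a leaf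
  too.\<close>

lemma (in rooted_tree) ex_spined_tree:
  assumes u: "u \<in> verts G" "dep u = d" and d: "2 \<le> d"
    and dep_le: "\<And>x. x \<in> verts G \<Longrightarrow> dep x \<le> d"
    and dist_le: "\<And>x z. x \<in> verts G \<Longrightarrow> z \<in> verts G \<Longrightarrow> graph_dist G x z \<le> d"
  shows "\<exists>v. spined_tree G r p dep v d"
proof -
  have up: "(p ^^ j) u \<in> verts G \<and> dep ((p ^^ j) u) = d - j" if "j \<le> d" for j
    using that
  proof (induction j)
    case (Suc j)
    then have j: "(p ^^ j) u \<in> verts G" "dep ((p ^^ j) u) = d - j" by auto
    then have "(p ^^ j) u \<noteq> r" using Suc.prems dep_root by auto
    with j show ?case using parent dep_parent[of "(p ^^ j) u"] by simp
  qed (simp add: u)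
  define v where "v i = (p ^^ (d - i)) u" for i
  have v: "v i \<in> verts G" "dep (v i) = i" if "i \<le> d" for i
    using up[of "d - i"] that by (auto simp: v_def)
  have v0: "v 0 = r"
  proof (rule ccontr)
    assume "v 0 \<noteq> r"
    then show False using dep_parent[of "v 0"] v[of 0] by simp
  qed
  have step: "v (Suc i) \<in> verts G \<and> v (Suc i) \<noteq> r \<and> p (v (Suc i)) = v i" if "i < d" for i
  proof -
    have "d - i = Suc (d - Suc i)" using that by simp
    then have "p (v (Suc i)) = v i" by (simp add: v_def)
    moreover have "v (Suc i) \<noteq> r" using v[of "Suc i"] that dep_root by auto
    ultimately show ?thesis using v[of "Suc i"] that by simp
  qed
  have last: "children (v d) = {}"
  proof -
    have "dep c = Suc d" if "c \<in> children (v d)" for c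
      using that dep_parent[of c] v[of d] by (auto simp: children_def)
    then show ?thesis using dep_le by (force simp: children_def)
  qed
  have v_desc: "v i \<in> desc (v 1)" if "1 \<le> i" "i \<le> d" for i
    using that
  proof (induction i rule: dec_induct)
    case base
    show ?case using v[of 1] d by (intro desc_refl) auto
  next
    case (step i)
    then show ?case
      using desc_iff[of "v (Suc i)" "v 1"] \<open>\<And>i. i < d \<Longrightarrow> _\<close>[of i] by auto
  qed
  have first: "children (v 0) = {v 1}"
  proof (rule ccontr)
    assume "children (v 0) \<noteq> {v 1}"
    moreover have "v 1 \<in> children (v 0)" using step[of 0] d by (simp add: children_def)
    ultimately obtain c where c: "c \<in> verts G" "c \<noteq> r" "p c = r" "c \<noteq> v 1"
      by (auto simp: children_def v0)
    \<comment> \<open>Depth counted positively inside the branch of \<open>v 1\<close> and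
      negatively outside changes by one along every edge; it separates c from \<open>v d\<close> by
      d + 1.\<close>
    define f where "f x = (if x \<in> desc (v 1) then int (dep x) else - int (dep x))" for x
    have v1: "v 1 \<in> verts G" "v 1 \<noteq> r" "p (v 1) = r" using step[of 0] d v0 by auto
    have "f z \<le> f x + 1" if xz: "x \<in> verts G" "z \<in> verts G" "{x, z} \<in> edges G" for x z
    proof -
      obtain a where a: "a \<in> verts G" "a \<noteq> r" "{x, z} = {a, p a}" using xz by (auto simp: edges_eq)
      show ?thesis
      proof (cases "a = v 1")
        case True
        then show ?thesis
          using a v1 dep_root dep_parent[of "v 1"] by (auto simp: f_def doubleton_eq_iff)
      next
        case False
        have "{x, z} \<noteq> {v 1, p (v 1)}"
        proof
          assume "{x, z} = {v 1, p (v 1)}"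
          then have "a = r \<or> a = v 1" using a v1 by (auto simp: doubleton_eq_iff)
          then show False using a False by simp
        qed
        then have "x \<in> desc (v 1) \<longleftrightarrow> z \<in> desc (v 1)" using desc_edge_iff xz v1 by simp
        moreover have "dep x = Suc (dep z) \<or> dep z = Suc (dep x)"
          using a dep_parent[of a] by (auto simp: doubleton_eq_iff)
        ultimately show ?thesis by (auto simp: f_def)
      qed
    qed
    then have "f (v d) - f c \<le> int (graph_dist G c (v d))"
      using c v[of d] by (intro Lipschitz_le_graph_dist connected) auto
    moreover have "graph_dist G c (v d) \<le> d" using dist_le c v[of d] by simp
    moreover have "f (v d) = int d" using v_desc[of d] d v[of d] by (simp add: f_def)
    moreover have "f c = -1"
    proof -
      have "c \<notin> desc (v 1)" using desc_iff[of c "v 1"] c v1 root_in_desc_iff by auto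
      then show ?thesis using dep_parent[of c] c dep_root by (simp add: f_def)
    qed
    ultimately show False by simp
  qed
  have "spined_tree G r p dep v d"
    using v0 step d first last by unfold_locales auto
  then show ?thesis by blast
qed

lemma ex_spined_tree_of_diam:
  assumes G: "is_tree G" and d: "diam G = d" "2 \<le> d"
  shows "\<exists>r p dep v. spined_tree G r p dep v d"
proof -
  have fin: "finite (verts G)" and ne: "verts G \<noteq> {}"
    using G by (auto simp: is_tree_def simple_graph_def connected_graph_def)
  obtain u w where uw: "u \<in> verts G" "w \<in> verts G" "graph_dist G u w = diam G"
    using diam_attained[OF fin ne] by blast
  obtain p where p: "rooted_tree G w p (\<lambda>x. graph_dist G x w)"
    using is_tree_rooted[OF G uw(2)] by blast
  show ?thesis
    using rooted_tree.ex_spined_tree[OF p uw(1)] uw d graph_dist_le_diam[OF fin] by blast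
qed

text \<open>The spine \<open>v 0, \<dots>, v d\<close> includes its two end leaves; each further leaf \<open>x\<close> hangs off
  \<open>v (att x)\<close>.\<close>

definition caterpillar :: "'a ugraph \<Rightarrow> nat \<Rightarrow> (nat \<Rightarrow> 'a) \<Rightarrow> ('a \<Rightarrow> nat) \<Rightarrow> bool" where
  "caterpillar G d v att \<longleftrightarrow> finite (verts G) \<and> inj_on v {0..d} \<and> v ` {0..d} \<subseteq> verts G \<and>
     (\<forall>x\<in>verts G - v ` {0..d}. att x \<in> {1..d - 1}) \<and>
     edges G = (\<lambda>i. {v i, v (Suc i)}) ` {0..<d} \<union> (\<lambda>x. {x, v (att x)}) ` (verts G - v ` {0..d})"

definition leaf_count :: "'a ugraph \<Rightarrow> nat \<Rightarrow> (nat \<Rightarrow> 'a) \<Rightarrow> ('a \<Rightarrow> nat) \<Rightarrow> nat \<Rightarrow> nat" where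
  "leaf_count G d v att i = card {x \<in> verts G - v ` {0..d}. att x = i}"

lemma caterpillar_rooted:
  assumes C: "caterpillar G d v att" and d: "2 \<le> d"
  shows "\<exists>p dep. rooted_caterpillar G (v 0) p dep v d \<and> (\<forall>x\<in>verts G - v ` {0..d}. p x = v (att x))"
proof -
  let ?S = "v ` {0..d}"
  have fin: "finite (verts G)" and inj: "inj_on v {0..d}" and sub: "?S \<subseteq> verts G"
    and E: "edges G = (\<lambda>i. {v i, v (Suc i)}) ` {0..<d} \<union> (\<lambda>x. {x, v (att x)}) ` (verts G - ?S)"
    using C by (auto simp: caterpillar_def)
  have att: "1 \<le> att x \<and> att x < d" if "x \<in> verts G" "x \<notin> ?S" for x
  proof -
    have "att x \<in> {1..d - 1}" using C that by (simp add: caterpillar_def)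
    then show ?thesis using d by auto
  qed
  define idx where "idx = inv_into {0..d} v"
  have idx: "idx (v i) = i" if "i \<le> d" for i
    using inv_into_f_f[OF inj, of i] that by (simp add: idx_def)
  define p where "p x = (if x \<in> ?S then v (idx x - 1) else v (att x))" for x
  define dep where "dep x = (if x \<in> ?S then idx x else Suc (att x))" for x
  have p_v: "p (v i) = v (i - 1)" and dep_v: "dep (v i) = i" if "i \<le> d" for i
    using that idx by (auto simp: p_def dep_def)
  have p_off: "p x = v (att x)" and dep_off: "dep x = Suc (att x)" if "x \<notin> ?S" for x
    using that by (auto simp: p_def dep_def)
  have v_in: "v i \<in> verts G" if "i \<le> d" for i using sub that by auto
  have v_eq: "v i = v j \<longleftrightarrow> i = j" if "i \<le> d" "j \<le> d" for i j
    using inj_onD[OF inj, of i j] that by auto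
  have nonroot: "verts G - {v 0} = v ` {1..d} \<union> (verts G - ?S)"
  proof -
    have "{0..d} = insert 0 {1..d}" by auto
    moreover have "v 0 \<notin> v ` {1..d}" using v_eq by auto
    ultimately show ?thesis using sub by auto
  qed
  have nonroot_cases: "(\<exists>i\<in>{1..d}. x = v i) \<or> x \<notin> ?S" if "x \<in> verts G" "x \<noteq> v 0" for x
    using nonroot that by auto
  interpret rooted_tree G "v 0" p dep
  proof
    show "finite (verts G)" by (rule fin)
    show "v 0 \<in> verts G" using v_in by simp
    show "dep (v 0) = 0" using dep_v by simp
    show "p x \<in> verts G" if "x \<in> verts G" "x \<noteq> v 0" for x
      using nonroot_cases[OF that] att[OF that(1)] by (auto simp: p_v p_off intro!: v_in)
    show "dep x = Suc (dep (p x))" if "x \<in> verts G" "x \<noteq> v 0" for x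
      using nonroot_cases[OF that] att[OF that(1)] by (auto simp: p_v p_off dep_v dep_off)
    have "(\<lambda>i. {v i, v (Suc i)}) ` {0..<d} = (\<lambda>x. {x, p x}) ` v ` {1..d}"
    proof -
      have "(\<lambda>x. {x, p x}) ` v ` {1..d} = (\<lambda>i. {v i, p (v i)}) ` Suc ` {0..<d}"
        by (simp add: image_image image_Suc_atLeastLessThan atLeastLessThanSuc_atLeastAtMost)
      then show ?thesis unfolding image_image using p_v by (auto simp: insert_commute)
    qed
    moreover have "(\<lambda>x. {x, v (att x)}) ` (verts G - ?S) = (\<lambda>x. {x, p x}) ` (verts G - ?S)"
      by (intro image_cong) (auto simp: p_off)
    ultimately show "edges G = (\<lambda>v. {v, p v}) ` (verts G - {v 0})"
      unfolding nonroot image_Un E by simp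
  qed
  have p_cases: "\<exists>i<d. p x = v i" if "x \<in> verts G" "x \<noteq> v 0" for x
    using nonroot_cases[OF that]
  proof
    assume "\<exists>i\<in>{1..d}. x = v i"
    then obtain i where i: "1 \<le> i" "i \<le> d" "x = v i" by auto
    then show ?thesis by (intro exI[of _ "i - 1"]) (simp add: p_v)
  qed (use att[OF that(1)] p_off in blast)
  interpret spined_tree G "v 0" p dep v d
  proof
    show "v 0 = v 0" ..
    show "2 \<le> d" by (rule d)
    show "v (Suc i) \<in> verts G \<and> v (Suc i) \<noteq> v 0 \<and> p (v (Suc i)) = v i" if "i < d" for i
      using that v_in v_eq p_v[of "Suc i"] by simp
    have "c = v 1" if c: "c \<in> verts G" "c \<noteq> v 0" "p c = v 0" for c
      using nonroot_cases[OF c(1,2)]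
    proof
      assume "\<exists>i\<in>{1..d}. c = v i"
      then obtain i where i: "1 \<le> i" "i \<le> d" "c = v i" by auto
      then have "i - 1 = 0" using p_v[of i] c v_eq[of "i - 1" 0] by simp
      then show ?thesis using i by (cases i) auto
    next
      assume "c \<notin> ?S"
      then have "att c = 0" using p_off[of c] c att[of c] v_eq[of "att c" 0] by simp
      then show ?thesis using att[of c] c \<open>c \<notin> ?S\<close> by simp
    qed
    moreover have "v 1 \<in> children (v 0)"
      using d v_in v_eq p_v[of 1] by (simp add: children_def)
    ultimately show "children (v 0) = {v 1}" by (auto simp: children_def)
    have "p c \<noteq> v d" if c: "c \<in> verts G" "c \<noteq> v 0" for c
    proof -
      obtain i where "i < d" "p c = v i" using p_cases[OF c] by blast
      then show ?thesis using v_eq[of i d] by simp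
    qed
    then show "children (v d) = {}" by (auto simp: children_def)
  qed
  interpret rooted_caterpillar G "v 0" p dep v d
  proof
    fix x assume x: "x \<in> off"
    have "p c \<noteq> x" if "c \<in> verts G" "c \<noteq> v 0" for c
      using p_cases[OF that] x by (auto simp: off_def)
    then have "children x = {}" by (auto simp: children_def)
    then show "desc x = {x}" using desc_eq_children[of x] x by (simp add: off_def)
  qed
  have "rooted_caterpillar G (v 0) p dep v d" ..
  then show ?thesis using p_off by blast
qed

lemma (in rooted_caterpillar) ex_caterpillar:
  "\<exists>att. caterpillar G d v att \<and> (\<forall>x\<in>verts G - v ` {0..d}. p x = v (att x))"
proof -
  obtain att where att: "\<And>x. x \<in> off \<Longrightarrow> att x \<in> {1..d - 1} \<and> p x = v (att x)"
    using off_parent by metis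
  have nonroot: "verts G - {r} = v ` {1..d} \<union> off"
  proof -
    have "{0..d} = insert 0 {1..d}" by auto
    moreover have "v ` {1..d} \<subseteq> verts G - {r}"
    proof (rule image_subsetI)
      fix i assume "i \<in> {1..d}"
      then show "v i \<in> verts G - {r}" using spine_in[of i] spine_parent[of i] by simp
    qed
    ultimately show ?thesis using spine_root root by (auto simp: off_def)
  qed
  have "(\<lambda>x. {x, p x}) ` v ` {1..d} = (\<lambda>i. {v i, p (v i)}) ` Suc ` {0..<d}"
    by (simp add: image_image image_Suc_atLeastLessThan atLeastLessThanSuc_atLeastAtMost)
  also have "\<dots> = (\<lambda>i. {v i, v (Suc i)}) ` {0..<d}"
    unfolding image_image using spine_Suc by (intro image_cong refl) (auto simp: insert_commute)
  finally have "edges G = (\<lambda>i. {v i, v (Suc i)}) ` {0..<d} \<union> (\<lambda>x. {x, p x}) ` off"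
    unfolding edges_eq nonroot image_Un by simp
  also have "(\<lambda>x. {x, p x}) ` off = (\<lambda>x. {x, v (att x)}) ` off"
    by (intro image_cong) (auto simp: att)
  finally have "caterpillar G d v att"
    unfolding caterpillar_def using finite_verts inj_spine spine_in att by (auto simp: off_def)
  then show ?thesis using att by (auto simp: off_def)
qed

lemma (in rooted_caterpillar) y_step_leaf_count:
  assumes att: "\<And>x. x \<in> verts G - v ` {0..d} \<Longrightarrow> p x = v (att x) \<and> att x \<le> d"
    and i: "1 \<le> i" "i < d"
  shows "y i - y (Suc i) = 2 + 2 * int (leaf_count G d v att i)"
proof -
  have "{x \<in> off. p x = v i} = {x \<in> verts G - v ` {0..d}. att x = i}"
    unfolding off_def using att i inj_onD[OF inj_spine, of _ i] by force
  then show ?thesis using y_step_card[OF i] by (simp add: leaf_count_def)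
qed

section \<open>The meeting time of a caterpillar in terms of its inner sequence\<close>

definition cost :: "nat \<Rightarrow> nat \<Rightarrow> (nat \<Rightarrow> int) \<Rightarrow> int" where
  "cost n d z = (\<Sum>j=1..d - 2. (z j)\<^sup>2) + 2 * (int n - 1) * \<bar>\<Sum>j=1..d - 2. z j\<bar>"

text \<open>The fixed terms are the squares of the two outermost y, the term m^2 for each of the d
  spine edges, and 1 for each of the n - 1 - d remaining edges if they are pendant; c is what
  varies.\<close>

definition meet_value :: "nat \<Rightarrow> nat \<Rightarrow> int \<Rightarrow> real" where
  "meet_value n d c = real_of_int (2 * (int n - 2)\<^sup>2 + int d * (int n - 1)\<^sup>2 + (int n - 1 - int d) + c)
     / (2 * (real n - 1))"

lemma (in spined_tree) T_real_eq:
  "T_real = meet_value (card (verts G)) d (cost (card (verts G)) d (\<lambda>j. y (Suc j))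
     + (\<Sum>a\<in>off. (2 * int (card (desc a)) - 1)\<^sup>2) - int (card off))"
proof -
  have "real_of_int base + 2 * edge_count * \<bar>real_of_int (\<Sum>i=1..d. y i)\<bar> =
    real_of_int (base + 2 * (int (card (verts G)) - 1) * \<bar>\<Sum>i=1..d. y i\<bar>)"
    by (simp add: edge_count_eq)
  also have "base + 2 * (int (card (verts G)) - 1) * \<bar>\<Sum>i=1..d. y i\<bar> =
    2 * (int (card (verts G)) - 2)\<^sup>2 + int d * (int (card (verts G)) - 1)\<^sup>2 + (int (card (verts G)) - 1 - int d)
    + (cost (card (verts G)) d (\<lambda>j. y (Suc j))
     + (\<Sum>a\<in>off. (2 * int (card (desc a)) - 1)\<^sup>2) - int (card off))"
    unfolding base_eq sum_y cost_def card_off using card_verts_gt by (simp add: of_nat_diff)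
  finally show ?thesis unfolding T_real_def meet_value_def by (simp add: edge_count_eq)
qed

lemma (in rooted_caterpillar) T_real_caterpillar:
  "T_real = meet_value (card (verts G)) d (cost (card (verts G)) d (\<lambda>j. y (Suc j)))"
  unfolding T_real_eq by (simp add: desc_off)

text \<open>The leaf counts determine the differences of y, and the value at d fixes the rest by
  backward induction, so an explicit Y for a concrete tree can be checked locally. If the inner sum
  vanishes, both ends of the spine attain the maximum.\<close>

lemma caterpillar_T_meet:
  assumes C: "caterpillar G d v att" and d: "2 \<le> d" and n: "card (verts G) = n"
    and Y: "Y d = 2 - int n" "\<And>i. 1 \<le> i \<Longrightarrow> i < d \<Longrightarrow> Y i - Y (Suc i) = 2 + 2 * int (leaf_count G d v att i)"
  shows "T_meet G = ennreal (meet_value n d (cost n d (\<lambda>j. Y (Suc j))))"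
    and "Y 1 = int n - 2"
    and "(\<Sum>j=1..d - 2. Y (Suc j)) = 0 \<Longrightarrow> T_meet G = H_stat G (v d)"
proof -
  obtain p dep where R: "rooted_caterpillar G (v 0) p dep v d"
    and p: "\<forall>x\<in>verts G - v ` {0..d}. p x = v (att x)"
    using caterpillar_rooted[OF C d] by blast
  interpret rooted_caterpillar G "v 0" p dep v d by (rule R)
  have att: "p x = v (att x) \<and> att x \<le> d" if "x \<in> verts G - v ` {0..d}" for x
  proof -
    have "att x \<in> {1..d - 1}" using C that by (simp add: caterpillar_def)
    then show ?thesis using p that by auto
  qed
  have yY: "y i = Y i" if "1 \<le> i" "i \<le> d" for i
    using that(2,1)
  proof (induction i rule: inc_induct)
    case base
    show ?case by (simp add: y_last Y n)
  next
    case (step i)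
    have "y i - y (Suc i) = Y i - Y (Suc i)"
      using y_step_leaf_count[OF att, of i] Y(2)[of i] step by simp
    then show ?case using step by simp
  qed
  show "Y 1 = int n - 2" using yY[of 1] d y_first n by simp
  have s: "(\<Sum>j=1..d - 2. y (Suc j)) = (\<Sum>j=1..d - 2. Y (Suc j))"
    by (intro sum.cong) (auto simp: yY)
  have "cost n d (\<lambda>j. y (Suc j)) = cost n d (\<lambda>j. Y (Suc j))"
  proof -
    have "(\<Sum>j=1..d - 2. (y (Suc j))\<^sup>2) = (\<Sum>j=1..d - 2. (Y (Suc j))\<^sup>2)"
      by (intro sum.cong) (auto simp: yY)
    then show ?thesis unfolding cost_def s by simp
  qed
  then show "T_meet G = ennreal (meet_value n d (cost n d (\<lambda>j. Y (Suc j))))"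
    using T_meet_eq T_real_caterpillar n by simp
  assume "(\<Sum>j=1..d - 2. Y (Suc j)) = 0"
  then have "(\<Sum>i=1..d. y i) = 0" using s sum_y by simp
  then show "T_meet G = H_stat G (v d)"
    unfolding T_meet_eq H_stat_last T_real_def by (simp del: of_int_sum)
qed

lemma relpow_sym: "sym R \<Longrightarrow> (x, y) \<in> R ^^ k \<Longrightarrow> (y, x) \<in> R ^^ k"
proof (induction k arbitrary: y)
  case (Suc k)
  then obtain z where "(x, z) \<in> R ^^ k" "(z, y) \<in> R" by auto
  then show ?case using Suc relpow_Suc_I2[of y z R x k] by (auto dest: symD)
qed simp

text \<open>Every vertex is within e \<le> min(i, d - i) of some \<open>v i\<close>: a spine vertex
  with e = 0, a leaf with e = 1. This bounds all distances by d, and the depth certifies that the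
  ends of the spine are d apart.\<close>

lemma caterpillar_tree_diam:
  assumes C: "caterpillar G d v att" and d: "2 \<le> d"
  shows "is_tree G" and "diam G = d"
proof -
  obtain p dep where R: "rooted_caterpillar G (v 0) p dep v d"
    and p: "\<forall>x\<in>verts G - v ` {0..d}. p x = v (att x)"
    using caterpillar_rooted[OF C d] by blast
  interpret rooted_caterpillar G "v 0" p dep v d by (rule R)
  show "is_tree G" by (rule tree)
  have up: "(v (i + k), v i) \<in> adj G ^^ k" if "i + k \<le> d" for i k
    using that
  proof (induction k)
    case (Suc k)
    then have "(v (i + Suc k), v (i + k)) \<in> adj G"
      using adj_parent[of "v (Suc (i + k))"] spine_Suc[of "i + k"] by simp
    then show ?case using relpow_Suc_I2 Suc by fastforce
  qed simp
  have spine: "(v i, v j) \<in> adj G ^^ nat \<bar>int i - int j\<bar>" if "i \<le> d" "j \<le> d" for i j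
  proof (cases "i \<le> j")
    case True
    then have "nat \<bar>int i - int j\<bar> = j - i" by simp
    then show ?thesis using relpow_sym[OF sym_adj up[of i "j - i"]] True that by simp
  next
    case False
    then have "nat \<bar>int i - int j\<bar> = i - j" by simp
    then show ?thesis using up[of j "i - j"] False that by simp
  qed
  have near: "\<exists>i e. (x, v i) \<in> adj G ^^ e \<and> e \<le> i \<and> i + e \<le> d" if x: "x \<in> verts G" for x
  proof (cases "x \<in> off")
    case True
    then have xr: "x \<noteq> v 0" by (auto simp: off_def)
    obtain k where "k \<in> {1..d - 1}" "p x = v k" using off_parent[OF True] by blast
    then show ?thesis
      using adj_parent[OF x xr] d by (intro exI[of _ k] exI[of _ 1]) auto
  next
    case False
    then obtain i where "i \<le> d" "x = v i" using x by (auto simp: off_def)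
    then show ?thesis by (intro exI[of _ i] exI[of _ 0]) simp
  qed
  have le: "graph_dist G x z \<le> d" if xz: "x \<in> verts G" "z \<in> verts G" for x z
  proof -
    obtain i e where i: "(x, v i) \<in> adj G ^^ e" "e \<le> i" "i + e \<le> d" using near[OF xz(1)] by blast
    obtain j e' where j: "(z, v j) \<in> adj G ^^ e'" "e' \<le> j" "j + e' \<le> d" using near[OF xz(2)] by blast
    have "(x, z) \<in> adj G ^^ (e + nat \<bar>int i - int j\<bar> + e')"
      unfolding relpow_add using i j spine[of i j] relpow_sym[OF sym_adj j(1)] by auto
    then have "graph_dist G x z \<le> e + nat \<bar>int i - int j\<bar> + e'" by (rule graph_dist_le[OF xz(1)])
    also have "\<dots> \<le> d" using i j by auto
    finally show ?thesis .
  qed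
  have "int (dep (v d)) - int (dep (v 0)) \<le> int (graph_dist G (v 0) (v d))"
  proof (rule Lipschitz_le_graph_dist[OF connected])
    fix x z assume "x \<in> verts G" "z \<in> verts G" "{x, z} \<in> edges G"
    then obtain a where "a \<in> verts G" "a \<noteq> v 0" "{x, z} = {a, p a}" by (auto simp: edges_eq)
    then show "int (dep z) \<le> int (dep x) + 1"
      using dep_parent[of a] by (auto simp: doubleton_eq_iff)
  qed (use spine_in in auto)
  then have "d \<le> graph_dist G (v 0) (v d)" by (simp add: dep_spine)
  also have "\<dots> \<le> diam G" 
    using graph_dist_le_diam[OF finite_verts spine_in spine_in, of 0 d] by simp
  finally have "d \<le> diam G" .
  moreover have "diam G \<le> d"
  proof -
    obtain x z where "x \<in> verts G" "z \<in> verts G" "graph_dist G x z = diam G"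
      using diam_attained[OF finite_verts] root by blast
    then show ?thesis using le by metis
  qed
  ultimately show "diam G = d" by simp
qed

section \<open>Extremality\<close>


lemma graph_isoI:
  assumes f: "bij_betw f (verts G) (verts H)"
    and E: "edges H = (\<lambda>e. f ` e) ` edges G" and sub: "\<And>e. e \<in> edges G \<Longrightarrow> e \<subseteq> verts G"
  shows "graph_iso G H"
  unfolding graph_iso_def
proof (intro exI conjI ballI)
  fix u w assume uw: "u \<in> verts G" "w \<in> verts G"
  have inj: "inj_on f (verts G)" using f by (simp add: bij_betw_def)
  show "{u, w} \<in> edges G \<longleftrightarrow> {f u, f w} \<in> edges H"
  proof
    assume "{f u, f w} \<in> edges H"
    then obtain e where e: "e \<in> edges G" "f ` e = f ` {u, w}" using E by auto
    then have "e = {u, w}"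
      using inj_on_image_eq_iff[OF inj, of e "{u, w}"] sub uw by simp
    then show "{u, w} \<in> edges G" using e by simp
  next
    assume "{u, w} \<in> edges G"
    then have "f ` {u, w} \<in> edges H" unfolding E by (rule imageI)
    then show "{f u, f w} \<in> edges H" by simp
  qed
qed (rule f)

lemma caterpillar_edge_subset:
  assumes "caterpillar G d v att" "e \<in> edges G"
  shows "e \<subseteq> verts G"
proof -
  have v: "v i \<in> verts G" if "i \<le> d" for i
    using assms(1) that by (auto simp: caterpillar_def)
  have att: "att x \<le> d" if "x \<in> verts G - v ` {0..d}" for x
  proof -
    have "att x \<in> {1..d - 1}" using assms(1) that by (simp add: caterpillar_def)
    then show ?thesis by auto
  qed
  have "e \<in> (\<lambda>i. {v i, v (Suc i)}) ` {0..<d} \<union> (\<lambda>x. {x, v (att x)}) ` (verts G - v ` {0..d})"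
    using assms by (simp add: caterpillar_def)
  then show ?thesis
  proof
    assume "e \<in> (\<lambda>i. {v i, v (Suc i)}) ` {0..<d}"
    then show ?thesis using v by auto
  next
    assume "e \<in> (\<lambda>x. {x, v (att x)}) ` (verts G - v ` {0..d})"
    then show ?thesis using v att by auto
  qed
qed

text \<open>The spines are matched index by index, and the leaves at each spine vertex by any
  bijection between the two classes of equal size.\<close>

lemma caterpillar_iso:
  assumes G: "caterpillar G d v att" and H: "caterpillar H d v' att'"
    and eq: "\<And>i. 1 \<le> i \<Longrightarrow> i < d \<Longrightarrow> leaf_count G d v att i = leaf_count H d v' att' i"
  shows "graph_iso G H"
proof -
  let ?S = "v ` {0..d}" and ?S' = "v' ` {0..d}"
  let ?X = "verts G - ?S" and ?X' = "verts H - ?S'"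
  have fin: "finite (verts G)" "finite (verts H)" and inj: "inj_on v {0..d}" "inj_on v' {0..d}"
    and sub: "?S \<subseteq> verts G" "?S' \<subseteq> verts H"
    and att: "\<And>x. x \<in> ?X \<Longrightarrow> att x \<in> {1..d - 1}" "\<And>x. x \<in> ?X' \<Longrightarrow> att' x \<in> {1..d - 1}"
    and E: "edges G = (\<lambda>i. {v i, v (Suc i)}) ` {0..<d} \<union> (\<lambda>x. {x, v (att x)}) ` ?X"
      "edges H = (\<lambda>i. {v' i, v' (Suc i)}) ` {0..<d} \<union> (\<lambda>x. {x, v' (att' x)}) ` ?X'"
    using G H by (simp_all add: caterpillar_def)
  have "\<exists>g. bij_betw g {x \<in> ?X. att x = i} {x \<in> ?X'. att' x = i}" if "i \<in> {1..d - 1}" for i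
  proof (rule finite_same_card_bij)
    show "card {x \<in> ?X. att x = i} = card {x \<in> ?X'. att' x = i}"
      using eq[of i] that unfolding leaf_count_def by auto
  qed (use fin in simp_all)
  then have "\<forall>i\<in>{1..d - 1}. \<exists>g. bij_betw g {x \<in> ?X. att x = i} {x \<in> ?X'. att' x = i}" by blast
  from bchoice[OF this] obtain g where
    g: "\<And>i. i \<in> {1..d - 1} \<Longrightarrow> bij_betw (g i) {x \<in> ?X. att x = i} {x \<in> ?X'. att' x = i}"
    by blast
  have gX: "g (att x) x \<in> ?X'" "att' (g (att x) x) = att x" if "x \<in> ?X" for x
    using bij_betwE[OF g[OF att(1)[OF that]]] that by auto
  have bijX: "bij_betw (\<lambda>x. g (att x) x) ?X ?X'"
  proof (rule bij_betw_imageI)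
    show "inj_on (\<lambda>x. g (att x) x) ?X"
    proof (rule inj_onI)
      fix x z assume xz: "x \<in> ?X" "z \<in> ?X" "g (att x) x = g (att z) z"
      then have "att x = att z" using gX(2) by metis
      then show "x = z"
        using bij_betw_imp_inj_on[OF g[OF att(1)[OF xz(1)]]] xz by (auto dest: inj_onD)
    qed
    show "(\<lambda>x. g (att x) x) ` ?X = ?X'"
    proof (intro equalityI subsetI)
      fix z assume z: "z \<in> ?X'"
      have "z \<in> g (att' z) ` {x \<in> ?X. att x = att' z}"
        using bij_betw_imp_surj_on[OF g[OF att(2)[OF z]]] z by auto
      then obtain x where "x \<in> ?X" "att x = att' z" "z = g (att' z) x" by auto
      then show "z \<in> (\<lambda>x. g (att x) x) ` ?X" by (intro image_eqI[of _ _ x]) auto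
    next
      fix z assume "z \<in> (\<lambda>x. g (att x) x) ` ?X"
      then obtain x where "x \<in> ?X" "z = g (att x) x" by blast
      then show "z \<in> ?X'" using gX(1)[of x] by simp
    qed
  qed
  define f where "f x = (if x \<in> ?S then v' (inv_into {0..d} v x) else g (att x) x)" for x
  have fv: "f (v i) = v' i" if "i \<le> d" for i
    using that inv_into_f_f[OF inj(1), of i] by (simp add: f_def)
  have fX: "f x = g (att x) x" if "x \<in> ?X" for x using that by (simp add: f_def)
  have bijS: "bij_betw f ?S ?S'"
  proof (rule bij_betw_imageI)
    show "inj_on f ?S"
    proof (rule inj_onI)
      fix x z assume "x \<in> ?S" "z \<in> ?S" and eq: "f x = f z"
      then obtain i j where ij: "x = v i" "i \<le> d" "z = v j" "j \<le> d" by auto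
      then have "v' i = v' j" using eq fv by simp
      then show "x = z" using inj_onD[OF inj(2), of i j] ij by simp
    qed
    show "f ` ?S = ?S'" unfolding image_image using fv by (intro image_cong) auto
  qed
  have "bij_betw f (?S \<union> ?X) (?S' \<union> ?X')"
  proof (rule bij_betw_combine[OF bijS])
    show "bij_betw f ?X ?X'" using bijX bij_betw_cong[of ?X f "\<lambda>x. g (att x) x"] fX by blast
  qed auto
  moreover have "?S \<union> ?X = verts G" "?S' \<union> ?X' = verts H" using sub by auto
  ultimately have bij: "bij_betw f (verts G) (verts H)" by simp
  have "edges H = (\<lambda>e. f ` e) ` edges G"
  proof -
    have "(\<lambda>e. f ` e) ` (\<lambda>i. {v i, v (Suc i)}) ` {0..<d} = (\<lambda>i. {v' i, v' (Suc i)}) ` {0..<d}"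
      unfolding image_image using fv by (intro image_cong) auto
    moreover have "(\<lambda>e. f ` e) ` (\<lambda>x. {x, v (att x)}) ` ?X = (\<lambda>x. {x, v' (att' x)}) ` ?X'"
    proof -
      have "(\<lambda>e. f ` e) ` (\<lambda>x. {x, v (att x)}) ` ?X =
          (\<lambda>x. {g (att x) x, v' (att' (g (att x) x))}) ` ?X"
        unfolding image_image
      proof (rule image_cong[OF refl])
        fix x assume x: "x \<in> ?X"
        then have "att x \<le> d" using att(1)[OF x] by auto
        then show "f ` {x, v (att x)} = {g (att x) x, v' (att' (g (att x) x))}"
          using fX[OF x] fv gX[OF x] by simp
      qed
      also have "\<dots> = (\<lambda>x. {x, v' (att' x)}) ` (\<lambda>x. g (att x) x) ` ?X"
        unfolding image_image ..
      finally show ?thesis using bij_betw_imp_surj_on[OF bijX] by simp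
    qed
    ultimately show ?thesis unfolding E image_Un by simp
  qed
  then show ?thesis
    using bij caterpillar_edge_subset[OF G] by (intro graph_isoI) auto
qed

text \<open>An optimal sequence is determined only up to reversal with negation, which corresponds
  to reading the spine from its other end.\<close>

lemma caterpillar_reverse:
  assumes "caterpillar G d v att"
  shows "caterpillar G d (\<lambda>i. v (d - i)) (\<lambda>x. d - att x)"
    and "1 \<le> i \<Longrightarrow> i < d \<Longrightarrow>
      leaf_count G d (\<lambda>i. v (d - i)) (\<lambda>x. d - att x) i = leaf_count G d v att (d - i)"
proof -
  have rev: "(\<lambda>i. d - i) ` {0..d} = {0..d}"
  proof (intro equalityI subsetI)
    fix i assume "i \<in> {0..d}"
    then have "i = d - (d - i)" "d - i \<in> {0..d}" by auto
    then show "i \<in> (\<lambda>i. d - i) ` {0..d}" by (rule image_eqI)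
  qed auto
  have S: "(\<lambda>i. v (d - i)) ` {0..d} = v ` {0..d}"
    using image_image[of v "\<lambda>i. d - i" "{0..d}"] rev by simp
  have att: "1 \<le> att x \<and> att x < d" if "x \<in> verts G - v ` {0..d}" for x
  proof -
    have "att x \<in> {1..d - 1}" using assms that by (simp add: caterpillar_def)
    then show ?thesis by auto
  qed
  have "(\<lambda>i. {v (d - i), v (d - Suc i)}) ` {0..<d} = (\<lambda>i. {v i, v (Suc i)}) ` {0..<d}"
  proof -
    have "(\<lambda>i. {v (d - i), v (d - Suc i)}) ` {0..<d} =
        (\<lambda>i. {v i, v (Suc i)}) ` (\<lambda>i. d - Suc i) ` {0..<d}"
      unfolding image_image by (intro image_cong) (auto simp: insert_commute Suc_diff_Suc)
    also have "(\<lambda>i. d - Suc i) ` {0..<d} = {0..<d}"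
    proof (intro equalityI subsetI)
      fix i assume "i \<in> {0..<d}"
      then have "i = d - Suc (d - Suc i)" "d - Suc i \<in> {0..<d}" by auto
      then show "i \<in> (\<lambda>i. d - Suc i) ` {0..<d}" by (rule image_eqI)
    qed auto
    finally show ?thesis .
  qed
  moreover have "(\<lambda>x. {x, v (d - (d - att x))}) ` (verts G - v ` {0..d}) =
      (\<lambda>x. {x, v (att x)}) ` (verts G - v ` {0..d})"
  proof (rule image_cong[OF refl])
    fix x assume "x \<in> verts G - v ` {0..d}"
    then show "{x, v (d - (d - att x))} = {x, v (att x)}" using att[of x] by simp
  qed
  moreover have "inj_on (\<lambda>i. v (d - i)) {0..d}"
  proof (rule inj_onI)
    fix i j assume ij: "i \<in> {0..d}" "j \<in> {0..d}" "v (d - i) = v (d - j)"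
    have "inj_on v {0..d}" using assms by (simp add: caterpillar_def)
    from inj_onD[OF this ij(3)] show "i = j" using ij by auto
  qed
  moreover have "d - att x \<in> {1..d - 1}" if "x \<in> verts G - v ` {0..d}" for x
    using att[OF that] by auto
  ultimately show "caterpillar G d (\<lambda>i. v (d - i)) (\<lambda>x. d - att x)"
    using assms unfolding caterpillar_def S by auto
  assume i: "1 \<le> i" "i < d"
  have "{x \<in> verts G - v ` {0..d}. d - att x = i} = {x \<in> verts G - v ` {0..d}. att x = d - i}"
  proof (rule Collect_cong, rule conj_cong[OF refl])
    fix x assume "x \<in> verts G - v ` {0..d}"
    then show "d - att x = i \<longleftrightarrow> att x = d - i" using att[of x] i by auto
  qed
  then show "leaf_count G d (\<lambda>i. v (d - i)) (\<lambda>x. d - att x) i = leaf_count G d v att (d - i)"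
    unfolding leaf_count_def S by simp
qed

text \<open>Used for the converse half of uniqueness: the meeting time of a caterpillar is a
  function of its leaf counts, so transporting these along the isomorphism shows that isomorphic
  trees have equal meeting times.\<close>

lemma iso_caterpillar:
  assumes iso: "graph_iso G H" and H: "caterpillar H d v att" and G: "simple_graph G"
  shows "\<exists>v' att'. caterpillar G d v' att' \<and> leaf_count G d v' att' = leaf_count H d v att"
proof -
  obtain f where f: "bij_betw f (verts G) (verts H)"
    and E: "\<And>u w. u \<in> verts G \<Longrightarrow> w \<in> verts G \<Longrightarrow> {u, w} \<in> edges G \<longleftrightarrow> {f u, f w} \<in> edges H"
    using iso by (auto simp: graph_iso_def)
  define h where "h = inv_into (verts G) f"
  have h: "bij_betw h (verts H) (verts G)" unfolding h_def by (rule bij_betw_inv_into[OF f])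
  have hf: "h (f x) = x" "f x \<in> verts H" if "x \<in> verts G" for x
    using f that by (auto simp: h_def bij_betw_def)
  have fh: "f (h x) = x" "h x \<in> verts G" if "x \<in> verts H" for x
    using f bij_betwE[OF h] that bij_betw_inv_into_right[OF f] by (auto simp: h_def)
  have injh: "inj_on h (verts H)" using h by (simp add: bij_betw_def)
  let ?S = "v ` {0..d}"
  have sub: "?S \<subseteq> verts H" and injv: "inj_on v {0..d}"
    and att: "\<And>x. x \<in> verts H - ?S \<Longrightarrow> att x \<in> {1..d - 1}"
    and EH: "edges H = (\<lambda>i. {v i, v (Suc i)}) ` {0..<d} \<union> (\<lambda>x. {x, v (att x)}) ` (verts H - ?S)"
    using H by (simp_all add: caterpillar_def)
  have S: "(\<lambda>i. h (v i)) ` {0..d} = h ` ?S" by (simp add: image_image)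
  have X: "verts G - h ` ?S = h ` (verts H - ?S)"
    using inj_on_image_set_diff[OF injh, of "verts H" ?S] sub bij_betw_imp_surj_on[OF h] by auto
  have EG: "edges G = (\<lambda>e. h ` e) ` edges H"
  proof (intro equalityI subsetI)
    fix e assume e: "e \<in> edges G"
    then have "card e = 2" "e \<subseteq> verts G" using G by (auto simp: simple_graph_def)
    then obtain u w where uw: "e = {u, w}" "u \<in> verts G" "w \<in> verts G"
      by (auto simp: card_2_iff)
    then have "{f u, f w} \<in> edges H" using E e by simp
    moreover have "h ` {f u, f w} = e" using uw hf by simp
    ultimately show "e \<in> (\<lambda>e. h ` e) ` edges H" by (metis imageI)
  next
    fix e assume "e \<in> (\<lambda>e. h ` e) ` edges H"
    then obtain e' where e': "e' \<in> edges H" "e = h ` e'" by auto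
    have "e' \<subseteq> verts H" using caterpillar_edge_subset[OF H e'(1)] .
    moreover have "\<exists>u w. e' = {u, w}" using e'(1) unfolding EH by auto
    ultimately obtain u w where uw: "e' = {u, w}" "u \<in> verts H" "w \<in> verts H" by auto
    then show "e \<in> edges G" using E[of "h u" "h w"] fh e' by simp
  qed
  have C: "caterpillar G d (\<lambda>i. h (v i)) (\<lambda>x. att (f x))"
    unfolding caterpillar_def S
  proof (intro conjI ballI)
    show "finite (verts G)" using G by (simp add: simple_graph_def)
    show "inj_on (\<lambda>i. h (v i)) {0..d}"
      using comp_inj_on[OF injv inj_on_subset[OF injh sub]] by (simp add: comp_def)
    show "h ` ?S \<subseteq> verts G" using fh sub by auto
    show "att (f x) \<in> {1..d - 1}" if "x \<in> verts G - h ` ?S" for x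
      using that att unfolding X by (auto simp: fh)
    have "(\<lambda>e. h ` e) ` (\<lambda>i. {v i, v (Suc i)}) ` {0..<d} = (\<lambda>i. {h (v i), h (v (Suc i))}) ` {0..<d}"
      unfolding image_image by simp
    moreover have "(\<lambda>e. h ` e) ` (\<lambda>x. {x, v (att x)}) ` (verts H - ?S) =
        (\<lambda>x. {x, h (v (att (f x)))}) ` (verts G - h ` ?S)"
    proof -
      have "(\<lambda>x. {x, h (v (att (f x)))}) ` (verts G - h ` ?S) =
          (\<lambda>x. {h x, h (v (att (f (h x))))}) ` (verts H - ?S)"
        unfolding X by (rule image_image)
      also have "\<dots> = (\<lambda>x. h ` {x, v (att x)}) ` (verts H - ?S)"
        by (rule image_cong) (simp_all add: fh)
      also have "\<dots> = (\<lambda>e. h ` e) ` (\<lambda>x. {x, v (att x)}) ` (verts H - ?S)"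
        by (rule image_image[symmetric])
      finally show ?thesis ..
    qed
    ultimately show "edges G = (\<lambda>i. {h (v i), h (v (Suc i))}) ` {0..<d} \<union>
        (\<lambda>x. {x, h (v (att (f x)))}) ` (verts G - h ` ?S)"
      unfolding EG EH image_Un by simp
  qed
  have "leaf_count G d (\<lambda>i. h (v i)) (\<lambda>x. att (f x)) i = leaf_count H d v att i" for i
  proof -
    have "{x \<in> verts G - h ` ?S. att (f x) = i} = h ` {x \<in> verts H - ?S. att x = i}"
      unfolding X by (auto simp: fh)
    moreover have "inj_on h {x \<in> verts H - ?S. att x = i}"
      by (rule inj_on_subset[OF injh]) auto
    ultimately show ?thesis unfolding leaf_count_def S by (simp add: card_image)
  qed
  with C show ?thesis by blast
qed

section \<open>From the integer problem to trees\<close>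

lemma meet_value_mono: "2 \<le> n \<Longrightarrow> meet_value n d a \<le> meet_value n d b \<longleftrightarrow> a \<le> b"
  by (simp add: meet_value_def divide_le_cancel)

lemma cost_cong: "(\<And>j. j \<in> {1..d - 2} \<Longrightarrow> z j = z' j) \<Longrightarrow> cost n d z = cost n d z'"
  unfolding cost_def by simp

lemma cost_nonneg: "1 \<le> n \<Longrightarrow> 0 \<le> cost n d z"
  unfolding cost_def by (intro add_nonneg_nonneg sum_nonneg mult_nonneg_nonneg) auto

lemma meet_value_nonneg: "d < n \<Longrightarrow> 0 \<le> c \<Longrightarrow> 0 \<le> meet_value n d c"
  unfolding meet_value_def by (intro divide_nonneg_nonneg) auto

text \<open>Optimality and uniqueness among trees follow from the integer problem
  \<open>opt\<close>. Equality in the lower bound forces all edges off the spine to be pendant, so G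
  is a caterpillar, and then its inner sequence determines the leaf counts. The alternative
  \<open>- Y (d - j)\<close> is the spine of B read backwards.\<close>

theorem extremal_caterpillar:
  fixes B :: "'b ugraph" and G :: "'a ugraph" and Y :: "nat \<Rightarrow> int"
  assumes d: "2 \<le> d" and dn: "d < n"
    and B: "caterpillar B d v att" "card (verts B) = n"
    and Y: "Y d = 2 - int n" "\<And>i. 1 \<le> i \<Longrightarrow> i < d \<Longrightarrow> Y i - Y (Suc i) = 2 + 2 * int (leaf_count B d v att i)"
    and opt: "\<And>z. (\<And>j. 1 \<le> j \<Longrightarrow> j < d - 2 \<Longrightarrow> 2 \<le> z j - z (Suc j)) \<Longrightarrow>
      (\<And>j. j \<in> {1..d - 2} \<Longrightarrow> even (z j + int n)) \<Longrightarrow>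
      cost n d (\<lambda>j. Y (Suc j)) \<le> cost n d z \<and>
      (cost n d z = cost n d (\<lambda>j. Y (Suc j)) \<longrightarrow>
        (\<forall>j\<in>{1..d - 2}. z j = Y (Suc j)) \<or> (\<forall>j\<in>{1..d - 2}. z j = - Y (d - j)))"
    and G: "G \<in> trees_with_diam n d"
  shows "T_meet B \<le> T_meet G \<and> (T_meet G = T_meet B \<longleftrightarrow> graph_iso G B)"
proof -
  let ?c = "cost n d (\<lambda>j. Y (Suc j))"
  have TB: "T_meet B = ennreal (meet_value n d ?c)" and Y1: "Y 1 = int n - 2"
    using caterpillar_T_meet[OF B(1) d B(2) Y] by auto
  have GT: "is_tree G" and n: "card (verts G) = n" and diamG: "diam G = d"
    using G by (auto simp: trees_with_diam_def)
  obtain r p dep u where S: "spined_tree G r p dep u d"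
    using ex_spined_tree_of_diam[OF GT diamG d] by blast
  interpret spined_tree G r p dep u d by (rule S)
  \<comment> \<open>The excess of the off-spine edges over the value 1 that each would contribute if
    pendant.\<close>
  define R where "R = (\<Sum>a\<in>off. (2 * int (card (desc a)) - 1)\<^sup>2) - int (card off)"
  define z where "z j = y (Suc j)" for j
  have R: "0 \<le> R" using off_sum_ge by (simp add: R_def)
  have z: "?c \<le> cost n d z" "cost n d z = ?c \<longrightarrow>
        (\<forall>j\<in>{1..d - 2}. z j = Y (Suc j)) \<or> (\<forall>j\<in>{1..d - 2}. z j = - Y (d - j))"
    using opt[of z] y_gap by (auto simp: z_def y_def n)
  have TG: "T_real = meet_value n d (cost n d z + R)"
    unfolding T_real_eq n R_def z_def by (simp add: algebra_simps)
  have le: "meet_value n d ?c \<le> T_real"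
    unfolding TG using meet_value_mono[of n d] z(1) R d dn by simp
  have "T_meet B \<le> T_meet G"
    using T_meet_ge le unfolding TB by (meson ennreal_leI order_trans)
  moreover have "graph_iso G B" if eq: "T_meet G = T_meet B"
  proof -
    have "ennreal T_real \<le> ennreal (meet_value n d ?c)" using T_meet_ge eq TB by simp
    \<comment> \<open>Since \<open>ennreal\<close> sends negative reals to 0, the comparison returns
      to the reals through the nonnegativity of the right-hand side.\<close>
    then have "T_real \<le> meet_value n d ?c"
      using meet_value_nonneg[OF dn cost_nonneg] dn by (simp add: ennreal_le_iff)
    then have "cost n d z + R \<le> ?c" unfolding TG using meet_value_mono[of n d] d dn by simp
    then have R0: "R = 0" and zc: "cost n d z = ?c" using z(1) R by auto
    interpret rooted_caterpillar G r p dep u d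
    proof
      fix x assume "x \<in> off"
      then show "desc x = {x}" using off_sum_eqD[of x] R0 by (simp add: R_def)
    qed
    obtain att' where C: "caterpillar G d u att'"
      and p: "\<forall>x\<in>verts G - u ` {0..d}. p x = u (att' x)"
      using ex_caterpillar by blast
    have att': "p x = u (att' x) \<and> att' x \<le> d" if "x \<in> verts G - u ` {0..d}" for x
    proof -
      have "att' x \<in> {1..d - 1}" using C that by (simp add: caterpillar_def)
      then show ?thesis using p that by auto
    qed
    have yl: "y i - y (Suc i) = 2 + 2 * int (leaf_count G d u att' i)" if "1 \<le> i" "i < d" for i
      using y_step_leaf_count[OF _ that] att' by blast
    consider "\<forall>j\<in>{1..d - 2}. z j = Y (Suc j)" | "\<forall>j\<in>{1..d - 2}. z j = - Y (d - j)"
      using z(2) zc by blast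
    then show ?thesis
    proof cases
      case 1
      have yY: "y i = Y i" if i: "1 \<le> i" "i \<le> d" for i
      proof -
        consider "i = 1" | "i = d" | "i - 1 \<in> {1..d - 2}" using i by force
        then show ?thesis
        proof cases
          case 3
          then show ?thesis using 1 i by (force simp: z_def)
        qed (simp_all add: y_first[simplified] Y1[simplified] y_last Y n)
      qed
      have "leaf_count G d u att' i = leaf_count B d v att i" if i: "1 \<le> i" "i < d" for i
        using yl[OF i] Y(2)[OF i] yY[of i] yY[of "Suc i"] i by simp
      then show ?thesis by (intro caterpillar_iso[OF C B(1)]) auto
    next
      case 2
      have yY: "y i = - Y (d + 1 - i)" if i: "1 \<le> i" "i \<le> d" for i
      proof -
        consider "i = 1" | "i = d" | "i - 1 \<in> {1..d - 2}" using i by force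
        then show ?thesis
        proof cases
          case 3
          then have "z (i - 1) = - Y (d - (i - 1))" using 2 by blast
          then show ?thesis using i 3 by (simp add: z_def Suc_diff_le)
        qed (simp_all add: y_first[simplified] Y1[simplified] y_last Y n)
      qed
      have "leaf_count G d u att' i = leaf_count B d v att (d - i)" if i: "1 \<le> i" "i < d" for i
      proof -
        have "y i - y (Suc i) = Y (d - i) - Y (Suc (d - i))"
          using yY[of i] yY[of "Suc i"] i by (simp add: Suc_diff_le)
        then show ?thesis using yl[OF i] Y(2)[of "d - i"] i by simp
      qed
      then show ?thesis
        using caterpillar_reverse[OF B(1)] by (intro caterpillar_iso[OF C]) auto
    qed
  qed
  moreover have "T_meet G = T_meet B" if iso: "graph_iso G B"
  proof -
    obtain v' att' where C: "caterpillar G d v' att'" and l: "leaf_count G d v' att' = leaf_count B d v att"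
      using iso_caterpillar[OF iso B(1)] GT by (auto simp: is_tree_def)
    show ?thesis unfolding TB by (rule caterpillar_T_meet(1)[OF C d n]) (simp_all add: l Y)
  qed
  ultimately show ?thesis by blast
qed

section \<open>Balanced brooms\<close>


text \<open>Turns the double broom into the near double broom, the new leaf being the
  singleton.\<close>

lemma caterpillar_insert_leaf:
  assumes C: "caterpillar G d v att" and x: "x \<notin> verts G" and k: "k \<in> {1..d - 1}"
    and H: "H = \<lparr>verts = insert x (verts G), edges = insert {x, v k} (edges G)\<rparr>"
  shows "caterpillar H d v (att(x := k))"
    and "leaf_count H d v (att(x := k)) i = leaf_count G d v att i + of_bool (i = k)"
proof -
  let ?S = "v ` {0..d}" and ?a = "att(x := k)"
  have fin: "finite (verts G)" and inj: "inj_on v {0..d}" and sub: "?S \<subseteq> verts G"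
    and att: "\<forall>z\<in>verts G - ?S. att z \<in> {1..d - 1}"
    and E: "edges G = (\<lambda>i. {v i, v (Suc i)}) ` {0..<d} \<union> (\<lambda>z. {z, v (att z)}) ` (verts G - ?S)"
    using C by (simp_all add: caterpillar_def)
  have VH: "verts H = insert x (verts G)" and EH: "edges H = insert {x, v k} (edges G)"
    by (simp_all add: H)
  have X: "verts H - ?S = insert x (verts G - ?S)" using sub x by (auto simp: VH)
  have "(\<lambda>z. {z, v (?a z)}) ` (verts G - ?S) = (\<lambda>z. {z, v (att z)}) ` (verts G - ?S)"
    using x by (intro image_cong) auto
  then have "(\<lambda>z. {z, v (?a z)}) ` (verts H - ?S) =
      insert {x, v k} ((\<lambda>z. {z, v (att z)}) ` (verts G - ?S))"
    unfolding X by simp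
  then have "edges H = (\<lambda>i. {v i, v (Suc i)}) ` {0..<d} \<union> (\<lambda>z. {z, v (?a z)}) ` (verts H - ?S)"
    unfolding EH E by simp
  moreover have "?a z \<in> {1..d - 1}" if "z \<in> verts H - ?S" for z
    using that att k unfolding X by auto
  ultimately show "caterpillar H d v ?a"
    unfolding caterpillar_def using fin inj sub by (simp add: VH subset_insertI2)
  have "{z \<in> verts H - ?S. ?a z = i} = {z \<in> verts G - ?S. att z = i} \<union> (if i = k then {x} else {})"
    unfolding X using x by auto
  then show "leaf_count H d v ?a i = leaf_count G d v att i + of_bool (i = k)"
    unfolding leaf_count_def using fin x by simp
qed

section \<open>Double brooms as caterpillars\<close>

definition broom_spine :: "nat \<Rightarrow> nat \<Rightarrow> broom_vertex" where
  "broom_spine d i = (if i = 0 then LeftLeaf 1 else if i = d then RightLeaf 1 else Path i)"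

text \<open>Meant for leaves off the spine; the default branch handles the right leaves.\<close>

definition broom_attach :: "nat \<Rightarrow> broom_vertex \<Rightarrow> nat" where
  "broom_attach d x = (case x of LeftLeaf _ \<Rightarrow> 1 | _ \<Rightarrow> d - 1)"

lemma broom_spine_image:
  assumes "2 \<le> d"
  shows "broom_spine d ` {0..d} = insert (LeftLeaf 1) (insert (RightLeaf 1) (Path ` {1..d - 1}))"
proof -
  have set: "{0..d} = insert 0 (insert d {1..d - 1})" using assms by auto
  have inner: "broom_spine d ` {1..d - 1} = Path ` {1..d - 1}"
    using assms by (intro image_cong) (auto simp: broom_spine_def)
  have ends: "broom_spine d 0 = LeftLeaf 1" "broom_spine d d = RightLeaf 1"
    using assms by (simp_all add: broom_spine_def)
  show ?thesis unfolding set image_insert inner ends ..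
qed

lemma double_broom_off:
  assumes "2 \<le> d"
  shows "verts (double_broom d l r) - broom_spine d ` {0..d} = LeftLeaf ` {2..l} \<union> RightLeaf ` {2..r}"
  unfolding broom_spine_image[OF assms] by (auto simp: double_broom_def)

text \<open>One leaf on each side is an end of the spine, hence l - 1 and r - 1. The bound 3 \<le> d
  keeps the two attachment vertices apart.\<close>

lemma double_broom_caterpillar:
  assumes d: "3 \<le> d" and l: "1 \<le> l" "1 \<le> r"
  shows "caterpillar (double_broom d l r) d (broom_spine d) (broom_attach d)"
    and "leaf_count (double_broom d l r) d (broom_spine d) (broom_attach d) i =
      (if i = 1 then l - 1 else if i = d - 1 then r - 1 else 0)"
    and "card (verts (double_broom d l r)) = d - 1 + l + r"
proof -
  let ?B = "double_broom d l r" and ?v = "broom_spine d" and ?X = "LeftLeaf ` {2..l} \<union> RightLeaf ` {2..r}"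
  have d2: "2 \<le> d" using d by simp
  have inj: "inj_on ?v {0..d}" by (auto simp: inj_on_def broom_spine_def)
  have sub: "?v ` {0..d} \<subseteq> verts ?B"
    unfolding broom_spine_image[OF d2] using l by (auto simp: double_broom_def)
  have "(\<lambda>i. {?v i, ?v (Suc i)}) ` {0..<d} = insert {LeftLeaf 1, Path 1}
      (insert {RightLeaf 1, Path (d - 1)} ((\<lambda>i. {Path i, Path (i + 1)}) ` {1..<d - 1}))"
  proof -
    have set: "{0..<d} = insert 0 (insert (d - 1) {1..<d - 1})" using d by auto
    have inner: "(\<lambda>i. {?v i, ?v (Suc i)}) ` {1..<d - 1} = (\<lambda>i. {Path i, Path (i + 1)}) ` {1..<d - 1}"
      by (intro image_cong) (auto simp: broom_spine_def)
    have ends: "?v 0 = LeftLeaf 1" "?v (Suc 0) = Path 1" "?v (d - 1) = Path (d - 1)"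
        "?v (Suc (d - 1)) = RightLeaf 1"
      using d by (auto simp: broom_spine_def)
    show ?thesis unfolding set image_insert inner ends by (simp add: insert_commute)
  qed
  moreover have "(\<lambda>x. {x, ?v (broom_attach d x)}) ` ?X =
      (\<lambda>j. {LeftLeaf j, Path 1}) ` {2..l} \<union> (\<lambda>j. {RightLeaf j, Path (d - 1)}) ` {2..r}"
    unfolding image_Un image_image using d by (simp add: broom_spine_def broom_attach_def)
  moreover have "{1..l} = insert 1 {2..l}" "{1..r} = insert 1 {2..r}" using l by auto
  ultimately have "edges ?B = (\<lambda>i. {?v i, ?v (Suc i)}) ` {0..<d} \<union> (\<lambda>x. {x, ?v (broom_attach d x)}) ` ?X"
    unfolding double_broom_def by auto
  moreover have "broom_attach d x \<in> {1..d - 1}" if "x \<in> ?X" for x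
    using that d by (auto simp: broom_attach_def)
  ultimately show "caterpillar ?B d ?v (broom_attach d)"
    unfolding caterpillar_def double_broom_off[OF d2] using inj sub
    by (auto simp: double_broom_def)
  have "{x \<in> ?X. broom_attach d x = i} =
      (if i = 1 then LeftLeaf ` {2..l} else if i = d - 1 then RightLeaf ` {2..r} else {})"
    using d by (auto simp: broom_attach_def)
  then show "leaf_count ?B d ?v (broom_attach d) i = (if i = 1 then l - 1 else if i = d - 1 then r - 1 else 0)"
    unfolding leaf_count_def double_broom_off[OF d2] by (simp add: card_image inj_on_def)
  have "card (verts ?B) = card (Path ` {1..d - 1}) + card (LeftLeaf ` {1..l}) + card (RightLeaf ` {1..r})"
    unfolding double_broom_def by (simp, subst card_Un_disjoint; (subst card_Un_disjoint)?) auto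
  then show "card (verts ?B) = d - 1 + l + r" by (simp add: card_image inj_on_def)
qed

text \<open>Here n + 1 = d + 2 l, so both sides carry l leaves and the inner sequence is the centred
  run. Its sum is 0, so the penalty vanishes, and the case c = 0 of
  \<open>sum_shifted_squares_ge\<close> gives optimality and uniqueness. The zero sum is also why
  \<open>RightLeaf 1\<close> attains the maximum.\<close>

lemma balanced_double_broom_extremal:
  assumes d: "4 \<le> d" and dn: "d < n" and par: "odd (n + d)"
  shows "balanced_double_broom n d \<in> trees_with_diam n d"
    and "G \<in> trees_with_diam n d \<Longrightarrow> T_meet (balanced_double_broom n d) \<le> T_meet G \<and>
      (T_meet G = T_meet (balanced_double_broom n d) \<longleftrightarrow> graph_iso G (balanced_double_broom n d))"
    and "T_meet (balanced_double_broom n d) = H_stat (balanced_double_broom n d) (RightLeaf 1)"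
    and "T_meet (balanced_double_broom n d) = ennreal (1/2 * (real d + 2) * real n
            + (real d ^ 3 - 6 * real d ^ 2 + 8 * real d) / (6 * (real n - 1)) - 1/2 * (real d + 5))"
proof -
  obtain l where l: "n + 1 = d + 2 * l"
  proof -
    have "even (n + 1 - d)" using par dn by auto
    then obtain l where "n + 1 - d = 2 * l" by (rule evenE)
    then show ?thesis using dn by (intro that[of l]) auto
  qed
  have l1: "1 \<le> l" using l dn by simp
  have "(n - d + 1) div 2 = l" "(n - d + 1 + 1) div 2 = l" using l dn by auto
  then have B: "balanced_double_broom n d = double_broom d l l"
    by (simp add: balanced_double_broom_def)
  have d3: "3 \<le> d" and d2: "2 \<le> d" using d by auto
  note C = double_broom_caterpillar[OF d3 l1 l1]
  have n: "card (verts (double_broom d l l)) = n" using C(3) l d by simp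
  define Y where "Y i = (if i = 1 then int n - 2 else if i = d then 2 - int n else int d + 1 - 2 * int i)" for i
  have nl: "int n = int d + 2 * int l - 1" using l by linarith
  have Yd: "Y d = 2 - int n" using d by (simp add: Y_def)
  have Ystep: "Y i - Y (Suc i) = 2 + 2 * int (leaf_count (double_broom d l l) d (broom_spine d) (broom_attach d) i)"
    if "1 \<le> i" "i < d" for i
    using that d l1 unfolding C(2) Y_def by (auto simp: nl of_nat_diff)
  have Yc: "Y (Suc j) = int (d - 2) + 1 - 2 * int j" if "j \<in> {1..d - 2}" for j
    using that d by (auto simp: Y_def of_nat_diff)
  let ?c = "\<Sum>j=1..d - 2. (int (d - 2) + 1 - 2 * int j)\<^sup>2"
  have sumY: "(\<Sum>j=1..d - 2. Y (Suc j)) = 0"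
  proof -
    have "(\<Sum>j=1..d - 2. Y (Suc j)) = (\<Sum>j=1..d - 2. int (d - 2) + 1 - 2 * int j)"
      by (intro sum.cong) (auto simp: Yc)
    also have "\<dots> = int (d - 2) * (int (d - 2) + 1) - 2 * (\<Sum>j=1..d - 2. int j)"
      by (simp add: sum_subtractf sum_distrib_left)
    finally show ?thesis unfolding sum_of_nat_Suc by simp
  qed
  have costY: "cost n d (\<lambda>j. Y (Suc j)) = ?c"
  proof -
    have "(\<Sum>j=1..d - 2. (Y (Suc j))\<^sup>2) = ?c" by (intro sum.cong) (auto simp: Yc)
    then show ?thesis unfolding cost_def sumY by simp
  qed
  show "balanced_double_broom n d \<in> trees_with_diam n d"
    unfolding B trees_with_diam_def using caterpillar_tree_diam[OF C(1) d2] n by simp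
  show "T_meet (balanced_double_broom n d) \<le> T_meet G \<and>
      (T_meet G = T_meet (balanced_double_broom n d) \<longleftrightarrow> graph_iso G (balanced_double_broom n d))"
    if G: "G \<in> trees_with_diam n d"
    unfolding B
  proof (rule extremal_caterpillar[OF d2 dn C(1) n Yd Ystep _ G])
    fix z :: "nat \<Rightarrow> int" assume gap: "\<And>j. 1 \<le> j \<Longrightarrow> j < d - 2 \<Longrightarrow> 2 \<le> z j - z (Suc j)"
    have sq: "(\<Sum>j=1..d - 2. (z j)\<^sup>2) \<le> cost n d z" unfolding cost_def using dn by simp
    have ge: "?c \<le> (\<Sum>j=1..d - 2. (z j)\<^sup>2)"
      using sum_shifted_squares_ge(1)[of "d - 2" z 0] gap by simp
    have "z j = Y (Suc j)" if "cost n d z = ?c" "j \<in> {1..d - 2}" for j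
    proof -
      have "(\<Sum>j=1..d - 2. (z j)\<^sup>2) = ?c" using that(1) sq ge by simp
      then show ?thesis
        using sum_shifted_squares_ge(2)[of "d - 2" z 0 j] gap that(2) Yc by simp
    qed
    then show "cost n d (\<lambda>j. Y (Suc j)) \<le> cost n d z \<and>
      (cost n d z = cost n d (\<lambda>j. Y (Suc j)) \<longrightarrow>
        (\<forall>j\<in>{1..d - 2}. z j = Y (Suc j)) \<or> (\<forall>j\<in>{1..d - 2}. z j = - Y (d - j)))"
      unfolding costY using sq ge by auto
  qed
  show "T_meet (balanced_double_broom n d) = H_stat (balanced_double_broom n d) (RightLeaf 1)"
    unfolding B using caterpillar_T_meet(3)[where Y = Y, OF C(1) d2 n Yd Ystep sumY] d by (simp add: broom_spine_def)
  have c3: "3 * ?c = (int d - 2) * ((int d - 2)\<^sup>2 - 1)"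
    using sum_centered_squares[of "d - 2"] d by (simp add: of_nat_diff)
  have "3 * real_of_int ?c = real_of_int ((int d - 2) * ((int d - 2)\<^sup>2 - 1))"
    by (subst c3[symmetric]) simp
  then have c: "real_of_int ?c = (real d - 2) * ((real d - 2)\<^sup>2 - 1) / 3" by simp
  have meet: "meet_value n d ?c = 1/2 * (real d + 2) * real n
            + (real d ^ 3 - 6 * real d ^ 2 + 8 * real d) / (6 * (real n - 1)) - 1/2 * (real d + 5)"
  proof -
    define m where "m = real n - 1"
    have m: "m \<noteq> 0" "real n = m + 1" using dn d by (auto simp: m_def)
    show ?thesis
      unfolding meet_value_def of_int_add c using m
      by (simp add: field_simps power2_eq_square power3_eq_cube)
  qed
  show "T_meet (balanced_double_broom n d) = ennreal (1/2 * (real d + 2) * real n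
            + (real d ^ 3 - 6 * real d ^ 2 + 8 * real d) / (6 * (real n - 1)) - 1/2 * (real d + 5))"
    unfolding B meet[symmetric] costY[symmetric]
    by (rule caterpillar_T_meet(1)[where Y = Y, OF C(1) d2 n Yd]) (rule Ystep)
qed

text \<open>Here n = d + 2 l, so a double broom with l leaves on each side leaves one vertex over.
  As the singleton it widens one gap of the inner sequence from 2 to 4, which produces
  \<open>skip_middle\<close>.\<close>

lemma balanced_near_double_broom_extremal:
  assumes d: "4 \<le> d" and dn: "d < n" and par: "even (n + d)"
  shows "balanced_near_double_broom n d \<in> trees_with_diam n d"
    and "G \<in> trees_with_diam n d \<Longrightarrow> T_meet (balanced_near_double_broom n d) \<le> T_meet G \<and>
      (T_meet G = T_meet (balanced_near_double_broom n d) \<longleftrightarrow> graph_iso G (balanced_near_double_broom n d))"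
    and "T_meet (balanced_near_double_broom n d) = ennreal (if even d
            then 1/2 * (real d + 2) * real n
              + (real d ^ 3 - 3 * real d ^ 2 - real d + 6) / (6 * (real n - 1)) - 1/2 * (real d + 5)
            else 1/2 * (real d + 2) * real n
              + (real d ^ 3 - 3 * real d ^ 2 - real d + 3) / (6 * (real n - 1)) - 1/2 * (real d + 3))"
proof -
  obtain l where l: "n = d + 2 * l"
  proof -
    have "even (n - d)" using par dn by auto
    then obtain l where "n - d = 2 * l" by (rule evenE)
    then show ?thesis using dn by (intro that[of l]) auto
  qed
  have l1: "1 \<le> l" using l dn by simp
  let ?D = "double_broom d l l" and ?v = "broom_spine d"
  define N where "N = d - 2"
  define B where "B = \<lparr>verts = insert Singleton (verts ?D), edges = insert {Singleton, ?v (d div 2)} (edges ?D)\<rparr>"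
  have dd: "d div 2 \<in> {1..d - 1}" "d div 2 \<noteq> 0" "d div 2 \<noteq> d" "d div 2 \<noteq> 1" "d div 2 \<noteq> d - 1"
    using d by auto
  have "(n - d) div 2 = l" "(n - d + 1) div 2 = l" using l dn by auto
  then have B: "balanced_near_double_broom n d = B"
    using dd by (simp add: balanced_near_double_broom_def Let_def B_def broom_spine_def)
  have d3: "3 \<le> d" and d2: "2 \<le> d" using d by auto
  note C0 = double_broom_caterpillar[OF d3 l1 l1]
  have new: "Singleton \<notin> verts ?D" by (auto simp: double_broom_def)
  let ?att = "(broom_attach d)(Singleton := d div 2)"
  note C = caterpillar_insert_leaf[OF C0(1) new dd(1) B_def]
  have n: "card (verts B) = n"
  proof -
    have "finite (verts ?D)" by (simp add: double_broom_def)
    then show ?thesis using C0(3) l d new by (simp add: B_def)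
  qed
  \<comment> \<open>The inner sequence is indexed by i - 1. Its wide gap follows entry N div 2, so
    the singleton sits at spine index N div 2 + 1 = d div 2.\<close>
  define Y where "Y i = (if i = 1 then int n - 2 else if i = d then 2 - int n else skip_middle N (i - 1))" for i
  have nl: "int n = int d + 2 * int l" using l by linarith
  have Yd: "Y d = 2 - int n" using d by (simp add: Y_def)
  have Ystep: "Y i - Y (Suc i) = 2 + 2 * int (leaf_count B d ?v ?att i)" if i: "1 \<le> i" "i < d" for i
  proof -
    have N: "int N = int d - 2" "N div 2 = d div 2 - 1" using d by (auto simp: N_def of_nat_diff)
    consider "i = 1" | "i = d - 1" | "i = d div 2" | "i \<noteq> 1" "i \<noteq> d - 1" "i \<noteq> d div 2" by blast
    then show ?thesis
      unfolding C(2) C0(2)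
    proof cases
      case 1
      then show "Y i - Y (Suc i) = 2 + 2 * int ((if i = 1 then l - 1 else if i = d - 1 then l - 1 else 0)
          + of_bool (i = d div 2))"
        using d l1 dd by (simp add: Y_def skip_middle_def N nl of_nat_diff)
    next
      case 2
      then have i2: "Suc i = d" "i \<noteq> Suc 0" "d \<noteq> Suc 0" "i \<noteq> d" "\<not> i - 1 \<le> N div 2" "int (i - 1) = int d - 2"
          "i \<noteq> d div 2" "d - 1 = i"
        using d dd unfolding N(2) by (auto simp: of_nat_diff)
      then show "Y i - Y (Suc i) = 2 + 2 * int ((if i = 1 then l - 1 else if i = d - 1 then l - 1 else 0)
          + of_bool (i = d div 2))"
        using l1 i2(6,5) by (simp add: i2 Y_def skip_middle_def N(1) nl of_nat_diff)
    next
      case 3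
      then have i3: "Suc i \<noteq> d" "i \<noteq> Suc 0" "i \<noteq> d" "i \<noteq> 0" "i - Suc 0 \<le> N div 2" "\<not> i \<le> N div 2"
          "int (i - Suc 0) = int i - 1" "i \<noteq> d - Suc 0" "d div 2 = i"
        using d dd unfolding N(2) by (auto simp: of_nat_diff)
      show "Y i - Y (Suc i) = 2 + 2 * int ((if i = 1 then l - 1 else if i = d - 1 then l - 1 else 0)
          + of_bool (i = d div 2))"
        by (simp add: i3 Y_def skip_middle_def N(1) of_nat_diff)
    next
      case 4
      have "i - 1 \<le> N div 2 \<longleftrightarrow> i \<le> N div 2" unfolding N(2) using 4 i dd(2) by arith
      moreover have "Suc i \<noteq> d" using 4 by auto
      ultimately show "Y i - Y (Suc i) = 2 + 2 * int ((if i = 1 then l - 1 else if i = d - 1 then l - 1 else 0)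
          + of_bool (i = d div 2))"
        using d 4 i by (simp add: Y_def skip_middle_def of_nat_diff)
    qed
  qed
  have Yc: "Y (Suc j) = skip_middle N j" if "j \<in> {1..d - 2}" for j
    using that d by (auto simp: Y_def)
  have Yrev: "- Y (d - j) = - skip_middle N (N + 1 - j)" if "j \<in> {1..d - 2}" for j
  proof -
    have "N + 1 - j \<in> {1..d - 2}" "Suc (N + 1 - j) = d - j" using that d by (auto simp: N_def)
    then show ?thesis using Yc[of "N + 1 - j"] by simp
  qed
  have costY: "cost n d (\<lambda>j. Y (Suc j)) = cost n d (skip_middle N)"
    by (rule cost_cong) (rule Yc)
  show "balanced_near_double_broom n d \<in> trees_with_diam n d"
    unfolding B trees_with_diam_def using caterpillar_tree_diam[OF C(1) d2] n by simp
  show "T_meet (balanced_near_double_broom n d) \<le> T_meet G \<and>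
      (T_meet G = T_meet (balanced_near_double_broom n d) \<longleftrightarrow> graph_iso G (balanced_near_double_broom n d))"
    if G: "G \<in> trees_with_diam n d"
    unfolding B
  proof (rule extremal_caterpillar[OF d2 dn C(1) n Yd Ystep _ G])
    fix z :: "nat \<Rightarrow> int" assume gap: "\<And>j. 1 \<le> j \<Longrightarrow> j < d - 2 \<Longrightarrow> 2 \<le> z j - z (Suc j)"
      and ev: "\<And>j. j \<in> {1..d - 2} \<Longrightarrow> even (z j + int n)"
    have ev': "even (z j + int N)" if "j \<in> {1..N}" for j
      using ev[of j] that d by (simp add: N_def nl of_nat_diff)
    \<comment> \<open>Equal parity and d < n give n >= d + 2, which is the required lower bound N +
      3 on the weight n - 1.\<close>
    have N2: "2 \<le> N" and Nn: "int N + 3 \<le> int n - 1" using d l1 by (auto simp: N_def nl of_nat_diff)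
    have gap': "2 \<le> z j - z (Suc j)" if "1 \<le> j" "j < N" for j
      using gap that by (simp add: N_def)
    note opt = skip_middle_optimal[of N z, OF gap' N2 ev' Nn]
    show "cost n d (\<lambda>j. Y (Suc j)) \<le> cost n d z \<and>
      (cost n d z = cost n d (\<lambda>j. Y (Suc j)) \<longrightarrow>
        (\<forall>j\<in>{1..d - 2}. z j = Y (Suc j)) \<or> (\<forall>j\<in>{1..d - 2}. z j = - Y (d - j)))"
      unfolding costY using opt Yc Yrev by (simp add: cost_def N_def[symmetric])
  qed
  have N: "int N = int d - 2" "N mod 2 = d mod 2" using d by (auto simp: N_def of_nat_diff mod_if)
  let ?c = "\<Sum>j=1..N. (int N + 1 - 2 * int j)\<^sup>2" and ?e = "int (d mod 2)"
  \<comment> \<open>After division by 2 (n - 1), the penalty of an odd d adds 1 and turns d + 5 into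
    d + 3, while - ?e turns the constant 6 of the numerator into 3.\<close>
  have "cost n d (skip_middle N) = ?c + (int N)\<^sup>2 + int N - ?e + 2 * (int n - 1) * ?e"
    unfolding cost_def N_def[symmetric] sum_skip_middle_squares sum_skip_middle N by simp
  then have "3 * cost n d (skip_middle N) =
      3 * ?c + 3 * ((int N)\<^sup>2 + int N - ?e + 2 * (int n - 1) * ?e)" by simp
  also have "\<dots> = (int d - 2) * ((int d - 2)\<^sup>2 - 1)
      + 3 * ((int d - 2)\<^sup>2 + (int d - 2) - ?e + 2 * (int n - 1) * ?e)"
    unfolding sum_centered_squares unfolding N ..
  finally have "real_of_int (3 * cost n d (skip_middle N)) = real_of_int ((int d - 2) * ((int d - 2)\<^sup>2 - 1)
      + 3 * ((int d - 2)\<^sup>2 + (int d - 2) - ?e + 2 * (int n - 1) * ?e))" by (rule arg_cong)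
  then have c: "real_of_int (cost n d (skip_middle N)) = ((real d - 2) * ((real d - 2)\<^sup>2 - 1)
      + 3 * ((real d - 2)\<^sup>2 + (real d - 2) - of_bool (odd d) + 2 * (real n - 1) * of_bool (odd d))) / 3"
    by (cases "even d") (simp_all add: odd_iff_mod_2_eq_one[THEN iffD1])
  have meet: "meet_value n d (cost n d (skip_middle N)) = (if even d
            then 1/2 * (real d + 2) * real n
              + (real d ^ 3 - 3 * real d ^ 2 - real d + 6) / (6 * (real n - 1)) - 1/2 * (real d + 5)
            else 1/2 * (real d + 2) * real n
              + (real d ^ 3 - 3 * real d ^ 2 - real d + 3) / (6 * (real n - 1)) - 1/2 * (real d + 3))"
  proof -
    define m where "m = real n - 1"
    have m: "m \<noteq> 0" "real n = m + 1" using dn d by (auto simp: m_def)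
    show ?thesis
      unfolding meet_value_def of_int_add c using m
      by (cases "even d") (simp_all add: field_simps power2_eq_square power3_eq_cube)
  qed
  show "T_meet (balanced_near_double_broom n d) = ennreal (if even d
            then 1/2 * (real d + 2) * real n
              + (real d ^ 3 - 3 * real d ^ 2 - real d + 6) / (6 * (real n - 1)) - 1/2 * (real d + 5)
            else 1/2 * (real d + 2) * real n
              + (real d ^ 3 - 3 * real d ^ 2 - real d + 3) / (6 * (real n - 1)) - 1/2 * (real d + 3))"
    unfolding B meet[symmetric] costY[symmetric]
    by (rule caterpillar_T_meet(1)[where Y = Y, OF C(1) d2 n Yd]) (rule Ystep)
qed

theorem theorem1p8:
  fixes n d :: nat
  assumes "4 \<le> d" and "d < n"
  shows
    "(odd (n + d) \<longrightarrow>
        balanced_double_broom n d \<in> trees_with_diam n d \<and>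
        (\<forall>G :: 'a ugraph. G \<in> trees_with_diam n d \<longrightarrow>
           T_meet (balanced_double_broom n d) \<le> T_meet G \<and>
           (T_meet G = T_meet (balanced_double_broom n d) \<longleftrightarrow>
              graph_iso G (balanced_double_broom n d))) \<and>
        T_meet (balanced_double_broom n d) =
          H_stat (balanced_double_broom n d) (RightLeaf 1) \<and>
        T_meet (balanced_double_broom n d) =
          ennreal (1/2 * (real d + 2) * real n
            + (real d ^ 3 - 6 * real d ^ 2 + 8 * real d) / (6 * (real n - 1))
            - 1/2 * (real d + 5))) \<and>
     (even (n + d) \<longrightarrow>
        balanced_near_double_broom n d \<in> trees_with_diam n d \<and>
        (\<forall>G :: 'a ugraph. G \<in> trees_with_diam n d \<longrightarrow>
           T_meet (balanced_near_double_broom n d) \<le> T_meet G \<and>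
           (T_meet G = T_meet (balanced_near_double_broom n d) \<longleftrightarrow>
              graph_iso G (balanced_near_double_broom n d))) \<and>
        T_meet (balanced_near_double_broom n d) =
          ennreal (if even d
            then 1/2 * (real d + 2) * real n
              + (real d ^ 3 - 3 * real d ^ 2 - real d + 6) / (6 * (real n - 1))
              - 1/2 * (real d + 5)
            else 1/2 * (real d + 2) * real n
              + (real d ^ 3 - 3 * real d ^ 2 - real d + 3) / (6 * (real n - 1))
              - 1/2 * (real d + 3)))"
  using balanced_double_broom_extremal[OF assms] balanced_near_double_broom_extremal[OF assms]
  by blast

end
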